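(* Consider the generalized polynomial Liénard system $$\dot x=y,\qquad \dot y=-g(x)-f(x)y,\qquad g(x)=\sum_{i=k}^{m}a_ix^i,\quad f(x)=\sum_{i=s}^{n}b_ix^i,$$ with $m,n,k,s\in\mathbb N$ and $a_ka_mb_sb_n\neq0$. When $n=1$, $P_\infty$ is a center at infinity of this system if and only if the system can be rescaled to the form $$\dot x=y,\qquad \dot y=-g(x)-bxy,$$ where $g(x)$ is an odd function with $m\ge3$, and $a_m$, $b$ satisfy $a_m>b^2/8>0$ when $m=3$ and $a_m>0$ when $m>3$.
   Context: All coefficients are real, and the dot denotes the derivative with respect to $t$. Here $m=\deg g$, $n=\deg f$, and $a_m$ is the leading coefficient of $g$. The Poincaré disc is the closed unit disc obtained by projecting the phase plane centrally onto a hemisphere of the unit sphere and then projecting vertically; the interior of the disc corresponds to the phase plane and the boundary circle to the points at infinity (diametrically opposite points in pairs). $P_\infty$ denotes infinity regarded as a single point, as if the boundary circle were collapsed to a point; $P_\infty$ is called a center at infinity of a planar differential system if there is a neighborhood $U$ of the unit circle in the Poincaré disc that is filled with closed orbits. *)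

theory Defs
  imports "HOL-Analysis.Analysis" "HOL-Computational_Algebra.Polynomial"
begin

type_synonym plane = "real \<times> real"

text \<open>The phase plane is identified with the tangent plane \<open>z = 1\<close> of the unit sphere at its
  north pole; the image of the projection below is the open unit disc, and the unit circle
  carries the points at infinity.\<close>

definition central_projection :: "plane \<Rightarrow> real \<times> real \<times> real" where
  "central_projection = (\<lambda>(x, y). (x, y, 1) /\<^sub>R norm (x, y, 1 :: real))"

definition vertical_projection :: "real \<times> real \<times> real \<Rightarrow> plane" where
  "vertical_projection = (\<lambda>(u, v, w). (u, v))"

definition poincare_projection :: "plane \<Rightarrow> plane" where
  "poincare_projection p = vertical_projection (central_projection p)"

definition poincare_disc :: "plane set" where
  "poincare_disc = cball 0 1"

definition infinity_circle :: "plane set" where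
  "infinity_circle = sphere 0 1"

definition closed_orbit :: "(plane \<Rightarrow> plane) \<Rightarrow> plane set \<Rightarrow> bool" where
  "closed_orbit V C \<longleftrightarrow>
     (\<exists>\<phi> :: real \<Rightarrow> plane. \<exists>T > 0.
        (\<forall>t. (\<phi> has_vector_derivative V (\<phi> t)) (at t)) \<and>
        (\<forall>t. \<phi> (t + T) = \<phi> t) \<and>
        \<not> \<phi> constant_on UNIV \<and>
        C = range \<phi>)"

text \<open>The circle at infinity itself usually contains equilibria of the compactified field, so it is
  the part of the neighbourhood \<open>U\<close> in the open disc that is filled with closed orbits.\<close>

definition center_at_infinity :: "(plane \<Rightarrow> plane) \<Rightarrow> bool" where
  "center_at_infinity V \<longleftrightarrow>
     (\<exists>U \<subseteq> poincare_disc.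
        (\<exists>W. openin (top_of_set poincare_disc) W \<and> infinity_circle \<subseteq> W \<and> W \<subseteq> U) \<and>
        (\<exists>\<C>. (\<forall>C \<in> \<C>. closed_orbit V C) \<and>
             U - infinity_circle = (\<Union>C \<in> \<C>. poincare_projection ` C)))"

definition lienard_field :: "real poly \<Rightarrow> real poly \<Rightarrow> plane \<Rightarrow> plane" where
  "lienard_field g f = (\<lambda>(x, y). (y, - poly g x - poly f x * y))"

text \<open>The change of variables is \<open>x = \<alpha> X + \<beta>\<close>, \<open>y = \<gamma> Y + \<delta>\<close>, \<open>t = \<tau> T\<close>.  Moving the origin has to
  be allowed: a linear \<open>f\<close> with nonzero constant term becomes \<open>b X\<close> only after
  a translation.\<close>

definition rescales_to :: "(plane \<Rightarrow> plane) \<Rightarrow> (plane \<Rightarrow> plane) \<Rightarrow> bool" where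
  "rescales_to V W \<longleftrightarrow>
     (\<exists>\<alpha> \<beta> \<gamma> \<delta> \<tau> :: real. \<alpha> \<noteq> 0 \<and> \<gamma> \<noteq> 0 \<and> \<tau> \<noteq> 0 \<and>
        (\<forall>X Y. W (X, Y) =
           (\<tau> / \<alpha> * fst (V (\<alpha> * X + \<beta>, \<gamma> * Y + \<delta>)),
            \<tau> / \<gamma> * snd (V (\<alpha> * X + \<beta>, \<gamma> * Y + \<delta>)))))"

end

theory Submission imports Defs begin

text \<open>
  A centre at infinity means that every point outside some disc lies on a periodic orbit
  (\<open>center_at_infinity_iff\<close>), a property that affine rescalings preserve. Since \<open>f\<close> is linear with
  nonzero slope, a translation brings the system to \<open>x' = y\<close>, \<open>y' = - h(x) - c x y\<close> with
  \<open>c \<noteq> 0\<close>. In terms of \<open>u = x\<^sup>2 / 2\<close> each half plane looks like an oscillator with constant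
  damping \<open>c\<close> and restoring force \<open>h(x) / x\<close>, so the borderline between rotation and escape is the
  restoring force \<open>c\<^sup>2 u / 4\<close>, that is \<open>h(x) = c\<^sup>2 x\<^sup>3 / 8\<close>. The degree and leading coefficient
  conditions say exactly that \<open>h - c\<^sup>2 x\<^sup>3 / 8\<close> has degree at least three and positive leading
  coefficient.

  \<^bold>\<open>Rotation.\<close> If \<open>h\<close> exceeds the borderline cubic by \<open>\<delta> x\<^sup>3 - B\<close> on \<open>x \<ge> 0\<close>, then far from the
  origin the angle \<open>arctan (2 y / (x + 1)\<^sup>2)\<close> decreases at a rate of at least \<open>\<epsilon> (x + 1)\<close>, while the
  energy \<open>y\<^sup>2 / 2 + G(x)\<close> changes by at most a fixed factor per half turn. Hence orbits cross the
  half plane \<open>x \<ge> 0\<close> in bounded time, stay bounded and stay far out (\<open>half_plane_rotation\<close>).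

  \<^bold>\<open>Sufficiency.\<close> If \<open>h\<close> is odd, the system is invariant under \<open>(x, y, t) \<mapsto> (- x, y, - t)\<close>. An arc in
  \<open>x \<ge> 0\<close> with both ends on the \<open>y\<close>-axis is then closed up by its mirror image
  (\<open>outer_closed_if_odd\<close>). The solutions come from Picard iteration for the field with clipped
  arguments, which is globally Lipschitz.

  \<^bold>\<open>Necessity.\<close> Below the borderline on one side there is a forward invariant region bounded by
  a parabola in which \<open>x\<close> increases for ever (\<open>not_outer_closed_if_escape\<close>). So both \<open>h(x)\<close> and its
  mirror image \<open>- h(- x)\<close> are above the borderline. If they differ, compare on a large periodic
  orbit an arc in \<open>x \<ge> 0\<close> with the reflection of an adjacent arc in \<open>x \<le> 0\<close>. As functions of \<open>x\<close>,
  the energies on the upper and lower branches satisfy \<open>e' = \<mp> c x sqrt (2 (e - G))\<close>, and a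
  differential inequality shows that, for \<open>c > 0\<close>, the arc with the stronger restoring force which
  starts at the same top point ends at a strictly lower bottom point
  (\<open>energy_branch_asymmetry\<close>). Applied at the lowest crossing of the \<open>y\<close>-axis on the orbit, this is
  a contradiction (\<open>not_outer_closed_if_asymmetric\<close>).
\<close>

section \<open>Real functions and antiderivatives\<close>

text \<open>The first time at which a continuous function that starts above a level comes down to it.\<close>

lemma first_hit:
  fixes f :: "real \<Rightarrow> real"
  assumes "continuous_on {a..b} f" "r < f a" "f b \<le> r" "a \<le> b"
  obtains s where "a < s" "s \<le> b" "f s = r" "\<And>t. a \<le> t \<Longrightarrow> t < s \<Longrightarrow> r < f t"
proof -
  define S where "S = {t \<in> {a..b}. f t \<le> r}"
  have "closed S" unfolding S_def
    using assms(1) by (intro continuous_closed_preimage_constant continuous_on_closed_Collect_le continuous_intros) auto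
  moreover have "bounded S" unfolding S_def by (rule bounded_subset[OF bounded_closed_interval[of a b]]) auto
  ultimately have "compact S" by (simp add: compact_eq_bounded_closed)
  moreover have "b \<in> S" using assms by (auto simp: S_def)
  ultimately obtain s where s: "s \<in> S" "\<And>t. t \<in> S \<Longrightarrow> s \<le> t"
    using compact_attains_inf[of S] by blast
  have lt: "r < f t" if "a \<le> t" "t < s" for t
    using s(2)[of t] s(1) that by (force simp: S_def)
  have "a \<noteq> s" using s(1) assms(2) by (auto simp: S_def)
  hence as: "a < s" using s(1) by (auto simp: S_def)
  have "r \<le> f s"
  proof (rule ccontr)
    assume "\<not> r \<le> f s"
    hence "f s < r" by simp
    moreover have "continuous_on {a..s} f"
      using assms(1) by (rule continuous_on_subset) (use s in \<open>auto simp: S_def\<close>)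
    ultimately obtain t where "a \<le> t" "t \<le> s" "f t = r"
      using IVT2'[of f s r a] assms(2) as by auto
    with lt[of t] \<open>f s < r\<close> show False by (cases "t = s") auto
  qed
  with s have "f s = r" by (auto simp: S_def)
  with as s lt show ?thesis by (intro that[of s]) (auto simp: S_def)
qed

lemma deriv_nonneg_mono:
  fixes f :: "real \<Rightarrow> real"
  assumes "a \<le> b" "\<And>t. t \<in> {a..b} \<Longrightarrow> (f has_real_derivative f' t) (at t within {a..b})"
    "\<And>t. t \<in> {a<..<b} \<Longrightarrow> 0 \<le> f' t"
  shows "f a \<le> f b"
proof (rule DERIV_nonneg_imp_increasing_open[OF assms(1)])
  fix x assume "a < x" "x < b"
  then show "\<exists>y. DERIV f x :> y \<and> 0 \<le> y"
    using assms(2)[of x] assms(3)[of x] by (auto simp: at_within_Icc_at)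
next
  show "continuous_on {a..b} f"
    using assms(2) by (meson DERIV_continuous_on)
qed

lemma deriv_nonpos_mono:
  fixes f :: "real \<Rightarrow> real"
  assumes "a \<le> b" "\<And>t. t \<in> {a..b} \<Longrightarrow> (f has_real_derivative f' t) (at t within {a..b})"
    "\<And>t. t \<in> {a<..<b} \<Longrightarrow> f' t \<le> 0"
  shows "f b \<le> f a"
  using deriv_nonneg_mono[of a b "\<lambda>t. - f t" "\<lambda>t. - f' t"] assms by (auto intro: DERIV_minus)

text \<open>A continuous function on the whole line has an antiderivative that vanishes at the origin, on
  both sides of it; this yields two-sided solutions of differential equations.\<close>

lemma antiderivative_real_line:
  fixes f :: "real \<Rightarrow> 'a :: banach"
  assumes "continuous_on UNIV f"
  shows "\<exists>A. A 0 = 0 \<and> (\<forall>t. (A has_vector_derivative f t) (at t))"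
proof -
  define A where "A = (\<lambda>t. integral {0..t} f - integral {t..0} f)"
  have io: "f integrable_on {a..b}" for a b
    using assms by (intro integrable_continuous_real) (auto intro: continuous_on_subset)
  have eq: "A t = integral {-S..t} f - integral {-S..0} f" if "- S \<le> t" "0 \<le> S" for t S
  proof (cases "0 \<le> t")
    case True
    then have "integral {-S..0} f + integral {0..t} f = integral {-S..t} f"
      using that by (intro Henstock_Kurzweil_Integration.integral_combine io) auto
    moreover have "integral {t..0} f = 0" using True by (cases "t = 0") auto
    ultimately show ?thesis by (auto simp: A_def algebra_simps)
  next
    case False
    then have "integral {-S..t} f + integral {t..0} f = integral {-S..0} f"
      using that by (intro Henstock_Kurzweil_Integration.integral_combine io) auto
    moreover have "integral {0..t} f = 0" using False by auto
    ultimately show ?thesis by (auto simp: A_def algebra_simps)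
  qed
  have "(A has_vector_derivative f t) (at t)" for t
  proof -
    define S where "S = \<bar>t\<bar> + 1"
    have "((\<lambda>u. integral {-S..u} f) has_vector_derivative f t) (at t within {-S..S})"
      using assms by (intro integral_has_vector_derivative) (auto simp: S_def intro: continuous_on_subset)
    hence "((\<lambda>u. integral {-S..u} f) has_vector_derivative f t) (at t)"
      by (subst (asm) at_within_Icc_at) (auto simp: S_def)
    hence "((\<lambda>u. integral {-S..u} f - integral {-S..0} f) has_vector_derivative f t) (at t)"
      by (auto intro!: derivative_eq_intros)
    thus ?thesis
      by (rule has_vector_derivative_transform_within_open[where S = "{-S<..<S}"])
        (use eq[of S] in \<open>auto simp: S_def\<close>)
  qed
  moreover have "A 0 = 0" by (simp add: A_def)
  ultimately show ?thesis by blast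
qed

text \<open>The estimate for one Picard iteration.\<close>

lemma norm_antiderivative_le_power:
  fixes D :: "real \<Rightarrow> 'a :: real_normed_vector"
  assumes "D 0 = 0" "\<And>t. (D has_vector_derivative d t) (at t)"
    and "\<And>t. norm (d t) \<le> M * \<bar>t\<bar> ^ k / fact k"
  shows "norm (D t) \<le> M * \<bar>t\<bar> ^ Suc k / fact (Suc k)"
proof -
  have *: "norm (E t) \<le> M * t ^ Suc k / fact (Suc k)"
    if "E 0 = 0" "\<And>t. (E has_vector_derivative e t) (at t)" "\<And>t. norm (e t) \<le> M * \<bar>t\<bar> ^ k / fact k"
      "0 < t" for E e and t :: real
  proof -
    have "norm (E t - E 0) \<le> (\<lambda>t. M * t ^ Suc k / fact (Suc k)) t - (\<lambda>t. M * t ^ Suc k / fact (Suc k)) 0"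
    proof (rule differentiable_bound_general)
      show "continuous_on {0..t} E"
        using that(2) by (meson continuous_at_imp_continuous_on has_vector_derivative_continuous)
      show "((\<lambda>t. M * t ^ Suc k / fact (Suc k)) has_vector_derivative M * s ^ k / fact k) (at s)" for s
      proof -
        have "((\<lambda>t. t ^ Suc k) has_real_derivative real (Suc k) * s ^ k) (at s)"
          using DERIV_pow[of "Suc k" s UNIV] by simp
        then have "((\<lambda>t. M * t ^ Suc k / fact (Suc k)) has_real_derivative M * (real (Suc k) * s ^ k) / fact (Suc k)) (at s)"
          by (intro DERIV_cmult DERIV_cdivide)
        also have "M * (real (Suc k) * s ^ k) / fact (Suc k) = M * s ^ k / fact k"
          by (simp add: divide_simps del: of_nat_Suc)
        finally show ?thesis by (simp add: has_real_derivative_iff_has_vector_derivative)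
      qed
      show "norm (e s) \<le> M * s ^ k / fact k" if "0 < s" for s
        using \<open>\<And>t. norm (e t) \<le> _\<close>[of s] that by simp
    qed (use that in \<open>auto intro!: continuous_intros\<close>)
    then show ?thesis using that(1) by simp
  qed
  consider "t = 0" | "0 < t" | "t < 0" by linarith
  then show ?thesis
  proof cases
    case 3
    have "norm ((\<lambda>t. D (- t)) (- t)) \<le> M * (- t) ^ Suc k / fact (Suc k)"
    proof (rule *[of "\<lambda>t. D (- t)" "\<lambda>t. - d (- t)"])
      show "((\<lambda>t. D (- t)) has_vector_derivative - d (- t)) (at t)" for t
        using vector_diff_chain_at[of "\<lambda>t. - t" "-1" t D "d (- t)"] assms(2)[of "- t"]
        by (auto simp: o_def has_vector_derivative_minus intro!: derivative_eq_intros)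
    qed (use assms(1) assms(3)[of "- t" for t] 3 in auto)
    then show ?thesis using 3 by simp
  qed (use *[of D d t] assms in auto)
qed

section \<open>Lipschitz differential equations\<close>

text \<open>Picard--Lindelof for a globally Lipschitz autonomous field: the iterates converge uniformly on
  bounded intervals, so the solution exists for all times.\<close>

lemma picard_global:
  fixes F :: "'a :: banach \<Rightarrow> 'a"
  assumes lip: "\<And>u v. norm (F u - F v) \<le> L * norm (u - v)"
  obtains \<phi> where "\<phi> 0 = p" "\<And>t. (\<phi> has_vector_derivative F (\<phi> t)) (at t)"
proof -
  have L0: "L \<ge> 0" if "u \<noteq> v" for u v :: 'a
  proof -
    have "0 \<le> L * norm (u - v)" using lip[of u v] norm_ge_zero order_trans by blast
    moreover have "norm (u - v) > 0" using that by simp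
    ultimately show ?thesis by (simp add: zero_le_mult_iff)
  qed
  show ?thesis
  proof (cases "\<exists>u v :: 'a. u \<noteq> v")
    case False
    then have "(F ((\<lambda>t. p) t)) = 0" for t :: real by blast
    then show ?thesis using that[of "\<lambda>_. p"] by auto
  next
    case True
    hence L0: "L \<ge> 0" using L0 by blast
  have contF: "continuous_on UNIV F"
  proof (rule continuous_on_iff[THEN iffD2], intro ballI allI impI)
    fix x and e :: real assume "e > 0"
    show "\<exists>d>0. \<forall>x'\<in>UNIV. dist x' x < d \<longrightarrow> dist (F x') (F x) < e"
    proof (intro exI[of _ "e / (L + 1)"] conjI ballI impI)
      show "0 < e / (L + 1)" using \<open>e > 0\<close> L0 by simp
      fix x' assume "dist x' x < e / (L + 1)"
      then have "(L + 1) * norm (x' - x) < e"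
        using L0 by (simp add: dist_norm pos_less_divide_eq mult.commute)
      moreover have "norm (F x' - F x) \<le> (L + 1) * norm (x' - x)"
        using lip[of x' x] by (simp add: distrib_right add_increasing2)
      ultimately show "dist (F x') (F x) < e" by (simp add: dist_norm)
    qed
  qed
  define I where "I = (\<lambda>f :: real \<Rightarrow> 'a. SOME A. A 0 = 0 \<and> (\<forall>t. (A has_vector_derivative f t) (at t)))"
  have I: "I f 0 = 0 \<and> (\<forall>t. (I f has_vector_derivative f t) (at t))" if f: "continuous_on UNIV f" for f
    unfolding I_def by (rule someI_ex[OF antiderivative_real_line[OF f]])
  \<comment> \<open>\<open>I\<close> selects the antiderivative, so \<open>\<phi> n\<close> is the sequence of Picard iterates.\<close>
  define \<phi> where "\<phi> = rec_nat (\<lambda>_. p) (\<lambda>_ f t. p + I (\<lambda>s. F (f s)) t)"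
  have \<phi>0: "\<phi> 0 = (\<lambda>_. p)" by (simp add: \<phi>_def)
  have \<phi>S: "\<phi> (Suc n) = (\<lambda>t. p + I (\<lambda>s. F (\<phi> n s)) t)" for n by (simp add: \<phi>_def)
  have cont: "continuous_on UNIV (\<phi> n)" for n
  proof (induction n)
    case (Suc n)
    from contF Suc have "continuous_on UNIV (\<lambda>s. F (\<phi> n s))"
      by (rule continuous_on_compose2) auto
    from I[OF this] have "\<And>t. isCont (I (\<lambda>s. F (\<phi> n s))) t"
      using has_vector_derivative_continuous by blast
    then show ?case unfolding \<phi>S
      by (intro continuous_intros continuous_at_imp_continuous_on) auto
  qed (simp add: \<phi>0)
  have contF\<phi>: "continuous_on UNIV (\<lambda>s. F (\<phi> n s))" for n
    using contF cont[of n] by (rule continuous_on_compose2) auto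
  have deriv: "(\<phi> (Suc n) has_vector_derivative F (\<phi> n t)) (at t)" for n t
    unfolding \<phi>S using I[OF contF\<phi>[of n]] by (auto intro!: derivative_eq_intros)
  have init: "\<phi> n 0 = p" for n
    by (cases n) (use I[OF contF\<phi>] in \<open>auto simp: \<phi>0 \<phi>S\<close>)
  have step: "norm (\<phi> (Suc n) t - \<phi> n t) \<le> norm (F p) * L ^ n * \<bar>t\<bar> ^ Suc n / fact (Suc n)" for n t
  proof (induction n arbitrary: t)
    case 0
    have "norm (\<phi> (Suc 0) t - p) \<le> norm (F p) * \<bar>t\<bar> ^ Suc 0 / fact (Suc 0)"
    proof (rule norm_antiderivative_le_power)
      show "((\<lambda>t. \<phi> (Suc 0) t - p) has_vector_derivative F p) (at t)" for t
        using deriv[of 0 t] by (auto intro!: derivative_eq_intros simp: \<phi>0)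
    qed (simp_all add: init)
    then show ?case by (simp add: \<phi>0)
  next
    case (Suc n)
    show ?case
    proof (rule norm_antiderivative_le_power)
      show "((\<lambda>t. \<phi> (Suc (Suc n)) t - \<phi> (Suc n) t) has_vector_derivative
          F (\<phi> (Suc n) t) - F (\<phi> n t)) (at t)" for t
        by (intro derivative_intros deriv)
      show "norm (F (\<phi> (Suc n) t) - F (\<phi> n t)) \<le> norm (F p) * L ^ Suc n * \<bar>t\<bar> ^ Suc n / fact (Suc n)" for t
        using order_trans[OF lip mult_left_mono[OF Suc[of t] L0]] by (simp add: ac_simps)
    qed (simp add: init)
  qed
  define \<Phi> where "\<Phi> = (\<lambda>t. p + (\<Sum>i. \<phi> (Suc i) t - \<phi> i t))"
  have tele: "p + (\<Sum>i<n. \<phi> (Suc i) t - \<phi> i t) = \<phi> n t" for n t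
    by (subst sum_lessThan_telescope) (simp add: \<phi>0)
  have unif: "uniform_limit {-r..r} \<phi> \<Phi> sequentially" if "r > 0" for r
  proof -
    have "uniform_limit {-r..r} (\<lambda>n t. \<Sum>i<n. \<phi> (Suc i) t - \<phi> i t) (\<lambda>t. \<Sum>i. \<phi> (Suc i) t - \<phi> i t) sequentially"
    proof (rule Weierstrass_m_test)
      fix n t assume "t \<in> {-r..r}"
      then have "\<bar>t\<bar> ^ Suc n \<le> r ^ Suc n" by (intro power_mono) auto
      then have "norm (F p) * L ^ n * \<bar>t\<bar> ^ Suc n / fact (Suc n) \<le> norm (F p) * L ^ n * r ^ Suc n / fact (Suc n)"
        using L0 by (intro divide_right_mono mult_left_mono mult_nonneg_nonneg) auto
      also have "\<dots> \<le> norm (F p) * L ^ n * r ^ Suc n / fact n"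
        using L0 that by (intro divide_left_mono mult_nonneg_nonneg) (auto intro: fact_mono)
      also have "\<dots> = norm (F p) * r * ((L * r) ^ n / fact n)"
        by (simp add: power_mult_distrib)
      finally show "norm (\<phi> (Suc n) t - \<phi> n t) \<le> norm (F p) * r * ((L * r) ^ n / fact n)"
        using step[of n t] by linarith
    next
      have "summable (\<lambda>n. (L * r) ^ n /\<^sub>R fact n)" by (rule summable_exp_generic)
      then show "summable (\<lambda>n. norm (F p) * r * ((L * r) ^ n / fact n))"
        by (intro summable_mult) (simp add: divide_inverse mult.commute)
    qed
    then have "uniform_limit {-r..r} (\<lambda>n t. p + (\<Sum>i<n. \<phi> (Suc i) t - \<phi> i t)) \<Phi> sequentially"
      unfolding \<Phi>_def by (intro uniform_limit_intros)
    then show ?thesis by (simp add: tele)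
  qed
  have lim: "(\<lambda>n. \<phi> n t) \<longlonglongrightarrow> \<Phi> t" for t
    by (rule tendsto_uniform_limitI[OF unif[of "\<bar>t\<bar> + 1"]]) auto
  have "(\<Phi> has_vector_derivative F (\<Phi> t)) (at t)" for t
  proof -
    define r where "r = \<bar>t\<bar> + 1"
    have "\<exists>g. \<forall>x\<in>{-r..r}. (\<lambda>n. \<phi> (Suc n) x) \<longlonglongrightarrow> g x \<and>
        (g has_derivative (\<lambda>h. h *\<^sub>R F (\<Phi> x))) (at x within {-r..r})"
    proof (rule has_derivative_sequence)
      show "(\<phi> (Suc n) has_derivative (\<lambda>h. h *\<^sub>R F (\<phi> n x))) (at x within {-r..r})" for n x
        using deriv[of n x] has_derivative_at_withinI unfolding has_vector_derivative_def by blast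
      fix e :: real assume "e > 0"
      with L0 have "e / (L + 1) > 0" by simp
      with unif[of r] have "\<forall>\<^sub>F n in sequentially. \<forall>x\<in>{-r..r}. dist (\<phi> n x) (\<Phi> x) < e / (L + 1)"
        by (auto simp: r_def uniform_limit_iff)
      then show "\<forall>\<^sub>F n in sequentially. \<forall>x\<in>{-r..r}. \<forall>h.
          norm (h *\<^sub>R F (\<phi> n x) - h *\<^sub>R F (\<Phi> x)) \<le> e * norm h"
      proof eventually_elim
        case (elim n)
        show ?case
        proof (intro ballI allI)
          fix x h assume "x \<in> {-r..r}"
          with elim have "(L + 1) * norm (\<phi> n x - \<Phi> x) < e"
            using L0 by (simp add: dist_norm pos_less_divide_eq mult.commute)
          moreover have "norm (F (\<phi> n x) - F (\<Phi> x)) \<le> (L + 1) * norm (\<phi> n x - \<Phi> x)"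
            using lip[of "\<phi> n x" "\<Phi> x"] by (simp add: distrib_right add_increasing2)
          ultimately have "\<bar>h\<bar> * norm (F (\<phi> n x) - F (\<Phi> x)) \<le> \<bar>h\<bar> * e"
            by (intro mult_left_mono) auto
          then show "norm (h *\<^sub>R F (\<phi> n x) - h *\<^sub>R F (\<Phi> x)) \<le> e * norm h"
            by (simp add: scaleR_diff_right[symmetric] mult.commute)
        qed
      qed
    next
      show "(\<lambda>n. \<phi> (Suc n) 0) \<longlonglongrightarrow> p" by (simp add: init)
    qed (auto simp: r_def)
    then obtain g where g: "\<And>x. x \<in> {-r..r} \<Longrightarrow> (\<lambda>n. \<phi> (Suc n) x) \<longlonglongrightarrow> g x"
      "\<And>x. x \<in> {-r..r} \<Longrightarrow> (g has_derivative (\<lambda>h. h *\<^sub>R F (\<Phi> x))) (at x within {-r..r})"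
      by blast
    have eq: "g x = \<Phi> x" if "x \<in> {-r..r}" for x
      using LIMSEQ_unique[OF g(1)[OF that] LIMSEQ_Suc[OF lim]] .
    have "(g has_vector_derivative F (\<Phi> t)) (at t within {-r..r})"
      unfolding has_vector_derivative_def by (rule g(2)) (auto simp: r_def)
    then have "(g has_vector_derivative F (\<Phi> t)) (at t)"
      by (subst (asm) at_within_Icc_at) (auto simp: r_def)
    then show ?thesis
      by (rule has_vector_derivative_transform_within_open[where S = "{-r<..<r}"])
        (use eq in \<open>auto simp: r_def\<close>)
  qed
  moreover have "\<Phi> 0 = p"
    using LIMSEQ_unique[OF lim[of 0]] by (simp add: init)
  ultimately show ?thesis using that by blast
  qed
qed

lemma has_vector_derivative_reverse:
  assumes "(f has_vector_derivative d) (at (- t))"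
  shows "((\<lambda>t. f (- t)) has_vector_derivative - d) (at t)"
proof -
  have "(uminus has_vector_derivative - 1) (at t)"
    by (auto intro!: derivative_eq_intros)
  from vector_diff_chain_at[OF this assms] show ?thesis by (simp add: o_def)
qed

lemma lipschitz_ode_unique:
  fixes F :: "'a :: real_inner \<Rightarrow> 'a"
  assumes lip: "\<And>u v. norm (F u - F v) \<le> L * norm (u - v)"
    and "\<And>t. (\<phi> has_vector_derivative F (\<phi> t)) (at t)"
    and "\<And>t. (\<psi> has_vector_derivative F (\<psi> t)) (at t)"
    and "\<phi> 0 = \<psi> 0"
  shows "\<phi> = \<psi>"
proof (rule ext)
  have *: "\<phi> t = \<psi> t"
    if lip: "\<And>u v. norm (F u - F v) \<le> L * norm (u - v)"
      and \<phi>: "\<And>t. (\<phi> has_vector_derivative F (\<phi> t)) (at t)"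
      and \<psi>: "\<And>t. (\<psi> has_vector_derivative F (\<psi> t)) (at t)"
      and "\<phi> 0 = \<psi> 0" "t \<ge> 0" for F \<phi> and \<psi> :: "real \<Rightarrow> 'a" and t :: real
  proof -
    \<comment> \<open>The weight makes the squared distance nonincreasing for positive times.\<close>
    define w where "w = (\<lambda>t. (\<phi> t - \<psi> t) \<bullet> (\<phi> t - \<psi> t) * exp (- 2 * L * t))"
    have d: "(w has_real_derivative
        2 * exp (- 2 * L * t) * ((\<phi> t - \<psi> t) \<bullet> (F (\<phi> t) - F (\<psi> t)) - L * ((\<phi> t - \<psi> t) \<bullet> (\<phi> t - \<psi> t)))) (at t)" for t
    proof -
      have "((\<lambda>t. (\<phi> t - \<psi> t) \<bullet> (\<phi> t - \<psi> t)) has_vector_derivative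
          (\<phi> t - \<psi> t) \<bullet> (F (\<phi> t) - F (\<psi> t)) + (F (\<phi> t) - F (\<psi> t)) \<bullet> (\<phi> t - \<psi> t)) (at t)"
        by (intro bounded_bilinear.has_vector_derivative[OF bounded_bilinear_inner] derivative_intros \<phi> \<psi>)
      then have "((\<lambda>t. (\<phi> t - \<psi> t) \<bullet> (\<phi> t - \<psi> t)) has_real_derivative
          2 * ((\<phi> t - \<psi> t) \<bullet> (F (\<phi> t) - F (\<psi> t)))) (at t)"
        by (simp add: has_real_derivative_iff_has_vector_derivative inner_commute)
      from DERIV_mult[OF this, of "\<lambda>t. exp (- 2 * L * t)" "- 2 * L * exp (- 2 * L * t)"]
      show ?thesis unfolding w_def
        by (rule DERIV_cong) (auto intro!: derivative_eq_intros simp: algebra_simps)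
    qed
    have "w t \<le> w 0"
    proof (rule deriv_nonpos_mono[OF \<open>t \<ge> 0\<close> DERIV_subset[OF d]])
      fix s
      have "(\<phi> s - \<psi> s) \<bullet> (F (\<phi> s) - F (\<psi> s)) \<le> norm (\<phi> s - \<psi> s) * norm (F (\<phi> s) - F (\<psi> s))"
        by (rule norm_cauchy_schwarz)
      also have "\<dots> \<le> norm (\<phi> s - \<psi> s) * (L * norm (\<phi> s - \<psi> s))"
        by (intro mult_left_mono lip) auto
      also have "\<dots> = L * ((\<phi> s - \<psi> s) \<bullet> (\<phi> s - \<psi> s))"
        by (simp add: dot_square_norm power2_eq_square)
      finally show "2 * exp (- 2 * L * s) * ((\<phi> s - \<psi> s) \<bullet> (F (\<phi> s) - F (\<psi> s)) -
          L * ((\<phi> s - \<psi> s) \<bullet> (\<phi> s - \<psi> s))) \<le> 0"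
        by (intro mult_nonneg_nonpos) auto
    qed auto
    then have "(\<phi> t - \<psi> t) \<bullet> (\<phi> t - \<psi> t) \<le> 0"
      using that(4) by (simp add: w_def mult_le_0_iff)
    then have "\<phi> t - \<psi> t = 0" by (metis inner_ge_zero inner_eq_zero_iff order_antisym)
    then show ?thesis by simp
  qed
  fix t
  show "\<phi> t = \<psi> t"
  proof (cases "t \<ge> 0")
    case True
    then show ?thesis using *[of F \<phi> \<psi> t] assms by blast
  next
    case False
    have "(\<lambda>t. \<phi> (- t)) (- t) = (\<lambda>t. \<psi> (- t)) (- t)"
    proof (rule *[of "\<lambda>u. - F u" "\<lambda>t. \<phi> (- t)" "\<lambda>t. \<psi> (- t)" "- t"])
      show "norm (- F u - - F v) \<le> L * norm (u - v)" for u v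
        using lip[of u v] by (simp add: norm_minus_commute)
      show "((\<lambda>t. \<phi> (- t)) has_vector_derivative - F (\<phi> (- t))) (at t)" for t
        by (intro has_vector_derivative_reverse assms)
      show "((\<lambda>t. \<psi> (- t)) has_vector_derivative - F (\<psi> (- t))) (at t)" for t
        by (intro has_vector_derivative_reverse assms)
    qed (use assms False in auto)
    then show ?thesis by simp
  qed
qed

section \<open>Polynomials and solutions of the Lienard system\<close>

text \<open>The functions \<open>x\<close>, \<open>y\<close> solve \<open>x' = y\<close>, \<open>y' = - h(x) - c x y\<close> at the times in \<open>S\<close>. The derivatives
  are two-sided, also at the end points of an interval \<open>S\<close>.\<close>

definition lienard_solution ::
  "real poly \<Rightarrow> real \<Rightarrow> (real \<Rightarrow> real) \<Rightarrow> (real \<Rightarrow> real) \<Rightarrow> real set \<Rightarrow> bool" where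
  "lienard_solution h c x y S \<longleftrightarrow>
     (\<forall>t\<in>S. (x has_real_derivative y t) (at t) \<and>
            (y has_real_derivative - poly h (x t) - c * x t * y t) (at t))"

lemma lienard_solution_subset:
  "lienard_solution h c x y S \<Longrightarrow> T \<subseteq> S \<Longrightarrow> lienard_solution h c x y T"
  by (auto simp: lienard_solution_def)

lemma lienard_solution_continuous:
  assumes "lienard_solution h c x y S"
  shows "continuous_on S x" "continuous_on S y"
  using assms by (auto simp: lienard_solution_def intro!: continuous_at_imp_continuous_on DERIV_isCont)

lemma poly_primitive:
  fixes h :: "real poly"
  obtains G where "pderiv G = h" "poly G 0 = 0"
proof
  let ?G = "\<Sum>i\<le>degree h. monom (coeff h i / real (Suc i)) (Suc i)"
  show "pderiv ?G = h"
    by (rule poly_eqI) (auto simp: coeff_pderiv coeff_sum coeff_eq_0 simp del: of_nat_Suc)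
  show "poly ?G 0 = 0" by (simp add: poly_sum poly_monom)
qed

lemma poly_bounded_below_right:
  fixes q :: "real poly"
  assumes "0 < lead_coeff q"
  obtains B where "0 \<le> B" "\<And>x. 0 \<le> x \<Longrightarrow> - B \<le> poly q x"
proof -
  obtain n where n: "\<And>x. x \<ge> n \<Longrightarrow> poly q x \<ge> lead_coeff q"
    using poly_pinfty_gt_lc[OF assms] by blast
  have "compact ((\<lambda>x. poly q x) ` {0..max n 0})"
    by (intro compact_continuous_image continuous_intros) auto
  then obtain B where B: "\<And>x. x \<in> {0..max n 0} \<Longrightarrow> \<bar>poly q x\<bar> \<le> B"
    by (metis bounded_real compact_imp_bounded image_eqI)
  show ?thesis
  proof (rule that[of "max B 0"])
    fix x :: real assume "0 \<le> x"
    then show "- max B 0 \<le> poly q x"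
      using B[of x] n[of x] assms by (cases "x \<le> max n 0") (auto simp: max_def split: if_splits)
  qed auto
qed

lemma cubic_lower_bound:
  fixes q :: "real poly"
  assumes "3 \<le> degree q" "0 < lead_coeff q"
  obtains \<delta> B where "0 < \<delta>" "0 \<le> B" "\<And>x. 0 \<le> x \<Longrightarrow> \<delta> * x ^ 3 - B \<le> poly q x"
proof -
  \<comment> \<open>In degree three, half of the leading coefficient is used up; in higher degree any value would do.\<close>
  define \<delta> where "\<delta> = lead_coeff q / 2"
  define p where "p = q - monom \<delta> 3"
  have \<delta>: "0 < \<delta>" "\<delta> < lead_coeff q" using assms by (auto simp: \<delta>_def)
  have "0 < lead_coeff p"
  proof (cases "degree q = 3")
    case True
    have "degree p \<le> 3" unfolding p_def
      using True by (intro degree_diff_le) (auto simp: degree_monom_le)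
    moreover have c: "0 < coeff p 3" using True \<delta> by (simp add: p_def)
    ultimately have "degree p = 3" by (metis le_degree less_irrefl order_antisym)
    then show ?thesis using c by simp
  next
    case False
    then have "degree (monom \<delta> 3) < degree q"
      using assms(1) degree_monom_le[of \<delta> 3] by linarith
    then have "degree p = degree q" unfolding p_def
      by (metis degree_add_eq_left degree_minus diff_conv_add_uminus)
    then show ?thesis using False assms by (simp add: p_def)
  qed
  then obtain B where "0 \<le> B" "\<And>x. 0 \<le> x \<Longrightarrow> - B \<le> poly p x"
    using poly_bounded_below_right by blast
  then show ?thesis using \<delta>
    by (intro that[of \<delta> B]) (force simp: p_def poly_monom)+
qed

lemma poly_linear_upper_bound:
  fixes q :: "real poly"
  assumes "degree q \<le> 1 \<or> lead_coeff q \<le> 0"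
  shows "\<exists>A X0. \<forall>x\<ge>X0. poly q x \<le> A * x"
proof (cases "degree q \<le> 1")
  case True
  then obtain a b where q: "q = [:a, b:]" 
    by (metis One_nat_def degree_eq_zeroE degree_pCons_eq_if le_Suc_eq le_zero_eq pCons_cases pCons_0_0 diff_Suc_1 nat.inject)
  have "poly q x \<le> (\<bar>a\<bar> + b) * x" if "x \<ge> 1" for x
  proof -
    have "a \<le> \<bar>a\<bar> * 1" by simp
    also have "\<dots> \<le> \<bar>a\<bar> * x" using that by (intro mult_left_mono) auto
    finally show ?thesis by (simp add: q algebra_simps)
  qed
  then show ?thesis by blast
next
  case False
  then have "q \<noteq> 0" by auto
  with False assms have "0 < lead_coeff (- q)" by (auto simp: less_le)
  then obtain n where n: "\<And>x. x \<ge> n \<Longrightarrow> poly (- q) x \<ge> lead_coeff (- q)"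
    using poly_pinfty_gt_lc by blast
  have "poly q x \<le> 0 * x" if "x \<ge> n" for x
    using n[OF that] \<open>0 < lead_coeff (- q)\<close> by simp
  then show ?thesis by blast
qed

section \<open>Rotation in a half plane\<close>

text \<open>The discriminant of \<open>z\<^sup>2 + c z + c\<^sup>2 / 4 + 2 \<delta>\<close> is negative; this is where the borderline \<open>c\<^sup>2 / 8\<close> comes from.\<close>

lemma rotation_quadratic:
  fixes c \<delta> \<epsilon> z :: real
  assumes "0 < \<delta>" "0 \<le> \<epsilon>" "\<epsilon> \<le> 1 / 4" "\<epsilon> * (2 + c\<^sup>2) \<le> 2 * \<delta>"
  shows "2 * \<epsilon> * (1 + z\<^sup>2) \<le> c\<^sup>2 / 4 + 2 * \<delta> + c * z + z\<^sup>2"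
proof -
  define w where "w = z + c / 2"
  have "0 \<le> (w + c / 2)\<^sup>2" by simp
  then have "z\<^sup>2 \<le> 2 * w\<^sup>2 + c\<^sup>2 / 2"
    by (simp add: w_def power2_eq_square algebra_simps)
  then have "2 * \<epsilon> * (1 + z\<^sup>2) \<le> 2 * \<epsilon> * (1 + (2 * w\<^sup>2 + c\<^sup>2 / 2))"
    using assms by (intro mult_left_mono) auto
  also have "\<dots> = \<epsilon> * (2 + c\<^sup>2) + (4 * \<epsilon>) * w\<^sup>2" by (simp add: algebra_simps)
  also have "(4 * \<epsilon>) * w\<^sup>2 \<le> 1 * w\<^sup>2" using assms by (intro mult_right_mono) auto
  also have "\<epsilon> * (2 + c\<^sup>2) + 1 * w\<^sup>2 \<le> 2 * \<delta> + w\<^sup>2" using assms by simp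
  also have "\<dots> = c\<^sup>2 / 4 + 2 * \<delta> + c * z + z\<^sup>2"
    by (simp add: w_def power2_eq_square algebra_simps)
  finally show ?thesis by simp
qed

text \<open>With \<open>z = y / \<psi>(x)\<close> and \<open>\<psi>(x) = (x + 1)\<^sup>2 / 2\<close>, the expression on the left-hand side is the time
  derivative of \<open>z\<close> along solutions. The shift
  by one keeps \<open>\<psi>'\<close> away from zero, so the estimate also holds at \<open>x = 0\<close> although \<open>h(0)\<close> need not vanish.\<close>

lemma angular_speed_bound:
  fixes h :: "real \<Rightarrow> real" and c \<delta> B :: real
  assumes "0 < \<delta>" "0 \<le> B" "\<And>x. 0 \<le> x \<Longrightarrow> (c\<^sup>2 / 8 + \<delta>) * x ^ 3 - B \<le> h x"
  obtains \<epsilon> X1 Y1 where "0 < \<epsilon>" "0 < X1" "0 < Y1"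
    "\<And>x y z. \<lbrakk>0 \<le> x; X1 \<le> x \<or> Y1 \<le> \<bar>y\<bar>; z = y / ((x + 1)\<^sup>2 / 2)\<rbrakk> \<Longrightarrow>
       - h x / ((x + 1)\<^sup>2 / 2) - c * x * z - (x + 1) * z\<^sup>2 \<le> - \<epsilon> * (x + 1) * (1 + z\<^sup>2)"
proof -
  define \<epsilon> where "\<epsilon> = min (1 / 4) (2 * \<delta> / (2 + c\<^sup>2))"
  have pos: "0 < 2 + c\<^sup>2" by (rule add_pos_nonneg) auto
  have \<epsilon>: "0 < \<epsilon>" "\<epsilon> \<le> 1 / 4" using assms pos by (auto simp: \<epsilon>_def)
  have "\<epsilon> \<le> 2 * \<delta> / (2 + c\<^sup>2)" by (simp add: \<epsilon>_def)
  then have \<epsilon>': "\<epsilon> * (2 + c\<^sup>2) \<le> 2 * \<delta>" using pos by (simp add: pos_le_divide_eq)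
  define \<alpha> where "\<alpha> = c\<^sup>2 / 4 + 2 * \<delta>"
  have \<alpha>: "0 < \<alpha>" using assms by (simp add: \<alpha>_def add_nonneg_pos)
  define C where "C = 3 * \<alpha> + 2 * B"
  have C: "0 < C" using \<alpha> assms by (simp add: C_def)
  define Q where "Q = (C + \<bar>c\<bar>) / \<epsilon>"
  have Q: "0 < Q" "C + \<bar>c\<bar> = \<epsilon> * Q" using C \<epsilon> by (auto simp: Q_def add_pos_nonneg)
  define X1 where "X1 = 2 * Q"
  define Y1 where "Y1 = (Q + 1) * ((X1 + 1)\<^sup>2 / 2)"
  have X1: "0 < X1" using Q by (simp add: X1_def)
  have Y1: "0 < Y1" using Q X1 by (simp add: Y1_def)
  show ?thesis
  proof (rule that[of \<epsilon> X1 Y1, OF \<epsilon>(1) X1 Y1])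
    fix x y z :: real
    assume x: "0 \<le> x" and reg: "X1 \<le> x \<or> Y1 \<le> \<bar>y\<bar>" and z: "z = y / ((x + 1)\<^sup>2 / 2)"
    define \<psi> where "\<psi> = (x + 1)\<^sup>2 / 2"
    have \<psi>: "1 / 2 \<le> \<psi>" using x by (simp add: \<psi>_def)
    have "- h x / \<psi> \<le> - \<alpha> * (x + 1) + C"
    proof -
      have "\<alpha> * (x - 2) * \<psi> - 2 * B * \<psi> \<le> \<alpha> / 2 * x ^ 3 - B"
      proof -
        have "\<alpha> / 2 * x ^ 3 - \<alpha> * (x - 2) * \<psi> = \<alpha> / 2 * (3 * x + 2)"
          by (simp add: \<psi>_def power2_eq_square power3_eq_cube field_simps)
        moreover have "0 \<le> \<alpha> / 2 * (3 * x + 2)" using \<alpha> x by simp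
        moreover have "B * 1 \<le> B * (2 * \<psi>)" using assms \<psi> by (intro mult_left_mono) auto
        ultimately show ?thesis by (simp add: algebra_simps)
      qed
      also have "\<alpha> / 2 = c\<^sup>2 / 8 + \<delta>" by (simp add: \<alpha>_def)
      also have "(c\<^sup>2 / 8 + \<delta>) * x ^ 3 - B \<le> h x" using assms x by blast
      finally have "(\<alpha> * (x - 2) - 2 * B) * \<psi> \<le> h x" by (simp add: algebra_simps)
      then have "\<alpha> * (x - 2) - 2 * B \<le> h x / \<psi>" using \<psi> by (simp add: pos_le_divide_eq)
      then show ?thesis by (simp add: C_def algebra_simps)
    qed
    moreover have "C + c * z \<le> \<epsilon> * (x + 1) * (1 + z\<^sup>2)"
    proof -
      have "c * z \<le> \<bar>c\<bar> * \<bar>z\<bar>" by (metis abs_ge_self abs_mult)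
      then have 1: "C + c * z \<le> C * 1 + \<bar>c\<bar> * \<bar>z\<bar>" by simp
      show ?thesis
      proof (cases "X1 \<le> x")
        case True
        have "C * 1 + \<bar>c\<bar> * \<bar>z\<bar> \<le> C * (1 + \<bar>z\<bar>) + \<bar>c\<bar> * (1 + \<bar>z\<bar>)"
          using C by (intro add_mono mult_left_mono) auto
        also have "\<dots> = (C + \<bar>c\<bar>) * (1 + \<bar>z\<bar>)" by (simp add: algebra_simps)
        also have "\<dots> = \<epsilon> * Q * (1 + \<bar>z\<bar>)" by (simp only: Q(2))
        also have "\<dots> \<le> \<epsilon> * Q * (2 * (1 + z\<^sup>2))"
        proof (rule mult_left_mono)
          have "\<bar>z\<bar> \<le> 1 + z\<^sup>2" using sum_squares_bound[of 1 "\<bar>z\<bar>"] by simp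
          then have "1 + \<bar>z\<bar> \<le> 2 + z\<^sup>2" by simp
          also have "\<dots> \<le> 2 * (1 + z\<^sup>2)" by simp
          finally show "1 + \<bar>z\<bar> \<le> 2 * (1 + z\<^sup>2)" .
        qed (use \<epsilon> Q in auto)
        also have "\<dots> = \<epsilon> * X1 * (1 + z\<^sup>2)" by (simp add: X1_def)
        also have "\<dots> \<le> \<epsilon> * (x + 1) * (1 + z\<^sup>2)"
          using True \<epsilon> by (intro mult_right_mono mult_left_mono) auto
        finally show ?thesis using 1 by linarith
      next
        case False
        then have "Y1 \<le> \<bar>y\<bar>" using reg by blast
        moreover have "(Q + 1) * \<psi> \<le> Y1"
          unfolding Y1_def \<psi>_def using False x Q
          by (intro mult_left_mono divide_right_mono power_mono) auto
        ultimately have "(Q + 1) * \<psi> \<le> \<bar>y\<bar>" by linarith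
        then have "Q + 1 \<le> \<bar>y\<bar> / \<psi>" using \<psi> by (simp add: pos_le_divide_eq)
        also have "\<dots> = \<bar>z\<bar>" using \<psi> by (simp add: z \<psi>_def[symmetric])
        finally have zQ: "Q \<le> \<bar>z\<bar>" "1 \<le> \<bar>z\<bar>" using Q by auto
        have "C * 1 + \<bar>c\<bar> * \<bar>z\<bar> \<le> C * \<bar>z\<bar> + \<bar>c\<bar> * \<bar>z\<bar>"
          using C zQ by (intro add_mono mult_left_mono) auto
        also have "\<dots> = (C + \<bar>c\<bar>) * \<bar>z\<bar>" by (simp add: algebra_simps)
        also have "\<dots> = \<epsilon> * (Q * \<bar>z\<bar>)" by (simp only: Q(2) mult.assoc)
        also have "\<dots> \<le> \<epsilon> * (\<bar>z\<bar> * \<bar>z\<bar>)"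
          using \<epsilon> zQ by (intro mult_left_mono mult_right_mono) auto
        also have "\<dots> = \<epsilon> * 1 * z\<^sup>2" by (simp add: power2_eq_square)
        also have "\<dots> \<le> \<epsilon> * (x + 1) * (1 + z\<^sup>2)"
          using \<epsilon> x by (intro mult_mono) auto
        finally show ?thesis using 1 by linarith
      qed
    qed
    moreover have "(x + 1) * (2 * \<epsilon> * (1 + z\<^sup>2)) \<le> (x + 1) * (\<alpha> + c * z + z\<^sup>2)"
      using rotation_quadratic[OF assms(1) less_imp_le[OF \<epsilon>(1)] \<epsilon>(2) \<epsilon>', of z] x
      by (intro mult_left_mono) (auto simp: \<alpha>_def)
    ultimately have "- h x / \<psi> - c * x * z - (x + 1) * z\<^sup>2 \<le> - \<epsilon> * (x + 1) * (1 + z\<^sup>2)"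
      by (simp add: algebra_simps)
    then show "- h x / ((x + 1)\<^sup>2 / 2) - c * x * z - (x + 1) * z\<^sup>2 \<le> - \<epsilon> * (x + 1) * (1 + z\<^sup>2)"
      by (simp only: \<psi>_def)
  qed
qed


text \<open>Uniform control of the motion in the half plane \<open>x \<ge> 0\<close>, where \<open>G\<close> is a primitive of \<open>h\<close>. An arc whose
  shifted energy \<open>y\<^sup>2 / 2 + G(x) + K\<close> starts above \<open>R0\<close> lasts for a time of at most \<open>\<tau>\<close>, its shifted
  energy changes by at most a factor of \<open>\<Lambda>\<close>, and its velocity changes sign at most once, from
  positive to negative. The shift \<open>K\<close> makes the energy an upper bound for \<open>x\<close>.\<close>

definition rotation_constants ::
  "real poly \<Rightarrow> real poly \<Rightarrow> real \<Rightarrow> real \<Rightarrow> real \<Rightarrow> real \<Rightarrow> real \<Rightarrow> bool" where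
  "rotation_constants h G c K R0 \<Lambda> \<tau> \<longleftrightarrow>
     0 < R0 \<and> 1 \<le> \<Lambda> \<and> 0 < \<tau> \<and> (\<forall>x\<ge>0. x \<le> poly G x + K) \<and>
     (\<forall>a b x y. a \<le> b \<longrightarrow> lienard_solution h c x y {a..b} \<longrightarrow> (\<forall>t\<in>{a..b}. 0 \<le> x t) \<longrightarrow>
        R0 < (y a)\<^sup>2 / 2 + poly G (x a) + K \<longrightarrow>
        b - a \<le> \<tau> \<and>
        (\<forall>t\<in>{a..b}.
          (y t)\<^sup>2 / 2 + poly G (x t) + K \<le> \<Lambda> * ((y a)\<^sup>2 / 2 + poly G (x a) + K) \<and>
          (y a)\<^sup>2 / 2 + poly G (x a) + K \<le> \<Lambda> * ((y t)\<^sup>2 / 2 + poly G (x t) + K)) \<and>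
        (\<forall>s\<in>{a..b}. \<forall>t\<in>{a..b}. s < t \<longrightarrow> y s \<le> 0 \<longrightarrow> y t < 0))"

lemma half_plane_rotation:
  fixes h G :: "real poly" and c \<delta> B :: real
  assumes "0 < \<delta>" "0 \<le> B" and lower: "\<And>x. 0 \<le> x \<Longrightarrow> (c\<^sup>2 / 8 + \<delta>) * x ^ 3 - B \<le> poly h x"
    and G: "pderiv G = h" "poly G 0 = 0"
  obtains K R0 \<Lambda> \<tau> where "rotation_constants h G c K R0 \<Lambda> \<tau>"
proof -
  obtain \<epsilon> X1 Y1 where pos: "0 < \<epsilon>" "0 < X1" "0 < Y1"
    and speed: "\<And>x y z. \<lbrakk>0 \<le> x; X1 \<le> x \<or> Y1 \<le> \<bar>y\<bar>; z = y / ((x + 1)\<^sup>2 / 2)\<rbrakk> \<Longrightarrow>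
       - poly h x / ((x + 1)\<^sup>2 / 2) - c * x * z - (x + 1) * z\<^sup>2 \<le> - \<epsilon> * (x + 1) * (1 + z\<^sup>2)"
    using angular_speed_bound[where h = "poly h", OF assms(1,2) lower] by blast
  define \<alpha> where "\<alpha> = c\<^sup>2 / 8 + \<delta>"
  have \<alpha>: "0 < \<alpha>" using assms(1) by (simp add: \<alpha>_def add_nonneg_pos)
  have "0 < lead_coeff [:0, - (B + 1), 0, 0, \<alpha> / 4:]" using \<alpha> by simp
  then obtain K where K0: "0 \<le> K" and K: "\<And>x. 0 \<le> x \<Longrightarrow> - K \<le> poly [:0, - (B + 1), 0, 0, \<alpha> / 4:] x"
    using poly_bounded_below_right by blast
  have GK: "x \<le> poly G x + K" if "0 \<le> x" for x
  proof -
    have "(\<lambda>x. poly G x - (\<alpha> / 4 * x ^ 4 - B * x)) 0 \<le> (\<lambda>x. poly G x - (\<alpha> / 4 * x ^ 4 - B * x)) x"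
    proof (rule deriv_nonneg_mono[OF that])
      fix t
      show "((\<lambda>x. poly G x - (\<alpha> / 4 * x ^ 4 - B * x)) has_real_derivative
          poly h t - (\<alpha> * t ^ 3 - B)) (at t within {0..x})"
        by (auto intro!: derivative_eq_intros simp: G)
      show "0 \<le> poly h t - (\<alpha> * t ^ 3 - B)" if "t \<in> {0<..<x}"
        using lower[of t] that by (simp add: \<alpha>_def)
    qed
    then show ?thesis using K[OF that] G(2)
      by (simp add: algebra_simps power_numeral_reduce)
  qed
  have "compact ((\<lambda>x. poly G x) ` {0..X1})"
    by (intro compact_continuous_image continuous_intros) auto
  then obtain M where M: "\<And>x. x \<in> {0..X1} \<Longrightarrow> \<bar>poly G x\<bar> \<le> M"
    by (metis bounded_real compact_imp_bounded image_eqI)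
  have "0 \<le> M" using M[of 0] pos by force
  define R where "R = (\<lambda>x y. y\<^sup>2 / 2 + poly G x + K :: real)"
  define RN where "RN = Y1\<^sup>2 / 2 + M + K + 1"
  have RN: "1 \<le> RN" using \<open>0 \<le> M\<close> K0 by (simp add: RN_def add_nonneg_nonneg)
  have region: "X1 \<le> x \<or> Y1 \<le> \<bar>y\<bar>" if "RN \<le> R x y" "0 \<le> x" for x y
  proof (rule ccontr)
    assume "\<not> (X1 \<le> x \<or> Y1 \<le> \<bar>y\<bar>)"
    then have "\<bar>poly G x\<bar> \<le> M" "y\<^sup>2 \<le> Y1\<^sup>2"
      using M[of x] that pos by (auto intro!: power2_le_iff_abs_le[THEN iffD2])
    then show False using that by (simp add: R_def RN_def)
  qed
  have y2R: "y\<^sup>2 \<le> 2 * R x y" if "0 \<le> x" for x y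
    using GK[OF that] that by (simp add: R_def)
  \<comment> \<open>With this factor, \<open>ln R + \<kappa> \<Theta>\<close> decreases and \<open>ln R - \<kappa> \<Theta>\<close> increases along arcs far from the origin.\<close>
  define \<kappa> where "\<kappa> = 2 * \<bar>c\<bar> / \<epsilon>"
  have \<kappa>: "0 \<le> \<kappa>" "\<kappa> * \<epsilon> = 2 * \<bar>c\<bar>" using pos by (auto simp: \<kappa>_def)
  define \<Lambda> where "\<Lambda> = exp (\<kappa> * pi)"
  have \<Lambda>: "1 \<le> \<Lambda>" using \<kappa> by (simp add: \<Lambda>_def)
  define \<Theta> where "\<Theta> = (\<lambda>x y. arctan (y / ((x + 1)\<^sup>2 / 2)) :: real)"
  have core: "\<Theta> (x b) (y b) - \<Theta> (x a) (y a) \<le> - \<epsilon> * (b - a) \<and>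
      R (x b) (y b) \<le> \<Lambda> * R (x a) (y a) \<and> R (x a) (y a) \<le> \<Lambda> * R (x b) (y b)"
    if ab: "a \<le> b" and sol: "lienard_solution h c x y {a..b}"
      and nn: "\<And>t. t \<in> {a..b} \<Longrightarrow> 0 \<le> x t" and big: "\<And>t. t \<in> {a..b} \<Longrightarrow> RN \<le> R (x t) (y t)"
    for a b x y
  proof -
    define z where "z = (\<lambda>t. y t / ((x t + 1)\<^sup>2 / 2))"
    define z' where "z' = (\<lambda>t. - poly h (x t) / ((x t + 1)\<^sup>2 / 2) - c * x t * z t - (x t + 1) * (z t)\<^sup>2)"
    have dx: "(x has_real_derivative y t) (at t within {a..b})"
      and dy: "(y has_real_derivative - poly h (x t) - c * x t * y t) (at t within {a..b})"
      if "t \<in> {a..b}" for t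
      using sol that by (auto simp: lienard_solution_def intro: has_field_derivative_at_within)
    have dz: "(z has_real_derivative z' t) (at t within {a..b})" if "t \<in> {a..b}" for t
    proof -
      have "0 < x t + 1" using nn[OF that] by simp
      then have nz: "(x t + 1)\<^sup>2 / 2 \<noteq> 0" by simp
      have "((\<lambda>t. (x t + 1)\<^sup>2 / 2) has_real_derivative (x t + 1) * y t) (at t within {a..b})"
        by (auto intro!: derivative_eq_intros dx[OF that] simp: field_simps)
      note DERIV_divide[OF dy[OF that] this nz]
      then have A: "(z has_real_derivative
          ((- poly h (x t) - c * x t * y t) * P - y t * ((x t + 1) * y t)) / (P * P)) (at t within {a..b})"
        if "P = (x t + 1)\<^sup>2 / 2" for P
        unfolding z_def that .
      have B: "((- h - c * u * v) * P - v * (w * v)) / (P * P) = - h / P - c * u * (v / P) - w * (v / P)\<^sup>2"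
        if "P \<noteq> 0" for h u v w P :: real
        using that by (simp add: field_simps power2_eq_square)
      show ?thesis using A[OF refl] unfolding B[OF nz] z'_def z_def .
    qed
    have d\<Theta>: "((\<lambda>t. \<Theta> (x t) (y t)) has_real_derivative z' t / (1 + (z t)\<^sup>2)) (at t within {a..b})"
      if "t \<in> {a..b}" for t
    proof -
      have "((\<lambda>t. arctan (z t)) has_real_derivative inverse (1 + (z t)\<^sup>2) * z' t) (at t within {a..b})"
        by (rule DERIV_chain2[OF DERIV_arctan dz[OF that]])
      moreover have "inverse (1 + (z t)\<^sup>2) * z' t = z' t / (1 + (z t)\<^sup>2)"
        by (simp add: divide_inverse)
      moreover have "(\<lambda>t. \<Theta> (x t) (y t)) = (\<lambda>t. arctan (z t))" by (simp only: \<Theta>_def z_def)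
      ultimately show ?thesis by (simp only:)
    qed
    have \<Theta>': "z' t / (1 + (z t)\<^sup>2) \<le> - \<epsilon> * (x t + 1)" if "t \<in> {a..b}" for t
    proof -
      have "z' t \<le> - \<epsilon> * (x t + 1) * (1 + (z t)\<^sup>2)" unfolding z'_def
        by (rule speed[OF nn[OF that] region[OF big[OF that] nn[OF that]]]) (simp add: z_def)
      moreover have "0 < 1 + (z t)\<^sup>2" by (rule add_pos_nonneg) auto
      ultimately show ?thesis by (simp add: pos_divide_le_eq)
    qed
    have Rpos: "0 < R (x t) (y t)" if "t \<in> {a..b}" for t using big[OF that] RN by linarith
    have dlR: "((\<lambda>t. ln (R (x t) (y t))) has_real_derivative - c * x t * (y t)\<^sup>2 / R (x t) (y t)) (at t within {a..b})"
      if "t \<in> {a..b}" for t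
    proof -
      have "((\<lambda>t. poly G (x t)) has_real_derivative poly h (x t) * y t) (at t within {a..b})"
        using DERIV_chain2[OF poly_DERIV dx[OF that], of G] by (simp add: G)
      moreover have "((\<lambda>t. (y t)\<^sup>2 / 2) has_real_derivative y t * (- poly h (x t) - c * x t * y t)) (at t within {a..b})"
        by (auto intro!: derivative_eq_intros dy[OF that])
      ultimately have "((\<lambda>t. R (x t) (y t)) has_real_derivative
          y t * (- poly h (x t) - c * x t * y t) + poly h (x t) * y t + 0) (at t within {a..b})"
        unfolding R_def by (intro DERIV_add DERIV_const)
      then have "((\<lambda>t. R (x t) (y t)) has_real_derivative - c * x t * (y t)\<^sup>2) (at t within {a..b})"
        by (rule DERIV_cong) (simp add: power2_eq_square algebra_simps)
      from DERIV_chain2[OF DERIV_ln[OF Rpos[OF that]] this]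
      have "((\<lambda>t. ln (R (x t) (y t))) has_real_derivative inverse (R (x t) (y t)) * (- c * x t * (y t)\<^sup>2)) (at t within {a..b})" .
      moreover have "inverse (R (x t) (y t)) * (- c * x t * (y t)\<^sup>2) = - c * x t * (y t)\<^sup>2 / R (x t) (y t)"
        by (simp add: divide_inverse)
      ultimately show ?thesis by (simp only:)
    qed
    have lR': "\<bar>- c * x t * (y t)\<^sup>2 / R (x t) (y t)\<bar> \<le> - \<kappa> * (z' t / (1 + (z t)\<^sup>2))" if "t \<in> {a..b}" for t
    proof -
      have "\<bar>- c * x t * (y t)\<^sup>2 / R (x t) (y t)\<bar> = \<bar>c\<bar> * x t * ((y t)\<^sup>2 / R (x t) (y t))"
        using nn[OF that] Rpos[OF that] by (simp add: abs_mult)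
      also have "\<dots> \<le> \<bar>c\<bar> * (x t + 1) * 2"
        using nn[OF that] Rpos[OF that] y2R[OF nn[OF that], of "y t"]
        by (intro mult_mono) (auto simp: pos_divide_le_eq)
      also have "\<dots> = \<kappa> * (\<epsilon> * (x t + 1))" using \<kappa>(2) by (simp add: mult.assoc[symmetric])
      also have "\<dots> \<le> \<kappa> * (- (z' t / (1 + (z t)\<^sup>2)))"
        using \<Theta>'[OF that] \<kappa>(1) by (intro mult_left_mono) auto
      finally show ?thesis by simp
    qed
    have "\<Theta> (x b) (y b) + \<epsilon> * b \<le> \<Theta> (x a) (y a) + \<epsilon> * a"
    proof (rule deriv_nonpos_mono[OF ab])
      fix t assume t: "t \<in> {a..b}"
      show "((\<lambda>t. \<Theta> (x t) (y t) + \<epsilon> * t) has_real_derivative z' t / (1 + (z t)\<^sup>2) + \<epsilon>) (at t within {a..b})"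
        by (auto intro!: derivative_eq_intros d\<Theta>[OF t])
    next
      fix t assume "t \<in> {a<..<b}"
      then have t: "t \<in> {a..b}" by auto
      have "\<epsilon> * 1 \<le> \<epsilon> * (x t + 1)" using nn[OF t] pos by (intro mult_left_mono) auto
      then show "z' t / (1 + (z t)\<^sup>2) + \<epsilon> \<le> 0" using \<Theta>'[OF t] by simp
    qed
    then have 1: "\<Theta> (x b) (y b) - \<Theta> (x a) (y a) \<le> - \<epsilon> * (b - a)" by (simp add: algebra_simps)
    have th: "\<Theta> (x a) (y a) - \<Theta> (x b) (y b) \<le> pi"
      using arctan_bounded unfolding \<Theta>_def by (smt (verit) field_sum_of_halves)
    have "\<kappa> * (\<Theta> (x a) (y a) - \<Theta> (x b) (y b)) \<le> \<kappa> * pi"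
      using th \<kappa>(1) by (intro mult_left_mono) auto
    moreover have "ln (R (x b) (y b)) + \<kappa> * \<Theta> (x b) (y b) \<le> ln (R (x a) (y a)) + \<kappa> * \<Theta> (x a) (y a)"
    proof (rule deriv_nonpos_mono[OF ab])
      fix t assume t: "t \<in> {a..b}"
      show "((\<lambda>t. ln (R (x t) (y t)) + \<kappa> * \<Theta> (x t) (y t)) has_real_derivative
          - c * x t * (y t)\<^sup>2 / R (x t) (y t) + \<kappa> * (z' t / (1 + (z t)\<^sup>2))) (at t within {a..b})"
        by (intro DERIV_add DERIV_cmult dlR[OF t] d\<Theta>[OF t])
    next
      fix t assume "t \<in> {a<..<b}"
      then have "t \<in> {a..b}" by auto
      from lR'[OF this] show "- c * x t * (y t)\<^sup>2 / R (x t) (y t) + \<kappa> * (z' t / (1 + (z t)\<^sup>2)) \<le> 0"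
        by linarith
    qed
    moreover have "ln (R (x a) (y a)) - \<kappa> * \<Theta> (x a) (y a) \<le> ln (R (x b) (y b)) - \<kappa> * \<Theta> (x b) (y b)"
    proof (rule deriv_nonneg_mono[OF ab])
      fix t assume t: "t \<in> {a..b}"
      show "((\<lambda>t. ln (R (x t) (y t)) - \<kappa> * \<Theta> (x t) (y t)) has_real_derivative
          - c * x t * (y t)\<^sup>2 / R (x t) (y t) - \<kappa> * (z' t / (1 + (z t)\<^sup>2))) (at t within {a..b})"
        by (intro DERIV_diff DERIV_cmult dlR[OF t] d\<Theta>[OF t])
    next
      fix t assume "t \<in> {a<..<b}"
      then have "t \<in> {a..b}" by auto
      from lR'[OF this] show "0 \<le> - c * x t * (y t)\<^sup>2 / R (x t) (y t) - \<kappa> * (z' t / (1 + (z t)\<^sup>2))"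
        by linarith
    qed
    ultimately have "ln (R (x b) (y b)) \<le> \<kappa> * pi + ln (R (x a) (y a))"
      "ln (R (x a) (y a)) \<le> \<kappa> * pi + ln (R (x b) (y b))"
      by (auto simp: algebra_simps)
    then have "exp (ln (R (x b) (y b))) \<le> exp (\<kappa> * pi + ln (R (x a) (y a)))"
      "exp (ln (R (x a) (y a))) \<le> exp (\<kappa> * pi + ln (R (x b) (y b)))"
      by (simp_all only: exp_le_cancel_iff)
    then show ?thesis using 1 Rpos[of a] Rpos[of b] ab by (simp add: exp_add \<Lambda>_def)
  qed
  have main: "(b - a \<le> pi / \<epsilon>) \<and>
      (\<forall>t\<in>{a..b}. R (x t) (y t) \<le> \<Lambda> * R (x a) (y a) \<and> R (x a) (y a) \<le> \<Lambda> * R (x t) (y t)) \<and>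
      (\<forall>s\<in>{a..b}. \<forall>t\<in>{a..b}. s < t \<longrightarrow> y s \<le> 0 \<longrightarrow> y t < 0)"
    if ab: "a \<le> b" and sol: "lienard_solution h c x y {a..b}"
      and nn: "\<And>t. t \<in> {a..b} \<Longrightarrow> 0 \<le> x t" and start: "\<Lambda> * RN < R (x a) (y a)"
    for a b x y
  proof -
    have "1 * RN \<le> \<Lambda> * RN" using \<Lambda> RN by (intro mult_right_mono) auto
    then have start': "RN < R (x a) (y a)" using start by linarith
    have contR: "continuous_on {a..b} (\<lambda>t. R (x t) (y t))"
      unfolding R_def using lienard_solution_continuous[OF sol] by (intro continuous_intros) auto
    \<comment> \<open>An orbit that starts above \<open>\<Lambda> * RN\<close> cannot reach the level \<open>RN\<close>, since until then it loses at most the factor \<open>\<Lambda>\<close>.\<close>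
    have big: "RN \<le> R (x t) (y t)" if t: "t \<in> {a..b}" for t
    proof (rule ccontr)
      assume "\<not> RN \<le> R (x t) (y t)"
      then have le: "R (x t) (y t) \<le> RN" and at: "a \<le> t" using t by auto
      have ct: "continuous_on {a..t} (\<lambda>t. R (x t) (y t))"
        by (rule continuous_on_subset[OF contR]) (use t in auto)
      obtain s where s: "a < s" "s \<le> t" "R (x s) (y s) = RN"
        "\<And>u. a \<le> u \<Longrightarrow> u < s \<Longrightarrow> RN < R (x u) (y u)"
        using first_hit[OF ct start' le at] by blast
      have "R (x a) (y a) \<le> \<Lambda> * R (x s) (y s)"
      proof -
        have "lienard_solution h c x y {a..s}"
          by (rule lienard_solution_subset[OF sol]) (use s t in auto)
        moreover have "RN \<le> R (x u) (y u)" if "u \<in> {a..s}" for u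
          using s(3) s(4)[of u] that by (cases "u = s") auto
        ultimately show ?thesis using core[of a s x y] nn s t by auto
      qed
      with start s show False by simp
    qed
    have sub: "\<Theta> (x t) (y t) - \<Theta> (x s) (y s) \<le> - \<epsilon> * (t - s) \<and>
      R (x t) (y t) \<le> \<Lambda> * R (x s) (y s) \<and> R (x s) (y s) \<le> \<Lambda> * R (x t) (y t)"
      if "a \<le> s" "s \<le> t" "t \<le> b" for s t
      by (rule core) (use that nn big lienard_solution_subset[OF sol, of "{s..t}"] in auto)
    have "\<epsilon> * (b - a) \<le> \<Theta> (x a) (y a) - \<Theta> (x b) (y b)" using sub[of a b] ab by simp
    also have "\<dots> \<le> pi"
      using arctan_bounded unfolding \<Theta>_def by (smt (verit) field_sum_of_halves)
    finally have "b - a \<le> pi / \<epsilon>" using pos by (simp add: pos_le_divide_eq mult.commute)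
    moreover have "y t < 0" if "s \<in> {a..b}" "t \<in> {a..b}" "s < t" "y s \<le> 0" for s t
    proof -
      have "0 < \<epsilon> * (t - s)" using that pos by simp
      then have "\<Theta> (x t) (y t) < \<Theta> (x s) (y s)" using sub[of s t] that by simp
      then have "y t / ((x t + 1)\<^sup>2 / 2) < y s / ((x s + 1)\<^sup>2 / 2)"
        by (simp add: \<Theta>_def arctan_less_iff)
      also have "\<dots> \<le> 0" using that by (simp add: divide_nonpos_nonneg)
      finally show ?thesis by (simp add: divide_less_0_iff)
    qed
    ultimately show ?thesis using sub by auto
  qed
  have "rotation_constants h G c K (\<Lambda> * RN) \<Lambda> (pi / \<epsilon>)"
    unfolding rotation_constants_def
  proof (intro conjI allI impI)
    show "0 < \<Lambda> * RN" using \<Lambda> RN by simp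
    show "0 < pi / \<epsilon>" using pos by simp
  next
    fix a b x y
    assume as: "a \<le> b" "lienard_solution h c x y {a..b}" "\<forall>t\<in>{a..b}. 0 \<le> x t"
      "\<Lambda> * RN < (y a)\<^sup>2 / 2 + poly G (x a) + K"
    have "\<Lambda> * RN < R (x a) (y a)" using as(4) by (simp add: R_def)
    note m = main[OF as(1,2) bspec[OF as(3)] this, unfolded R_def]
    show "b - a \<le> pi / \<epsilon>"
      "\<forall>s\<in>{a..b}. \<forall>t\<in>{a..b}. s < t \<longrightarrow> y s \<le> 0 \<longrightarrow> y t < 0"
      "\<forall>t\<in>{a..b}.
          (y t)\<^sup>2 / 2 + poly G (x t) + K \<le> \<Lambda> * ((y a)\<^sup>2 / 2 + poly G (x a) + K) \<and>
          (y a)\<^sup>2 / 2 + poly G (x a) + K \<le> \<Lambda> * ((y t)\<^sup>2 / 2 + poly G (x t) + K)"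
      using m by blast+
  qed (use \<Lambda> GK in auto)
  then show ?thesis by (rule that)
qed

section \<open>Energy as a function of position\<close>

text \<open>The energy \<open>e = y\<^sup>2 / 2 + G(x)\<close> as a function of \<open>x\<close> along the part with \<open>y > 0\<close> of an arc that starts on the
  \<open>y\<close>-axis and turns at \<open>x = X\<close>, where \<open>y = 0\<close> and \<open>e = G(X)\<close>. The part with \<open>y < 0\<close>, run backwards, is a branch
  for the parameter \<open>- c\<close>.\<close>

definition energy_branch :: "real poly \<Rightarrow> real \<Rightarrow> real \<Rightarrow> (real \<Rightarrow> real) \<Rightarrow> bool" where
  "energy_branch G c X e \<longleftrightarrow>
     0 < X \<and> continuous_on {0..X} e \<and> e X = poly G X \<and>
     (\<forall>\<xi>\<in>{0..<X}. poly G \<xi> < e \<xi>) \<and>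
     (\<forall>\<xi>\<in>{0<..<X}. (e has_real_derivative - c * \<xi> * sqrt (2 * (e \<xi> - poly G \<xi>))) (at \<xi>))"

lemma energy_branch_of_solution:
  assumes ab: "a < b" and sol: "lienard_solution h c x y {a..b}" and G: "pderiv G = h" "poly G 0 = 0"
    and "x a = 0" "y b = 0" and ypos: "\<And>t. a \<le> t \<Longrightarrow> t < b \<Longrightarrow> 0 < y t"
  obtains e where "energy_branch G c (x b) e" "e 0 = (y a)\<^sup>2 / 2"
proof -
  have dx: "(x has_real_derivative y t) (at t)"
    and dy: "(y has_real_derivative - poly h (x t) - c * x t * y t) (at t)" if "t \<in> {a..b}" for t
    using sol that by (auto simp: lienard_solution_def)
  have cx: "continuous_on {a..b} x" and cy: "continuous_on {a..b} y"
    using lienard_solution_continuous[OF sol] .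
  have mono: "x s < x t" if "a \<le> s" "s < t" "t \<le> b" for s t
  proof (rule DERIV_pos_imp_increasing_open[OF that(2)])
    fix u assume "s < u" "u < t"
    then show "\<exists>d. DERIV x u :> d \<and> 0 < d" using dx[of u] ypos[of u] that by auto
  qed (use cx that in \<open>auto intro: continuous_on_subset\<close>)
  have inj: "inj_on x {a..b}"
    by (rule inj_onI) (metis atLeastAtMost_iff less_irrefl linorder_neqE_linordered_idom mono)
  have img: "x ` {a..b} = {0..x b}"
  proof (intro equalityI subsetI)
    fix u assume "u \<in> x ` {a..b}"
    then obtain t where "t \<in> {a..b}" "u = x t" by blast
    then show "u \<in> {0..x b}" using mono[of a t] mono[of t b] assms(5) by (cases "t = a"; cases "t = b") auto
  next
    fix u assume "u \<in> {0..x b}"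
    then show "u \<in> x ` {a..b}" using IVT'[of x a u b] cx ab assms(5) by (auto simp: image_iff)
  qed
  define \<tau> where "\<tau> = the_inv_into {a..b} x"
  have \<tau>x: "\<tau> (x t) = t" if "t \<in> {a..b}" for t
    unfolding \<tau>_def by (rule the_inv_into_f_f[OF inj that])
  have x\<tau>: "x (\<tau> u) = u" and \<tau>in: "\<tau> u \<in> {a..b}" if "u \<in> {0..x b}" for u
    using that f_the_inv_into_f[OF inj, of u] the_inv_into_into[OF inj, of u "{a..b}"]
    by (auto simp: \<tau>_def img)
  have c\<tau>: "continuous_on {0..x b} \<tau>"
    using continuous_on_inv[OF cx, of \<tau>] \<tau>x by (simp add: img)
  define e where "e = (\<lambda>\<xi>. (y (\<tau> \<xi>))\<^sup>2 / 2 + poly G \<xi>)"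
  have "0 < x b" using mono[of a b] assms(5) ab by simp
  have ypos': "0 < y (\<tau> \<xi>)" if "\<xi> \<in> {0..<x b}" for \<xi>
  proof -
    have "\<tau> \<xi> \<noteq> b" using x\<tau>[of \<xi>] that by auto
    then show ?thesis using \<tau>in[of \<xi>] that by (intro ypos) auto
  qed
  have "energy_branch G c (x b) e"
    unfolding energy_branch_def
  proof (intro conjI ballI)
    show "0 < x b" by fact
    show "continuous_on {0..x b} e" unfolding e_def
      by (intro continuous_intros continuous_on_compose2[OF cy c\<tau>]) (use \<tau>in in auto)
    show "e (x b) = poly G (x b)" using \<tau>x[of b] assms(6) ab by (simp add: e_def)
    show "poly G \<xi> < e \<xi>" if "\<xi> \<in> {0..<x b}" for \<xi>
      using ypos'[OF that] by (simp add: e_def)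
    fix \<xi> assume \<xi>: "\<xi> \<in> {0<..<x b}"
    then have \<xi>': "\<xi> \<in> {0..x b}" "\<xi> \<in> {0..<x b}" by auto
    have yp: "0 < y (\<tau> \<xi>)" by (rule ypos') fact
    have "(\<tau> has_real_derivative inverse (y (\<tau> \<xi>))) (at \<xi>)"
    proof (rule DERIV_inverse_function[where f = x and a = 0 and b = "x b"])
      show "DERIV x (\<tau> \<xi>) :> y (\<tau> \<xi>)" by (rule dx[OF \<tau>in]) fact
      show "isCont \<tau> \<xi>"
        using c\<tau> \<xi> by (intro continuous_on_interior) auto
    qed (use \<xi> yp x\<tau> in auto)
    note DERIV_chain2[OF dy[OF \<tau>in[OF \<xi>'(1)]] this]
    then have "((\<lambda>\<xi>. y (\<tau> \<xi>)) has_real_derivative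
        (- poly h \<xi> - c * \<xi> * y (\<tau> \<xi>)) * inverse (y (\<tau> \<xi>))) (at \<xi>)"
      by (simp only: x\<tau>[OF \<xi>'(1)])
    from DERIV_cdivide[OF DERIV_power[OF this, of 2], of 2]
    have "(e has_real_derivative real 2 * ((- poly h \<xi> - c * \<xi> * y (\<tau> \<xi>)) * inverse (y (\<tau> \<xi>)) *
        y (\<tau> \<xi>) ^ (2 - Suc 0)) / 2 + poly h \<xi>) (at \<xi>)"
      unfolding e_def using poly_DERIV[of G \<xi>] by (intro DERIV_add) (simp_all add: G)
    moreover have "real 2 * ((- poly h \<xi> - c * \<xi> * y (\<tau> \<xi>)) * inverse (y (\<tau> \<xi>)) *
        y (\<tau> \<xi>) ^ (2 - Suc 0)) / 2 + poly h \<xi> = - c * \<xi> * y (\<tau> \<xi>)"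
      using yp by (simp add: field_simps)
    moreover have "y (\<tau> \<xi>) = sqrt (2 * (e \<xi> - poly G \<xi>))"
      using yp by (simp add: e_def)
    ultimately show "(e has_real_derivative - c * \<xi> * sqrt (2 * (e \<xi> - poly G \<xi>))) (at \<xi>)" by simp
  qed
  moreover have "e 0 = (y a)\<^sup>2 / 2" using \<tau>x[of a] assms(5) ab G(2) by (simp add: e_def)
  ultimately show ?thesis using that by blast
qed

text \<open>Branches with large initial velocity have almost constant velocity on a fixed interval
  \<open>{0..K}\<close>, uniformly.\<close>

lemma energy_branch_flat_start:
  assumes "0 < K"
  obtains C where "0 < C" "\<And>X e. energy_branch G c X e \<Longrightarrow> C + 1 < sqrt (2 * e 0) \<Longrightarrow>
     poly G 0 = 0 \<Longrightarrow>
     K < X \<and> (\<forall>\<xi>\<in>{0..K}. \<bar>sqrt (2 * (e \<xi> - poly G \<xi>)) - sqrt (2 * e 0)\<bar> \<le> C)"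
proof -
  have "compact ((\<lambda>x. poly (pderiv G) x) ` {0..K})"
    by (intro compact_continuous_image continuous_intros) auto
  then obtain M where M: "\<And>x. x \<in> {0..K} \<Longrightarrow> \<bar>poly (pderiv G) x\<bar> \<le> M"
    by (metis bounded_real compact_imp_bounded image_eqI)
  have M0: "0 \<le> M" using M[of 0] assms by force
  define D where "D = \<bar>c\<bar> * K + M"
  have D0: "0 \<le> D" using M0 assms by (simp add: D_def)
  define C where "C = D * K + 1"
  show ?thesis
  proof (rule that[of C])
    show "0 < C" using D0 assms by (simp add: C_def add_nonneg_pos)
    fix X e assume br: "energy_branch G c X e" and big: "C + 1 < sqrt (2 * e 0)" and G0: "poly G 0 = 0"
    define y where "y = (\<lambda>\<xi>. sqrt (2 * (e \<xi> - poly G \<xi>)))"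
    have y0: "y 0 = sqrt (2 * e 0)" using G0 by (simp add: y_def)
    have X: "0 < X" and ce: "continuous_on {0..X} e"
      and de: "\<And>\<xi>. \<xi> \<in> {0<..<X} \<Longrightarrow> (e has_real_derivative - c * \<xi> * y \<xi>) (at \<xi>)"
      and gt: "\<And>\<xi>. \<xi> \<in> {0..<X} \<Longrightarrow> poly G \<xi> < e \<xi>" and "y X = 0"
      using br by (auto simp: energy_branch_def y_def)
    have cy: "continuous_on {0..X} y" unfolding y_def by (intro continuous_intros ce)
    have dy: "(y has_real_derivative (- c * \<xi> * y \<xi> - poly (pderiv G) \<xi>) / y \<xi>) (at \<xi>)"
      if \<xi>: "\<xi> \<in> {0<..<X}" for \<xi>
    proof -
      have p: "0 < 2 * (e \<xi> - poly G \<xi>)" using gt[of \<xi>] \<xi> by auto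
      have "((\<lambda>\<xi>. 2 * (e \<xi> - poly G \<xi>)) has_real_derivative 2 * (- c * \<xi> * y \<xi> - poly (pderiv G) \<xi>)) (at \<xi>)"
        by (intro DERIV_cmult DERIV_diff de \<xi> poly_DERIV)
      from DERIV_chain2[OF DERIV_real_sqrt[OF p] this]
      have "(y has_real_derivative inverse (y \<xi>) / 2 * (2 * (- c * \<xi> * y \<xi> - poly (pderiv G) \<xi>))) (at \<xi>)"
        unfolding y_def .
      moreover have "inverse u / 2 * (2 * v) = v / u" for u v :: real
        by (simp add: inverse_eq_divide)
      ultimately show ?thesis by (simp only:)
    qed
    have close: "\<bar>y \<xi> - y 0\<bar> \<le> D * K" if \<xi>: "0 \<le> \<xi>" "\<xi> \<le> K" "\<xi> \<le> X"
      and ge: "\<And>s. 0 \<le> s \<Longrightarrow> s < \<xi> \<Longrightarrow> 1 \<le> y s" for \<xi>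
    proof (cases "\<xi> = 0")
      case False
      with \<xi> have "0 < \<xi>" by simp
      have "\<exists>l s. 0 < s \<and> s < \<xi> \<and> DERIV y s :> l \<and> y \<xi> - y 0 = (\<xi> - 0) * l"
      proof (rule MVT[OF \<open>0 < \<xi>\<close>])
        show "continuous_on {0..\<xi>} y"
          by (rule continuous_on_subset[OF cy]) (use \<xi> in auto)
        show "y differentiable (at u)" if "0 < u" "u < \<xi>" for u
          using dy[of u] that \<xi> by (force simp: real_differentiable_def)
      qed
      then obtain l s where s: "0 < s" "s < \<xi>" and sl0: "DERIV y s :> l" "y \<xi> - y 0 = (\<xi> - 0) * l"
        by blast
      have "(y has_real_derivative (- c * s * y s - poly (pderiv G) s) / y s) (at s)"
        by (rule dy) (use s \<xi> in auto)
      from DERIV_unique[OF sl0(1) this] sl0(2)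
      have sl: "y \<xi> - y 0 = \<xi> * ((- c * s * y s - poly (pderiv G) s) / y s)" by simp
      have "\<bar>(- c * s * y s - poly (pderiv G) s) / y s\<bar> \<le> D"
      proof -
        have y1: "1 \<le> y s" using ge s by simp
        have "(- c * s * y s - poly (pderiv G) s) / y s = - c * s - poly (pderiv G) s / y s"
          using y1 by (simp add: diff_divide_distrib)
        moreover have "\<bar>poly (pderiv G) s / y s\<bar> \<le> M"
        proof -
          have "\<bar>poly (pderiv G) s / y s\<bar> = \<bar>poly (pderiv G) s\<bar> / y s" using y1 by simp
          also have "\<dots> \<le> \<bar>poly (pderiv G) s\<bar> / 1" using y1 by (intro divide_left_mono) auto
          also have "\<dots> \<le> M" using M[of s] s \<xi> by simp
          finally show ?thesis .
        qed
        moreover have "\<bar>c * s\<bar> \<le> \<bar>c\<bar> * K" using s \<xi> by (simp add: abs_mult mult_left_mono)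
        ultimately show ?thesis unfolding D_def by linarith
      qed
      from mult_left_mono[OF this \<xi>(1)]
      have "\<bar>y \<xi> - y 0\<bar> \<le> \<xi> * D" unfolding sl by (simp only: abs_mult abs_of_nonneg[OF \<xi>(1)])
      also have "\<xi> * D \<le> K * D" using \<xi> D0 by (intro mult_right_mono) auto
      also have "K * D = D * K" by simp
      finally show ?thesis .
    qed (use D0 assms in auto)
    have ge1: "1 \<le> y \<xi>" if \<xi>: "0 \<le> \<xi>" "\<xi> \<le> K" "\<xi> \<le> X" for \<xi>
    proof (rule ccontr)
      assume "\<not> 1 \<le> y \<xi>"
      then have le: "y \<xi> \<le> 1" by simp
      have gt1: "1 < y 0" using big y0 \<open>0 < C\<close> by linarith
      have cy': "continuous_on {0..\<xi>} y"
        by (rule continuous_on_subset[OF cy]) (use \<xi> in auto)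
      obtain s where s: "0 < s" "s \<le> \<xi>" "y s = 1" "\<And>u. 0 \<le> u \<Longrightarrow> u < s \<Longrightarrow> 1 < y u"
        using first_hit[OF cy' gt1 le \<xi>(1)] by blast
      have "\<bar>y s - y 0\<bar> \<le> D * K" by (rule close) (use s \<xi> in \<open>auto intro: less_imp_le\<close>)
      then show False using big y0 s(3) by (simp add: C_def)
    qed
    have "K < X" 
    proof (rule ccontr)
      assume "\<not> K < X"
      then show False using ge1[of X] \<open>y X = 0\<close> X by simp
    qed
    moreover have "\<bar>y \<xi> - y 0\<bar> \<le> C" if "\<xi> \<in> {0..K}" for \<xi>
      using close[of \<xi>] ge1 that \<open>K < X\<close> by (force simp: C_def)
    ultimately show "K < X \<and> (\<forall>\<xi>\<in>{0..K}. \<bar>sqrt (2 * (e \<xi> - poly G \<xi>)) - sqrt (2 * e 0)\<bar> \<le> C)"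
      using y0 by (simp add: y_def)
  qed
qed

text \<open>Write \<open>\<Gamma> = G1 - G2\<close> and \<open>\<Delta> = sgn c * (e1 - e2)\<close>. Then \<open>\<Delta>' = \<beta> (\<bar>c\<bar> \<Gamma> - c \<Delta>)\<close> with \<open>\<beta> = 2 \<xi> / (y1 + y2)\<close>. On
  \<open>{0..K}\<close> the sum \<open>y1 + y2\<close> is nearly constant, so there the sign of the gain is that of the integral \<open>Q(K)\<close>
  of \<open>\<xi> \<Gamma>(\<xi>)\<close>, even if \<open>\<Gamma>\<close> is negative somewhere; beyond \<open>K\<close> the right-hand side preserves
  \<open>\<Delta> \<ge> 0\<close>.\<close>

lemma energy_branch_comparison:
  fixes G1 G2 Q :: "real poly" and c K :: real
  assumes "c \<noteq> 0" "0 < K" and G0: "poly G1 0 = 0" "poly G2 0 = 0"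
    and gap: "\<And>\<xi>. K \<le> \<xi> \<Longrightarrow> 0 \<le> poly (G1 - G2) \<xi>"
    and Q: "pderiv Q = [:0, 1:] * (G1 - G2)" "poly Q 0 = 0" "0 < poly Q K"
  obtains Y0 where "0 < Y0"
    "\<And>X1 X2 e1 e2. \<lbrakk>energy_branch G1 c X1 e1; energy_branch G2 c X2 e2;
        Y0 < sqrt (2 * e1 0); Y0 < sqrt (2 * e2 0); 0 \<le> sgn c * (e1 0 - e2 0)\<rbrakk> \<Longrightarrow>
        K < min X1 X2 \<and> (\<forall>\<xi>\<in>{K..min X1 X2}. 0 \<le> sgn c * (e1 \<xi> - e2 \<xi>))"
proof -
  obtain C1 where C1: "0 < C1" "\<And>X e. energy_branch G1 c X e \<Longrightarrow> C1 + 1 < sqrt (2 * e 0) \<Longrightarrow>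
     K < X \<and> (\<forall>\<xi>\<in>{0..K}. \<bar>sqrt (2 * (e \<xi> - poly G1 \<xi>)) - sqrt (2 * e 0)\<bar> \<le> C1)"
    using energy_branch_flat_start[OF assms(2), of G1 c] G0(1) by metis
  obtain C2 where C2: "0 < C2" "\<And>X e. energy_branch G2 c X e \<Longrightarrow> C2 + 1 < sqrt (2 * e 0) \<Longrightarrow>
     K < X \<and> (\<forall>\<xi>\<in>{0..K}. \<bar>sqrt (2 * (e \<xi> - poly G2 \<xi>)) - sqrt (2 * e 0)\<bar> \<le> C2)"
    using energy_branch_flat_start[OF assms(2), of G2 c] G0(2) by metis
  define C where "C = C1 + C2"
  define \<Gamma> where "\<Gamma> = (\<lambda>\<xi>. poly (G1 - G2) \<xi>)"
  have "compact ((\<lambda>\<xi>. \<xi> * \<Gamma> \<xi>) ` {0..K})" unfolding \<Gamma>_def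
    by (intro compact_continuous_image continuous_intros) auto
  then obtain M0 where M0: "\<And>\<xi>. \<xi> \<in> {0..K} \<Longrightarrow> \<bar>\<xi> * \<Gamma> \<xi>\<bar> \<le> M0"
    by (metis (no_types, lifting) bounded_real compact_imp_bounded image_eqI)
  define M where "M = M0 + 1"
  have M: "0 < M" "\<And>\<xi>. \<xi> \<in> {0..K} \<Longrightarrow> \<bar>\<xi> * \<Gamma> \<xi>\<bar> \<le> M"
    using M0 M0[of 0] assms(2) by (force simp: M_def)+
  define \<eta> where "\<eta> = poly Q K / (M * K)"
  have \<eta>: "0 < \<eta>" using M Q assms(2) by (simp add: \<eta>_def)
  have decay: "((\<lambda>S. a / (S - u)) \<longlongrightarrow> 0) at_top" for a u :: real
  proof (rule tendsto_divide_0[OF tendsto_const])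
    have "filterlim (\<lambda>S. - u + S) at_top (at_top :: real filter)"
      by (rule filterlim_tendsto_add_at_top[OF tendsto_const filterlim_ident])
    then show "filterlim (\<lambda>S. S - u) at_infinity at_top"
      by (intro filterlim_at_top_imp_at_infinity) (simp add: algebra_simps)
  qed
  have ratio: "((\<lambda>S. S / (S - u)) \<longlongrightarrow> 1) at_top" for u :: real
  proof (rule Lim_transform_eventually)
    show "((\<lambda>S. 1 + u / (S - u)) \<longlongrightarrow> 1) at_top"
      using tendsto_add[OF tendsto_const[of 1] decay[of u u]] by simp
    show "\<forall>\<^sub>F S in at_top. 1 + u / (S - u) = S / (S - u)"
      using eventually_gt_at_top[of u] by eventually_elim (simp add: field_simps)
  qed
  have lim1: "((\<lambda>S. S / (S - C) * exp (\<bar>c\<bar> * (2 * K * K / (S - C)))) \<longlongrightarrow> 1) at_top"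
    using tendsto_mult[OF ratio tendsto_exp[OF tendsto_mult_right_zero[OF decay]]] by simp
  have lim2: "((\<lambda>S. S / (S + C) * exp (- (\<bar>c\<bar> * (2 * K * K / (S - C))))) \<longlongrightarrow> 1) at_top"
    using tendsto_mult[OF ratio[of "- C"] tendsto_exp[OF tendsto_minus[OF tendsto_mult_right_zero[OF decay]]]]
    by simp
  have "\<forall>\<^sub>F S in at_top. S / (S - C) * exp (\<bar>c\<bar> * (2 * K * K / (S - C))) < 1 + \<eta>"
    using order_tendstoD(2)[OF lim1, of "1 + \<eta>"] \<eta> by simp
  moreover have "\<forall>\<^sub>F S in at_top. 1 - \<eta> < S / (S + C) * exp (- (\<bar>c\<bar> * (2 * K * K / (S - C))))"
    using order_tendstoD(1)[OF lim2, of "1 - \<eta>"] \<eta> by simp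
  ultimately have "\<forall>\<^sub>F S in at_top. S / (S - C) * exp (\<bar>c\<bar> * (2 * K * K / (S - C))) < 1 + \<eta> \<and>
      1 - \<eta> < S / (S + C) * exp (- (\<bar>c\<bar> * (2 * K * K / (S - C))))"
    by (rule eventually_conj)
  then obtain S0 where S0: "\<And>S. S0 \<le> S \<Longrightarrow> S / (S - C) * exp (\<bar>c\<bar> * (2 * K * K / (S - C))) < 1 + \<eta> \<and>
      1 - \<eta> < S / (S + C) * exp (- (\<bar>c\<bar> * (2 * K * K / (S - C))))"
    by (auto simp: eventually_at_top_linorder)
  define Y0 where "Y0 = max (C + 1) S0"
  show ?thesis
  proof (rule that[of Y0])
    show "0 < Y0" using C1 C2 by (simp add: Y0_def C_def)
    fix X1 X2 e1 e2
    assume br1: "energy_branch G1 c X1 e1" and br2: "energy_branch G2 c X2 e2"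
      and big1: "Y0 < sqrt (2 * e1 0)" and big2: "Y0 < sqrt (2 * e2 0)"
      and start: "0 \<le> sgn c * (e1 0 - e2 0)"
    define y1 where "y1 = (\<lambda>\<xi>. sqrt (2 * (e1 \<xi> - poly G1 \<xi>)))"
    define y2 where "y2 = (\<lambda>\<xi>. sqrt (2 * (e2 \<xi> - poly G2 \<xi>)))"
    define S where "S = y1 0 + y2 0"
    have y0: "y1 0 = sqrt (2 * e1 0)" "y2 0 = sqrt (2 * e2 0)" using G0 by (auto simp: y1_def y2_def)
    have flat1: "K < X1 \<and> (\<forall>\<xi>\<in>{0..K}. \<bar>y1 \<xi> - y1 0\<bar> \<le> C1)"
      unfolding y0 unfolding y1_def using C1(2)[OF br1] big1 C2(1) by (simp add: Y0_def C_def)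
    have flat2: "K < X2 \<and> (\<forall>\<xi>\<in>{0..K}. \<bar>y2 \<xi> - y2 0\<bar> \<le> C2)"
      unfolding y0 unfolding y2_def using C2(2)[OF br2] big2 C1(1) by (simp add: Y0_def C_def)
    define X where "X = min X1 X2"
    have KX: "K < X" using flat1 flat2 by (simp add: X_def)
    have SC: "C < S" "S0 \<le> S" using big1 big2 y0 C1(1) C2(1) by (auto simp: S_def Y0_def C_def)
    have "0 < S" using SC C1 C2 by (simp add: C_def)
    have cont1: "continuous_on {0..X} e1" and cont2: "continuous_on {0..X} e2"
      using br1 br2 unfolding energy_branch_def X_def by (auto intro: continuous_on_subset)
    have conty: "continuous_on {0..X} y1" "continuous_on {0..X} y2"
      unfolding y1_def y2_def by (intro continuous_intros cont1 cont2)+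
    have pos: "poly G1 \<xi> < e1 \<xi>" "poly G2 \<xi> < e2 \<xi>" if "\<xi> \<in> {0..<X}" for \<xi>
      using br1 br2 that by (auto simp: energy_branch_def X_def)
    have ypos: "0 < y1 \<xi> + y2 \<xi>" if "\<xi> \<in> {0..<X}" for \<xi>
      using pos[OF that] by (auto simp: y1_def y2_def intro!: add_pos_pos)
    have dE: "(e1 has_real_derivative - c * \<xi> * y1 \<xi>) (at \<xi>)" "(e2 has_real_derivative - c * \<xi> * y2 \<xi>) (at \<xi>)"
      if "\<xi> \<in> {0<..<X}" for \<xi>
      using br1 br2 that by (auto simp: energy_branch_def X_def y1_def y2_def)
    have ysq: "y1 \<xi> - y2 \<xi> = 2 * (e1 \<xi> - e2 \<xi> - \<Gamma> \<xi>) / (y1 \<xi> + y2 \<xi>)" if "\<xi> \<in> {0..<X}" for \<xi>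
    proof -
      have "(y1 \<xi> - y2 \<xi>) * (y1 \<xi> + y2 \<xi>) = (y1 \<xi>)\<^sup>2 - (y2 \<xi>)\<^sup>2"
        by (simp add: power2_eq_square algebra_simps)
      also have "\<dots> = 2 * (e1 \<xi> - e2 \<xi> - \<Gamma> \<xi>)"
        using pos[OF that] by (simp add: y1_def y2_def \<Gamma>_def)
      finally show ?thesis using ypos[OF that] by (simp add: eq_divide_eq)
    qed
    define \<Delta> where "\<Delta> = (\<lambda>\<xi>. sgn c * (e1 \<xi> - e2 \<xi>))"
    define \<beta> where "\<beta> = (\<lambda>\<xi>. 2 * \<xi> / (y1 \<xi> + y2 \<xi>))"
    have cont\<Delta>: "continuous_on {0..X} \<Delta>" unfolding \<Delta>_def by (intro continuous_intros cont1 cont2)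
    have d\<Delta>: "(\<Delta> has_real_derivative \<beta> \<xi> * (\<bar>c\<bar> * \<Gamma> \<xi> - c * \<Delta> \<xi>)) (at \<xi>)" if \<xi>: "\<xi> \<in> {0<..<X}" for \<xi>
    proof -
      have \<xi>': "\<xi> \<in> {0..<X}" using \<xi> by auto
      have "(\<Delta> has_real_derivative sgn c * (- c * \<xi> * y1 \<xi> - - c * \<xi> * y2 \<xi>)) (at \<xi>)"
        unfolding \<Delta>_def by (intro DERIV_cmult DERIV_diff dE[OF \<xi>])
      moreover have "sgn c * (- c * \<xi> * y1 \<xi> - - c * \<xi> * y2 \<xi>) = - (sgn c * c) * \<xi> * (y1 \<xi> - y2 \<xi>)"
        by (simp add: algebra_simps)
      moreover have "\<dots> = \<beta> \<xi> * (\<bar>c\<bar> * \<Gamma> \<xi> - c * \<Delta> \<xi>)"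
      proof -
        have s: "sgn c * c = \<bar>c\<bar>" by (simp add: abs_sgn mult.commute)
        have "c * \<Delta> \<xi> = \<bar>c\<bar> * (e1 \<xi> - e2 \<xi>)"
          by (simp add: \<Delta>_def s[symmetric] algebra_simps)
        then have "\<bar>c\<bar> * \<Gamma> \<xi> - c * \<Delta> \<xi> = - \<bar>c\<bar> * (e1 \<xi> - e2 \<xi> - \<Gamma> \<xi>)"
          by (simp only:) (simp add: algebra_simps)
        then show ?thesis unfolding s ysq[OF \<xi>'] \<beta>_def by simp
      qed
      ultimately show ?thesis by simp
    qed
    \<comment> \<open>\<open>exp (c * Bf)\<close> is the integrating factor of the equation for \<open>\<Delta>\<close>.\<close>
    define Bf where "Bf = (\<lambda>\<xi>. integral {0..\<xi>} \<beta>)"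
    have cont\<beta>: "continuous_on {0..b} \<beta>" if "b < X" for b
      unfolding \<beta>_def using conty that ypos
      by (intro continuous_intros) (force intro: continuous_on_subset)+
    have dB: "(Bf has_real_derivative \<beta> \<xi>) (at \<xi> within {0..b})" if "\<xi> \<in> {0..b}" "b < X" for \<xi> b
      unfolding Bf_def by (rule integral_has_real_derivative[OF cont\<beta>[OF that(2)] that(1)])
    define P where "P = (\<lambda>\<xi>. \<Delta> \<xi> * exp (c * Bf \<xi>))"
    have dP: "(P has_real_derivative \<bar>c\<bar> * (\<xi> * \<Gamma> \<xi>) * (2 / (y1 \<xi> + y2 \<xi>) * exp (c * Bf \<xi>))) (at \<xi>)"
      if \<xi>: "\<xi> \<in> {0<..<X}" for \<xi>
    proof -
      define b where "b = (\<xi> + X) / 2"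
      have b: "\<xi> < b" "b < X" "0 < \<xi>" using \<xi> by (auto simp: b_def)
      have "(Bf has_real_derivative \<beta> \<xi>) (at \<xi>)"
        using dB[of \<xi> b] b by (simp add: at_within_Icc_at)
      note DERIV_mult[OF d\<Delta>[OF \<xi>] DERIV_chain2[OF DERIV_exp DERIV_cmult[OF this, of c]]]
      then show ?thesis unfolding P_def
        by (rule DERIV_cong) (simp add: \<beta>_def algebra_simps diff_divide_distrib)
    qed
    have contP: "continuous_on {0..b} P" if "b < X" for b
      unfolding P_def using dB[OF _ that] cont\<Delta> that
      by (intro continuous_intros DERIV_continuous_on[of _ Bf \<beta>]) (auto intro: continuous_on_subset)
    have PK: "0 \<le> P K"
    proof -
      \<comment> \<open>\<open>\<eta>\<close> was chosen such that \<open>Q(K) = \<eta> M K\<close>, so monotonicity of \<open>W\<close> gives \<open>P(K) \<ge> 0\<close>.\<close>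
      define W where "W = (\<lambda>\<xi>. S / 2 * P \<xi> - \<bar>c\<bar> * (poly Q \<xi> - \<eta> * M * \<xi>))"
      have "W 0 \<le> W K"
      proof (rule DERIV_nonneg_imp_increasing_open[where f = W and a = 0 and b = K])
        fix \<xi> assume \<xi>: "0 < \<xi>" "\<xi> < K"
        then have \<xi>X: "\<xi> \<in> {0<..<X}" "\<xi> \<in> {0..<X}" "\<xi> \<in> {0..K}" using KX by auto
        define q where "q = S / (y1 \<xi> + y2 \<xi>) * exp (c * Bf \<xi>)"
        have near: "S - C \<le> y1 u + y2 u" "y1 u + y2 u \<le> S + C" if "u \<in> {0..K}" for u
          using flat1 flat2 that by (auto simp: S_def C_def abs_le_iff dest!: bspec[of _ _ u])
        have \<beta>b: "0 \<le> \<beta> u \<and> \<beta> u \<le> 2 * K / (S - C)" if "u \<in> {0..\<xi>}" for u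
        proof -
          have "u \<in> {0..K}" using that \<xi> by auto
          from near[OF this] show ?thesis using SC that \<xi> unfolding \<beta>_def
            by (auto intro!: divide_nonneg_nonneg frac_le)
        qed
        have int: "\<beta> integrable_on {0..\<xi>}"
          by (rule integrable_continuous_real[OF cont\<beta>]) (use \<xi>X in auto)
        have "0 \<le> Bf \<xi>" unfolding Bf_def
          by (rule Henstock_Kurzweil_Integration.integral_nonneg[OF int]) (use \<beta>b in auto)
        have "Bf \<xi> \<le> integral {0..\<xi>} (\<lambda>_. 2 * K / (S - C))" unfolding Bf_def
          by (rule Henstock_Kurzweil_Integration.integral_le[OF int]) (use \<beta>b in auto)
        moreover have "integral {0..\<xi>} (\<lambda>_. r) = \<xi> * r" for r :: real using \<xi> by simp
        ultimately have Bf: "0 \<le> Bf \<xi>" "Bf \<xi> \<le> \<xi> * (2 * K / (S - C))"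
          using \<open>0 \<le> Bf \<xi>\<close> by (simp_all only:)
        have "\<xi> * (2 * K / (S - C)) \<le> K * (2 * K / (S - C))"
          using \<xi> SC by (intro mult_right_mono) auto
        with Bf have "Bf \<xi> \<le> K * (2 * K / (S - C))" by linarith
        then have "\<bar>c\<bar> * Bf \<xi> \<le> \<bar>c\<bar> * (K * (2 * K / (S - C)))"
          by (rule mult_left_mono) simp
        moreover have "\<bar>c * Bf \<xi>\<bar> = \<bar>c\<bar> * Bf \<xi>" using Bf(1) by (simp add: abs_mult)
        ultimately have "\<bar>c * Bf \<xi>\<bar> \<le> \<bar>c\<bar> * (K * (2 * K / (S - C)))" by (simp only:)
        also have "K * (2 * K / (S - C)) = 2 * K * K / (S - C)" by simp
        finally have cB: "c * Bf \<xi> \<le> \<bar>c\<bar> * (2 * K * K / (S - C))" "- (\<bar>c\<bar> * (2 * K * K / (S - C))) \<le> c * Bf \<xi>"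
          by linarith+
        have "q \<le> S / (S - C) * exp (\<bar>c\<bar> * (2 * K * K / (S - C)))"
          unfolding q_def using near[OF \<xi>X(3)] SC \<open>0 < S\<close> cB
          by (intro mult_mono divide_left_mono) auto
        moreover have "S / (S + C) * exp (- (\<bar>c\<bar> * (2 * K * K / (S - C)))) \<le> q"
          unfolding q_def using near[OF \<xi>X(3)] SC \<open>0 < S\<close> cB
          by (intro mult_mono divide_left_mono) auto
        ultimately have "\<bar>q - 1\<bar> \<le> \<eta>" using S0[OF SC(2)] by linarith
        then have "\<bar>\<xi> * \<Gamma> \<xi>\<bar> * \<bar>q - 1\<bar> \<le> M * \<eta>"
          using M(2)[OF \<xi>X(3)] M(1) by (intro mult_mono) auto
        then have "\<bar>\<xi> * \<Gamma> \<xi> * (q - 1)\<bar> \<le> \<eta> * M" by (simp add: abs_mult mult.commute)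
        then have nn: "0 \<le> \<xi> * \<Gamma> \<xi> * (q - 1) + \<eta> * M" by linarith
        have dQ: "(poly Q has_real_derivative \<xi> * \<Gamma> \<xi>) (at \<xi>)"
          using poly_DERIV[of Q \<xi>] by (simp add: Q \<Gamma>_def)
        have "(W has_real_derivative
            S / 2 * (\<bar>c\<bar> * (\<xi> * \<Gamma> \<xi>) * (2 / (y1 \<xi> + y2 \<xi>) * exp (c * Bf \<xi>))) - \<bar>c\<bar> * (\<xi> * \<Gamma> \<xi> - \<eta> * M * 1)) (at \<xi>)"
          unfolding W_def by (intro DERIV_diff DERIV_cmult dP \<xi>X dQ DERIV_ident)
        moreover have "S / 2 * (\<bar>c\<bar> * (\<xi> * \<Gamma> \<xi>) * (2 / (y1 \<xi> + y2 \<xi>) * exp (c * Bf \<xi>))) = \<bar>c\<bar> * (\<xi> * \<Gamma> \<xi> * q)"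
          by (simp add: q_def)
        moreover have "0 \<le> \<bar>c\<bar> * (\<xi> * \<Gamma> \<xi> * (q - 1) + \<eta> * M)" using nn by (intro mult_nonneg_nonneg) auto
        then have "0 \<le> \<bar>c\<bar> * (\<xi> * \<Gamma> \<xi> * q) - \<bar>c\<bar> * (\<xi> * \<Gamma> \<xi> - \<eta> * M * 1)"
          by (simp add: algebra_simps)
        ultimately show "\<exists>d. (W has_real_derivative d) (at \<xi>) \<and> 0 \<le> d"
          by auto
      next
        show "continuous_on {0..K} W" unfolding W_def by (intro continuous_intros contP KX)
      qed (use assms(2) in simp)
      then have "S / 2 * P 0 + \<bar>c\<bar> * (poly Q K - \<eta> * M * K) \<le> S / 2 * P K"
        using Q(2) by (simp add: W_def)
      moreover have "poly Q K - \<eta> * M * K = 0" using M assms(2) by (simp add: \<eta>_def)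
      moreover have "0 \<le> S / 2 * P 0" using start \<open>0 < S\<close> by (simp add: P_def \<Delta>_def)
      ultimately have "0 \<le> S / 2 * P K" by simp
      then show ?thesis using \<open>0 < S\<close> by (simp add: zero_le_mult_iff)
    qed
    have \<Delta>: "0 \<le> \<Delta> \<xi>" if \<xi>: "K \<le> \<xi>" "\<xi> < X" for \<xi>
    proof -
      have "P K \<le> P \<xi>"
      proof (rule DERIV_nonneg_imp_increasing_open[OF \<xi>(1), where f = P])
        fix u assume u: "K < u" "u < \<xi>"
        then have "u \<in> {0<..<X}" using \<xi> assms(2) by auto
        moreover have "0 \<le> \<bar>c\<bar> * (u * \<Gamma> u) * (2 / (y1 u + y2 u) * exp (c * Bf u))"
          using gap[of u] u assms(2) ypos[of u] \<xi> by (auto simp: \<Gamma>_def intro!: mult_nonneg_nonneg divide_nonneg_nonneg)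
        ultimately show "\<exists>d. (P has_real_derivative d) (at u) \<and> 0 \<le> d" using dP by blast
      qed (use contP[OF \<xi>(2)] assms(2) in \<open>auto intro: continuous_on_subset\<close>)
      with PK have "0 \<le> P \<xi>" by linarith
      then show ?thesis by (simp add: P_def zero_le_mult_iff)
    qed
    have "0 \<le> \<Delta> \<xi>" if "\<xi> \<in> {K..X}" for \<xi>
    proof (cases "\<xi> < X")
      case False
      then have \<xi>: "\<xi> = X" using that by simp
      show ?thesis unfolding \<xi>
      proof (rule ccontr)
        assume "\<not> 0 \<le> \<Delta> X"
        then have "\<Delta> X < 0" by simp
        moreover have "continuous (at X within {0..X}) \<Delta>"
          using cont\<Delta> KX assms(2) by (auto simp: continuous_on_eq_continuous_within)
        ultimately have "\<forall>\<^sub>F u in at X within {0..X}. \<Delta> u < 0"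
          unfolding continuous_within by (auto dest: order_tendstoD(2))
        then have "\<forall>\<^sub>F u in at_left X. \<Delta> u < 0"
          using at_within_Icc_at_left[of 0 X] KX assms(2) by simp
        moreover have "\<forall>\<^sub>F u in at_left X. u \<in> {K<..<X}"
          by (rule eventually_at_left_real[OF KX])
        ultimately have "\<forall>\<^sub>F u in at_left X. False"
        proof eventually_elim
          case (elim u)
          have "0 \<le> \<Delta> u" by (rule \<Delta>) (use elim in auto)
          with elim show ?case by simp
        qed
        then show False by (simp add: trivial_limit_at_left_real eventually_False)
      qed
    qed (use \<Delta> that in auto)
    then show "K < min X1 X2 \<and> (\<forall>\<xi>\<in>{K..min X1 X2}. 0 \<le> sgn c * (e1 \<xi> - e2 \<xi>))"
      using KX by (simp add: X_def \<Delta>_def)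
  qed
qed


lemma lead_coeff_pos_if_pderiv:
  fixes p :: "real poly"
  assumes "0 < lead_coeff (pderiv p)"
  shows "0 < lead_coeff p"
proof -
  have "degree p \<noteq> 0" using assms pderiv_eq_0_iff[of p] by auto
  then have "coeff (pderiv p) (degree (pderiv p)) = real (degree p) * lead_coeff p"
    by (simp add: degree_pderiv coeff_pderiv)
  with assms show ?thesis by (simp add: zero_less_mult_iff)
qed

text \<open>Two arcs, each with an upper branch \<open>u\<close> and a lower branch \<open>l\<close>, start at the same top point. If the
  restoring force of the first is eventually larger and \<open>c > 0\<close>, then the first ends at a strictly lower bottom
  point. Otherwise the first arc would turn earlier, at \<open>X1 < X2\<close>, with \<open>u2 \<le> u1 = l1 \<le> l2\<close> there, whereas the
  damping makes \<open>u2 > l2\<close>.\<close>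

lemma energy_branch_asymmetry:
  fixes G1 G2 :: "real poly" and c :: real
  assumes c: "0 < c" and G0: "poly G1 0 = 0" "poly G2 0 = 0"
    and lead: "0 < lead_coeff (G1 - G2)"
  obtains Y0 where "0 < Y0"
    "\<And>X1 X2 u1 l1 u2 l2. \<lbrakk>energy_branch G1 c X1 u1; energy_branch G1 (- c) X1 l1;
        energy_branch G2 c X2 u2; energy_branch G2 (- c) X2 l2;
        Y0 < sqrt (2 * u1 0); Y0 < sqrt (2 * l1 0); Y0 < sqrt (2 * l2 0);
        u1 0 = u2 0; l1 0 \<le> l2 0\<rbrakk> \<Longrightarrow> False"
proof -
  obtain Q where Q: "pderiv Q = [:0, 1:] * (G1 - G2)" "poly Q 0 = 0"
    using poly_primitive by blast
  have "0 < lead_coeff Q"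
  proof (rule lead_coeff_pos_if_pderiv)
    show "0 < lead_coeff (pderiv Q)" unfolding Q(1) lead_coeff_mult using lead by simp
  qed
  then obtain n1 where n1: "\<And>x. n1 \<le> x \<Longrightarrow> lead_coeff Q \<le> poly Q x"
    using poly_pinfty_gt_lc by blast
  obtain n2 where n2: "\<And>x. n2 \<le> x \<Longrightarrow> lead_coeff (G1 - G2) \<le> poly (G1 - G2) x"
    using poly_pinfty_gt_lc[OF lead] by blast
  define K where "K = max 1 (max n1 n2)"
  have K: "0 < K" by (simp add: K_def)
  have gap: "0 < poly (G1 - G2) \<xi>" if "K \<le> \<xi>" for \<xi>
  proof -
    have "n2 \<le> \<xi>" using that by (simp add: K_def)
    from n2[OF this] lead show ?thesis by linarith
  qed
  have QK: "0 < poly Q K"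
  proof -
    have "n1 \<le> K" by (simp add: K_def)
    from n1[OF this] \<open>0 < lead_coeff Q\<close> show ?thesis by linarith
  qed
  have c1: "c \<noteq> 0" and c2: "- c \<noteq> 0" using c by auto
  obtain Yu where Yu: "0 < Yu"
    "\<And>X1 X2 e1 e2. \<lbrakk>energy_branch G1 c X1 e1; energy_branch G2 c X2 e2;
        Yu < sqrt (2 * e1 0); Yu < sqrt (2 * e2 0); 0 \<le> sgn c * (e1 0 - e2 0)\<rbrakk> \<Longrightarrow>
        K < min X1 X2 \<and> (\<forall>\<xi>\<in>{K..min X1 X2}. 0 \<le> sgn c * (e1 \<xi> - e2 \<xi>))"
    using energy_branch_comparison[OF c1 K G0 less_imp_le[OF gap] Q QK] by blast
  obtain Yl where Yl: "0 < Yl"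
    "\<And>X1 X2 e1 e2. \<lbrakk>energy_branch G1 (- c) X1 e1; energy_branch G2 (- c) X2 e2;
        Yl < sqrt (2 * e1 0); Yl < sqrt (2 * e2 0); 0 \<le> sgn (- c) * (e1 0 - e2 0)\<rbrakk> \<Longrightarrow>
        K < min X1 X2 \<and> (\<forall>\<xi>\<in>{K..min X1 X2}. 0 \<le> sgn (- c) * (e1 \<xi> - e2 \<xi>))"
    using energy_branch_comparison[OF c2 K G0 less_imp_le[OF gap] Q QK] by blast
  show ?thesis
  proof (rule that[of "max Yu Yl"])
    show "0 < max Yu Yl" using Yu by simp
    fix X1 X2 u1 l1 u2 l2
    assume br: "energy_branch G1 c X1 u1" "energy_branch G1 (- c) X1 l1"
        "energy_branch G2 c X2 u2" "energy_branch G2 (- c) X2 l2"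
      and big: "max Yu Yl < sqrt (2 * u1 0)" "max Yu Yl < sqrt (2 * l1 0)" "max Yu Yl < sqrt (2 * l2 0)"
      and start: "u1 0 = u2 0" "l1 0 \<le> l2 0"
    have upper: "K < min X1 X2 \<and> (\<forall>\<xi>\<in>{K..min X1 X2}. 0 \<le> sgn c * (u1 \<xi> - u2 \<xi>))"
      by (rule Yu(2)[OF br(1) br(3)]) (use big start in auto)
    have lower: "K < min X1 X2 \<and> (\<forall>\<xi>\<in>{K..min X1 X2}. 0 \<le> sgn (- c) * (l1 \<xi> - l2 \<xi>))"
      by (rule Yl(2)[OF br(2) br(4)]) (use big start c in auto)
    have u: "u2 \<xi> \<le> u1 \<xi>" and l: "l1 \<xi> \<le> l2 \<xi>" if "K \<le> \<xi>" "\<xi> \<le> X1" "\<xi> \<le> X2" for \<xi>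
      using upper lower that c by (force simp: sgn_if)+
    have KX: "K < X1" "K < X2" using upper by auto
    have "X1 < X2"
    proof (rule ccontr)
      assume "\<not> X1 < X2"
      then have "X2 \<le> X1" by simp
      have "poly G1 X2 \<le> l1 X2"
        using br(2) \<open>X2 \<le> X1\<close> KX K by (cases "X2 = X1") (auto simp: energy_branch_def intro: less_imp_le)
      also have "\<dots> \<le> l2 X2" using l[of X2] KX \<open>X2 \<le> X1\<close> by simp
      also have "\<dots> = poly G2 X2" using br(4) by (simp add: energy_branch_def)
      finally show False using gap[of X2] KX by simp
    qed
    have cont: "continuous_on {X1..X2} u2" "continuous_on {X1..X2} l2"
      using br(3,4) KX K by (auto simp: energy_branch_def intro: continuous_on_subset)
    have "u2 X2 < u2 X1"
    proof (rule DERIV_neg_imp_decreasing_open[OF \<open>X1 < X2\<close>, where f = u2])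
      fix x assume x: "X1 < x" "x < X2"
      have "(u2 has_real_derivative - c * x * sqrt (2 * (u2 x - poly G2 x))) (at x)" "poly G2 x < u2 x"
        using br(3) x KX K by (auto simp: energy_branch_def)
      moreover from this have "0 < c * x * sqrt (2 * (u2 x - poly G2 x))"
        using c x KX K by (intro mult_pos_pos) auto
      ultimately show "\<exists>d. (u2 has_real_derivative d) (at x) \<and> d < 0" by fastforce
    qed (rule cont)
    moreover have "l2 X1 < l2 X2"
    proof (rule DERIV_pos_imp_increasing_open[OF \<open>X1 < X2\<close>, where f = l2])
      fix x assume x: "X1 < x" "x < X2"
      have "(l2 has_real_derivative - (- c) * x * sqrt (2 * (l2 x - poly G2 x))) (at x)" "poly G2 x < l2 x"
        using br(4) x KX K by (auto simp: energy_branch_def)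
      moreover from this have "0 < - (- c) * x * sqrt (2 * (l2 x - poly G2 x))"
        using c x KX K by (intro mult_pos_pos) auto
      ultimately show "\<exists>d. (l2 has_real_derivative d) (at x) \<and> 0 < d" by blast
    qed (rule cont)
    moreover have "u1 X1 = l1 X1" "u2 X2 = l2 X2" using br by (auto simp: energy_branch_def)
    ultimately show False
      using u[of X1] l[of X1] KX \<open>X1 < X2\<close> by simp
  qed
qed

section \<open>Half turns\<close>

text \<open>The return to the \<open>y\<close>-axis after leaving it with positive velocity.\<close>

lemma next_zero:
  fixes x :: "real \<Rightarrow> real"
  assumes dx: "\<And>t. (x has_real_derivative y t) (at t)" and "x a = 0" "0 < y a" "a < b" "x b \<le> 0"
  obtains s where "a < s" "s \<le> b" "x s = 0" "\<And>t. a < t \<Longrightarrow> t < s \<Longrightarrow> 0 < x t"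
proof -
  obtain d where d: "0 < d" "\<And>u. 0 < u \<Longrightarrow> u < d \<Longrightarrow> 0 < x (a + u)"
    using DERIV_pos_inc_right[OF dx[of a] assms(3)] assms(2) by auto
  define m where "m = a + min d (b - a) / 2"
  have m: "a < m" "m < b" "m < a + d" using d assms(4) by (auto simp: m_def min_def field_simps)
  have "0 < x m" using d(2)[of "m - a"] m by simp
  have "continuous_on {m..b} x"
    using dx by (meson DERIV_isCont continuous_at_imp_continuous_on)
  from first_hit[OF this \<open>0 < x m\<close> assms(5) less_imp_le[OF m(2)]]
  obtain s where s: "m < s" "s \<le> b" "x s = 0" "\<And>t. m \<le> t \<Longrightarrow> t < s \<Longrightarrow> 0 < x t" by blast
  show ?thesis
  proof (rule that[of s])
    show "0 < x t" if "a < t" "t < s" for t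
      using d(2)[of "t - a"] s(4)[of t] that m by (cases "t < m") auto
  qed (use s m in auto)
qed

lemma lienard_solution_reverse:
  assumes "lienard_solution h c x y (uminus ` S)"
  shows "lienard_solution h (- c) (\<lambda>t. x (- t)) (\<lambda>t. - y (- t)) S"
  unfolding lienard_solution_def
proof (intro ballI conjI)
  fix t assume "t \<in> S"
  then have d: "(x has_real_derivative y (- t)) (at (- t))"
    "(y has_real_derivative - poly h (x (- t)) - c * x (- t) * y (- t)) (at (- t))"
    using assms by (auto simp: lienard_solution_def)
  have m: "(uminus has_real_derivative - 1) (at t)" by (auto intro!: derivative_eq_intros)
  show "((\<lambda>t. x (- t)) has_real_derivative - y (- t)) (at t)"
    using DERIV_chain2[OF d(1) m] by simp
  show "((\<lambda>t. - y (- t)) has_real_derivative - poly h (x (- t)) - - c * x (- t) * - y (- t)) (at t)"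
    by (rule DERIV_cong[OF DERIV_minus[OF DERIV_chain2[OF d(2) m]]]) simp
qed

text \<open>The central symmetry \<open>(x, y) \<mapsto> (- x, - y)\<close> turns arcs in the left half plane into arcs in the right one.\<close>

lemma lienard_solution_rotate:
  assumes "lienard_solution h c x y S"
  shows "lienard_solution (- pcompose h [:0, -1:]) (- c) (\<lambda>t. - x t) (\<lambda>t. - y t) S"
  unfolding lienard_solution_def
proof (intro ballI conjI)
  fix t assume "t \<in> S"
  then have d: "(x has_real_derivative y t) (at t)"
    "(y has_real_derivative - poly h (x t) - c * x t * y t) (at t)"
    using assms by (auto simp: lienard_solution_def)
  show "((\<lambda>t. - x t) has_real_derivative - y t) (at t)" by (rule DERIV_minus[OF d(1)])
  show "((\<lambda>t. - y t) has_real_derivative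
      - poly (- pcompose h [:0, -1:]) (- x t) - - c * - x t * - y t) (at t)"
    by (rule DERIV_cong[OF DERIV_minus[OF d(2)]]) (simp add: poly_pcompose)
qed

text \<open>An arc in \<open>x \<ge> 0\<close> that starts high enough on the \<open>y\<close>-axis ends at least \<open>L\<close> below the origin and consists of an
  upper and a lower energy branch with a common turning point.\<close>

lemma half_turn:
  fixes h G :: "real poly" and c \<delta> B L :: real
  assumes "0 < \<delta>" "0 \<le> B" and lower: "\<And>x. 0 \<le> x \<Longrightarrow> (c\<^sup>2 / 8 + \<delta>) * x ^ 3 - B \<le> poly h x"
    and G: "pderiv G = h" "poly G 0 = 0" and "0 \<le> L"
  obtains W where "0 < W"
    "\<forall>a b x y. a < b \<longrightarrow> lienard_solution h c x y {a..b} \<longrightarrow> (\<forall>t\<in>{a..b}. 0 \<le> x t) \<longrightarrow>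
        x a = 0 \<longrightarrow> x b = 0 \<longrightarrow> W \<le> y a \<longrightarrow>
        y b \<le> - L \<and> (\<exists>X u l. energy_branch G c X u \<and> energy_branch G (- c) X l \<and>
          u 0 = (y a)\<^sup>2 / 2 \<and> l 0 = (y b)\<^sup>2 / 2)"
proof -
  obtain K R0 \<Lambda> \<tau> where rc: "rotation_constants h G c K R0 \<Lambda> \<tau>"
    by (rule half_plane_rotation[OF assms(1,2) lower G])
  then have R0: "0 < R0" "1 \<le> \<Lambda>" "0 < \<tau>" and GK: "\<And>x. 0 \<le> x \<Longrightarrow> x \<le> poly G x + K"
    unfolding rotation_constants_def by blast+
  have K0: "0 \<le> K" using GK[of 0] G by simp
  define N where "N = R0 + \<Lambda> * (L\<^sup>2 / 2 + K)"
  have N: "0 < N" using R0 K0 by (simp add: N_def add_pos_nonneg)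
  define W where "W = sqrt (2 * N) + 1"
  have W: "0 < W" using N by (simp add: W_def add_nonneg_pos)
  have "(sqrt (2 * N))\<^sup>2 < W\<^sup>2" unfolding W_def using N by (intro power_strict_mono) auto
  then have W2: "N < W\<^sup>2 / 2" using N by simp
  show ?thesis
  proof (rule that[OF W], intro allI impI)
    fix a b x y
    assume ab: "a < b" and sol: "lienard_solution h c x y {a..b}"
      and nn': "\<forall>t\<in>{a..b}. 0 \<le> x t" and ends: "x a = 0" "x b = 0" and ya: "W \<le> y a"
    have "W\<^sup>2 \<le> (y a)\<^sup>2" using ya W by (intro power_mono) auto
    then have Ny: "N < (y a)\<^sup>2 / 2" using W2 by linarith
    have "0 \<le> \<Lambda> * (L\<^sup>2 / 2 + K)" using R0 K0 by simp
    then have start: "R0 < (y a)\<^sup>2 / 2 + poly G (x a) + K"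
      using Ny K0 ends G by (simp add: N_def)
    have sgn0: "\<forall>s\<in>{a..b}. \<forall>t\<in>{a..b}. s < t \<longrightarrow> y s \<le> 0 \<longrightarrow> y t < 0"
      and rot: "\<forall>t\<in>{a..b}. (y a)\<^sup>2 / 2 + poly G (x a) + K \<le> \<Lambda> * ((y t)\<^sup>2 / 2 + poly G (x t) + K)"
      using rc less_imp_le[OF ab] sol nn' start unfolding rotation_constants_def by blast+
    have sgn: "y t < 0" if "s \<in> {a..b}" "t \<in> {a..b}" "s < t" "y s \<le> 0" for s t
      using sgn0 that by blast
    have dx: "(x has_real_derivative y t) (at t)" if "t \<in> {a..b}" for t
      using sol that by (auto simp: lienard_solution_def)
    have cx: "continuous_on {a..b} x" and cy: "continuous_on {a..b} y"
      using lienard_solution_continuous[OF sol] .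
    have yb: "y b < 0"
    proof (rule ccontr)
      assume "\<not> y b < 0"
      then have pos: "0 < y s" if "s \<in> {a..<b}" for s
        using sgn[of s b] that ab by force
      have "x a < x b"
      proof (rule DERIV_pos_imp_increasing_open[OF ab, where f = x])
        show "\<exists>d. (x has_real_derivative d) (at s) \<and> 0 < d" if "a < s" "s < b" for s
          using dx[of s] pos[of s] that by auto
      qed (rule cx)
      with ends show False by simp
    qed
    have ya0: "0 < y a" using ya W by linarith
    obtain m where m: "a < m" "m \<le> b" "y m = 0" "\<And>t. a \<le> t \<Longrightarrow> t < m \<Longrightarrow> 0 < y t"
      using first_hit[OF cy ya0 less_imp_le[OF yb] less_imp_le[OF ab]] by blast
    have "m < b" using m yb by (cases "m = b") auto
    have neg: "y t < 0" if "m < t" "t \<le> b" for t using sgn[of m t] that m by simp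
    have solu: "lienard_solution h c x y {a..m}" by (rule lienard_solution_subset[OF sol]) (use m in auto)
    obtain u where u: "energy_branch G c (x m) u" "u 0 = (y a)\<^sup>2 / 2"
      using energy_branch_of_solution[OF m(1) solu G ends(1) m(3) m(4)] by blast
    have "lienard_solution h c x y (uminus ` {- b..- m})"
      by (rule lienard_solution_subset[OF sol]) (use m in auto)
    from lienard_solution_reverse[OF this]
    have soll: "lienard_solution h (- c) (\<lambda>t. x (- t)) (\<lambda>t. - y (- t)) {- b..- m}" .
    obtain l where l: "energy_branch G (- c) (x (- (- m))) l" "l 0 = (- y (- (- b)))\<^sup>2 / 2"
    proof (rule energy_branch_of_solution[OF _ soll G])
      show "0 < - y (- t)" if "- b \<le> t" "t < - m" for t
        using neg[of "- t"] that by simp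
    qed (use \<open>m < b\<close> ends m(3) in auto)
    have "N < \<Lambda> * ((y b)\<^sup>2 / 2 + K)"
    proof -
      have "(y a)\<^sup>2 / 2 + poly G (x a) + K \<le> \<Lambda> * ((y b)\<^sup>2 / 2 + poly G (x b) + K)"
        using rot ab by simp
      then show ?thesis using Ny ends G K0 by simp
    qed
    then have "\<Lambda> * (L\<^sup>2 / 2 + K) < \<Lambda> * ((y b)\<^sup>2 / 2 + K)"
      using R0(1) unfolding N_def by linarith
    then have "L\<^sup>2 / 2 + K < (y b)\<^sup>2 / 2 + K" by (rule mult_left_less_imp_less) (use R0 in simp)
    then have "L\<^sup>2 < (- y b)\<^sup>2" by simp
    then have "L < - y b" by (rule power2_less_imp_less) (use yb in simp)
    moreover have "energy_branch G (- c) (x m) l" "l 0 = (y b)\<^sup>2 / 2" using l by simp_all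
    ultimately show "y b \<le> - L \<and> (\<exists>X u l. energy_branch G c X u \<and> energy_branch G (- c) X l \<and>
          u 0 = (y a)\<^sup>2 / 2 \<and> l 0 = (y b)\<^sup>2 / 2)"
      using u by (intro conjI exI[of _ "x m"] exI[of _ u] exI[of _ l]) simp_all
  qed
qed

section \<open>Obstructions to closed orbits near infinity\<close>

text \<open>Every point outside some disc lies on a closed orbit.\<close>

definition outer_closed :: "(plane \<Rightarrow> plane) \<Rightarrow> bool" where
  "outer_closed V \<longleftrightarrow> (\<exists>R. \<forall>p. R < norm p \<longrightarrow> (\<exists>C. closed_orbit V C \<and> p \<in> C))"

lemma closed_orbit_coordinates:
  assumes "closed_orbit (lienard_field h [:0, c:]) C" "p \<in> C"
  obtains x y T t0 where "0 < T" "lienard_solution h c x y UNIV"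
    "\<And>t. x (t + T) = x t" "\<And>t. y (t + T) = y t" "p = (x t0, y t0)"
proof -
  obtain \<phi> T where T: "0 < T" and d: "\<And>t. (\<phi> has_vector_derivative lienard_field h [:0, c:] (\<phi> t)) (at t)"
    and per: "\<And>t. \<phi> (t + T) = \<phi> t" and C: "C = range \<phi>"
    using assms(1) unfolding closed_orbit_def by blast
  obtain t0 where t0: "p = \<phi> t0" using assms(2) C by blast
  define x where "x = (\<lambda>t. fst (\<phi> t))"
  define y where "y = (\<lambda>t. snd (\<phi> t))"
  have "lienard_solution h c x y UNIV" unfolding lienard_solution_def
  proof (intro ballI conjI)
    fix t
    have f: "lienard_field h [:0, c:] (\<phi> t) = (y t, - poly h (x t) - c * x t * y t)"
      by (simp add: lienard_field_def x_def y_def case_prod_unfold mult_ac)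
    show "(x has_real_derivative y t) (at t)"
      using bounded_linear.has_vector_derivative[OF bounded_linear_fst d[of t]]
      by (simp add: f x_def has_real_derivative_iff_has_vector_derivative)
    show "(y has_real_derivative - poly h (x t) - c * x t * y t) (at t)"
      using bounded_linear.has_vector_derivative[OF bounded_linear_snd d[of t]]
      by (simp add: f y_def has_real_derivative_iff_has_vector_derivative)
  qed
  then show ?thesis
    by (rule that[OF T]) (simp_all add: x_def y_def per t0)
qed

lemma periodic_to_fundamental:
  fixes x :: "real \<Rightarrow> 'a"
  assumes "0 < T" "\<And>t. x (t + T) = x t"
  obtains k :: int where "t + of_int k * T \<in> {t0..t0 + T}"
    "\<And>t. x (t + of_int k * T) = x t"
proof -
  have nat: "x (t + of_nat n * T) = x t" for n t
    by (induction n) (use assms(2)[of "t + of_nat n * T" for n] in \<open>auto simp: algebra_simps\<close>)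
  have int: "x (t + of_int k * T) = x t" for k t
  proof (cases "0 \<le> k")
    case True
    then show ?thesis using nat[of t "nat k"] by simp
  next
    case False
    then show ?thesis using nat[of "t + of_int k * T" "nat (- k)"] by simp
  qed
  define k where "k = - \<lfloor>(t - t0) / T\<rfloor>"
  have q: "(t - t0) / T * T = t - t0" using assms(1) by simp
  have "of_int \<lfloor>(t - t0) / T\<rfloor> * T \<le> (t - t0) / T * T"
    using assms(1) by (intro mult_right_mono) auto
  moreover have "(t - t0) / T * T \<le> (of_int \<lfloor>(t - t0) / T\<rfloor> + 1) * T"
    using assms(1) by (intro mult_right_mono) auto
  ultimately have "t + of_int k * T \<in> {t0..t0 + T}"
    unfolding q by (simp add: k_def algebra_simps)
  then show ?thesis using that int by blast
qed

text \<open>The restoring force is eventually stronger on the right than on the left. The orbit through a low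
  point of the \<open>y\<close>-axis is followed from its lowest crossing of the axis through the left half plane up to the axis
  and then through the right half plane down again; the second arc would end below the lowest crossing.\<close>

lemma not_outer_closed_if_asymmetric:
  fixes h h' :: "real poly" and c :: real
  assumes c: "0 < c" and h': "h' = - pcompose h [:0, -1:]"
    and lower: "0 < \<delta>" "0 \<le> B" "\<And>x. 0 \<le> x \<Longrightarrow> (c\<^sup>2 / 8 + \<delta>) * x ^ 3 - B \<le> poly h x"
    and lower': "0 < \<delta>'" "0 \<le> B'" "\<And>x. 0 \<le> x \<Longrightarrow> (c\<^sup>2 / 8 + \<delta>') * x ^ 3 - B' \<le> poly h' x"
    and lead: "0 < lead_coeff (h - h')"
  shows "\<not> outer_closed (lienard_field h [:0, c:])"
proof
  assume "outer_closed (lienard_field h [:0, c:])"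
  then obtain R where R: "\<And>p. R < norm p \<Longrightarrow> \<exists>C. closed_orbit (lienard_field h [:0, c:]) C \<and> p \<in> C"
    unfolding outer_closed_def by blast
  obtain G1 where G1: "pderiv G1 = h" "poly G1 0 = 0" using poly_primitive by blast
  obtain G2 where G2: "pderiv G2 = h'" "poly G2 0 = 0" using poly_primitive by blast
  have leadG: "0 < lead_coeff (G1 - G2)"
    by (rule lead_coeff_pos_if_pderiv) (use lead in \<open>simp add: pderiv_diff G1 G2\<close>)
  obtain Y0 where Y0: "0 < Y0"
    and asym: "\<And>X1 X2 u1 l1 u2 l2. \<lbrakk>energy_branch G1 c X1 u1; energy_branch G1 (- c) X1 l1;
        energy_branch G2 c X2 u2; energy_branch G2 (- c) X2 l2;
        Y0 < sqrt (2 * u1 0); Y0 < sqrt (2 * l1 0); Y0 < sqrt (2 * l2 0);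
        u1 0 = u2 0; l1 0 \<le> l2 0\<rbrakk> \<Longrightarrow> False"
    by (rule energy_branch_asymmetry[OF c G1(2) G2(2) leadG]) blast
  have L1: "0 \<le> Y0 + 1" using Y0 by simp
  obtain W1 where W1: "0 < W1"
    and right: "\<forall>a b x y. a < b \<longrightarrow> lienard_solution h c x y {a..b} \<longrightarrow> (\<forall>t\<in>{a..b}. 0 \<le> x t) \<longrightarrow>
        x a = 0 \<longrightarrow> x b = 0 \<longrightarrow> W1 \<le> y a \<longrightarrow>
        y b \<le> - (Y0 + 1) \<and> (\<exists>X u l. energy_branch G1 c X u \<and> energy_branch G1 (- c) X l \<and>
          u 0 = (y a)\<^sup>2 / 2 \<and> l 0 = (y b)\<^sup>2 / 2)"
    by (rule half_turn[OF lower G1 L1]) blast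
  define L where "L = max W1 (Y0 + 1)"
  have L: "0 \<le> L" using W1 by (simp add: L_def)
  have lower'': "\<And>x. 0 \<le> x \<Longrightarrow> ((- c)\<^sup>2 / 8 + \<delta>') * x ^ 3 - B' \<le> poly h' x" using lower'(3) by simp
  obtain W2 where W2: "0 < W2"
    and left: "\<forall>a b x y. a < b \<longrightarrow> lienard_solution h' (- c) x y {a..b} \<longrightarrow> (\<forall>t\<in>{a..b}. 0 \<le> x t) \<longrightarrow>
        x a = 0 \<longrightarrow> x b = 0 \<longrightarrow> W2 \<le> y a \<longrightarrow>
        y b \<le> - L \<and> (\<exists>X u l. energy_branch G2 (- c) X u \<and> energy_branch G2 (- (- c)) X l \<and>
          u 0 = (y a)\<^sup>2 / 2 \<and> l 0 = (y b)\<^sup>2 / 2)"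
    by (rule half_turn[OF lower'(1,2) lower'' G2 L]) blast
  define W where "W = max W2 (max (Y0 + 1) (\<bar>R\<bar> + 1))"
  have "R < norm (0 :: real, - W)" by (auto simp: norm_Pair W_def)
  then obtain C where C: "closed_orbit (lienard_field h [:0, c:]) C" "(0, - W) \<in> C" using R by blast
  obtain x y T t0 where T: "0 < T" and sol: "lienard_solution h c x y UNIV"
    and per: "\<And>t. x (t + T) = x t" "\<And>t. y (t + T) = y t" and t0: "(0, - W) = (x t0, y t0)"
    by (rule closed_orbit_coordinates[OF C]) blast
  have dx: "(x has_real_derivative y t) (at t)" for t using sol by (auto simp: lienard_solution_def)
  have cx: "continuous_on UNIV x" and cy: "continuous_on UNIV y"
    using lienard_solution_continuous[OF sol] .
  \<comment> \<open>The lowest crossing of the \<open>y\<close>-axis is at the time \<open>s\<close>.\<close>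
  define Z where "Z = {t \<in> {t0..t0 + T}. x t = 0}"
  have "closed Z" unfolding Z_def
    by (intro continuous_closed_preimage_constant continuous_on_subset[OF cx]) auto
  moreover have "bounded Z" unfolding Z_def by (rule bounded_subset[OF bounded_closed_interval[of t0 "t0 + T"]]) auto
  ultimately have "compact Z" by (simp add: compact_eq_bounded_closed)
  moreover have "t0 \<in> Z" using t0 T by (simp add: Z_def)
  moreover have "continuous_on Z y" by (rule continuous_on_subset[OF cy]) auto
  ultimately obtain s where s: "s \<in> Z" and smin: "\<And>t. t \<in> Z \<Longrightarrow> y s \<le> y t"
    using continuous_attains_inf[of Z y] by blast
  have low: "y s \<le> y t" if "x t = 0" for t
  proof -
    obtain k :: int where k: "t + of_int k * T \<in> {t0..t0 + T}"
      "\<And>t. (\<lambda>t. (x t, y t)) (t + of_int k * T) = (\<lambda>t. (x t, y t)) t"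
      by (rule periodic_to_fundamental[OF T, of "\<lambda>t. (x t, y t)" t t0]) (use per in auto)
    then have "t + of_int k * T \<in> Z" using that by (simp add: Z_def)
    from smin[OF this] show ?thesis using k(2)[of t] by simp
  qed
  have xs: "x s = 0" using s by (simp add: Z_def)
  have ys: "y s \<le> - W" using smin[OF \<open>t0 \<in> Z\<close>] t0 by simp
  have "0 < - y s" using ys Y0 by (simp add: W_def)
  have dmx: "((\<lambda>t. - x t) has_real_derivative - y t) (at t)" for t by (rule DERIV_minus[OF dx])
  obtain t1 where t1: "s < t1" "- x t1 = 0" "\<And>t. s < t \<Longrightarrow> t < t1 \<Longrightarrow> 0 < - x t"
  proof (rule next_zero[of "\<lambda>t. - x t" "\<lambda>t. - y t" s "s + T"])
    show "((\<lambda>t. - x t) has_real_derivative - y t) (at t)" for t by (rule dmx)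
  qed (use xs \<open>0 < - y s\<close> T per(1)[of s] in auto)
  have "- y t1 \<le> - L \<and> (\<exists>X u l. energy_branch G2 (- c) X u \<and> energy_branch G2 (- (- c)) X l \<and>
          u 0 = (- y s)\<^sup>2 / 2 \<and> l 0 = (- y t1)\<^sup>2 / 2)"
  proof (rule left[rule_format, OF t1(1), of "\<lambda>t. - x t" "\<lambda>t. - y t"])
    show "lienard_solution h' (- c) (\<lambda>t. - x t) (\<lambda>t. - y t) {s..t1}"
      unfolding h' by (rule lienard_solution_rotate[OF lienard_solution_subset[OF sol]]) auto
    show "0 \<le> - x t" if "t \<in> {s..t1}" for t
      using t1(2) t1(3)[of t] xs that by (cases "t = s \<or> t = t1") auto
  qed (use xs t1(2) ys in \<open>auto simp: W_def\<close>)
  then obtain X2 u2 l2 where yt1: "L \<le> y t1" and br2: "energy_branch G2 c X2 u2" "energy_branch G2 (- c) X2 l2"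
    "u2 0 = (y t1)\<^sup>2 / 2" "l2 0 = (y s)\<^sup>2 / 2" by auto
  have "0 < y t1" using yt1 W1 by (simp add: L_def)
  obtain t2 where t2: "t1 < t2" "x t2 = 0" "\<And>t. t1 < t \<Longrightarrow> t < t2 \<Longrightarrow> 0 < x t"
    by (rule next_zero[of x y t1 "t1 + T"]) (use dx t1(2) \<open>0 < y t1\<close> T per(1)[of t1] in auto)
  have "y t2 \<le> - (Y0 + 1) \<and> (\<exists>X u l. energy_branch G1 c X u \<and> energy_branch G1 (- c) X l \<and>
          u 0 = (y t1)\<^sup>2 / 2 \<and> l 0 = (y t2)\<^sup>2 / 2)"
  proof (rule right[rule_format, OF t2(1), of x y])
    show "lienard_solution h c x y {t1..t2}" by (rule lienard_solution_subset[OF sol]) auto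
    show "0 \<le> x t" if "t \<in> {t1..t2}" for t
      using t2(2) t2(3)[of t] t1(2) that by (cases "t = t1 \<or> t = t2") auto
  qed (use t1(2) t2(2) yt1 in \<open>auto simp: L_def\<close>)
  then obtain X1 u1 l1 where yt2: "y t2 \<le> - (Y0 + 1)" and br1: "energy_branch G1 c X1 u1" "energy_branch G1 (- c) X1 l1"
    "u1 0 = (y t1)\<^sup>2 / 2" "l1 0 = (y t2)\<^sup>2 / 2" by auto
  have root: "sqrt (2 * (v\<^sup>2 / 2)) = \<bar>v\<bar>" for v :: real by simp
  have "l1 0 \<le> l2 0"
  proof -
    have "(- y t2)\<^sup>2 \<le> (- y s)\<^sup>2" using low[OF t2(2)] yt2 Y0 by (intro power_mono) auto
    then show ?thesis by (simp add: br1 br2)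
  qed
  show False
  proof (rule asym[OF br1(1,2) br2(1,2)])
    show "Y0 < sqrt (2 * u1 0)" "Y0 < sqrt (2 * l1 0)" "Y0 < sqrt (2 * l2 0)"
      unfolding br1 br2 root using yt1 yt2 ys Y0 by (auto simp: L_def W_def)
  qed (use br1 br2 \<open>l1 0 \<le> l2 0\<close> in auto)
qed

text \<open>For \<open>c < 0\<close> the damping acts as an accelerating force in the right half plane. With \<open>d = - c / 2\<close>, the region above the
  parabola \<open>y = d x\<^sup>2 / 2 + \<mu>\<close> is forward invariant for large \<open>x\<close>, and \<open>x\<close> increases there.\<close>

lemma not_outer_closed_if_escape:
  fixes h :: "real poly" and c :: real
  assumes c: "c < 0" and upper: "\<And>x. X0 \<le> x \<Longrightarrow> poly h x \<le> x * (c\<^sup>2 / 8 * x\<^sup>2 + A)"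
  shows "\<not> outer_closed (lienard_field h [:0, c:])"
proof
  assume "outer_closed (lienard_field h [:0, c:])"
  then obtain R where R: "\<And>p. R < norm p \<Longrightarrow> \<exists>C. closed_orbit (lienard_field h [:0, c:]) C \<and> p \<in> C"
    unfolding outer_closed_def by blast
  define d where "d = - c / 2"
  have d: "0 < d" using c by (simp add: d_def)
  define \<mu> where "\<mu> = \<bar>A\<bar> / d + 1"
  have \<mu>: "0 < \<mu>" "A \<le> d * \<mu>" using d by (auto simp: \<mu>_def add_nonneg_pos distrib_left)
  define x0 where "x0 = max X0 (\<bar>R\<bar> + 1)"
  have x0: "X0 \<le> x0" "0 < x0" "R < x0" by (auto simp: x0_def)
  define y0 where "y0 = d * x0\<^sup>2 / 2 + \<mu> + 1"
  have "\<bar>x0\<bar> \<le> norm (x0, y0)" using norm_fst_le[of x0 y0] by simp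
  then have "R < norm (x0, y0)" using x0 by linarith
  then obtain C where C: "closed_orbit (lienard_field h [:0, c:]) C" "(x0, y0) \<in> C" using R by blast
  obtain x y T t0 where T: "0 < T" and sol: "lienard_solution h c x y UNIV"
    and per: "\<And>t. x (t + T) = x t" "\<And>t. y (t + T) = y t" and t0: "(x0, y0) = (x t0, y t0)"
    by (rule closed_orbit_coordinates[OF C]) blast
  have dx: "(x has_real_derivative y t) (at t)"
    and dy: "(y has_real_derivative - poly h (x t) - c * x t * y t) (at t)" for t
    using sol by (auto simp: lienard_solution_def)
  define D where "D = (\<lambda>t. y t - d * (x t)\<^sup>2 / 2 - \<mu>)"
  have dD: "(D has_real_derivative - poly h (x t) + d * x t * y t) (at t)" for t
  proof -
    have "((\<lambda>t. d * (x t)\<^sup>2 / 2) has_real_derivative d * x t * y t) (at t)"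
      by (auto intro!: derivative_eq_intros dx)
    from DERIV_diff[OF DERIV_diff[OF dy this] DERIV_const[of \<mu>]]
    show ?thesis unfolding D_def
      by (rule DERIV_cong) (simp add: d_def field_simps)
  qed
  have D0: "D t0 = 1" using t0 by (auto simp: D_def y0_def)
  have cD: "continuous_on S D" for S
    using dD by (meson DERIV_isCont continuous_at_imp_continuous_on)
  have yD: "\<mu> < y t" if "0 < D t" for t
  proof -
    have "0 \<le> d * (x t)\<^sup>2 / 2" using d by simp
    with that show ?thesis by (simp add: D_def)
  qed
  have Dpos: "0 < D t" if "t0 \<le> t" for t
  proof (rule ccontr)
    assume "\<not> 0 < D t"
    then have le: "D t \<le> 0" by simp
    have "0 < D t0" using D0 by simp
    from first_hit[OF cD this le that]
    obtain s where s: "t0 < s" "D s = 0" "\<And>u. t0 \<le> u \<Longrightarrow> u < s \<Longrightarrow> 0 < D u" by blast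
    have xge: "x0 \<le> x u" if "t0 \<le> u" "u \<le> s" for u
    proof -
      have "x t0 \<le> x u"
      proof (rule deriv_nonneg_mono[OF that(1)])
        show "(x has_real_derivative y v) (at v within {t0..u})" for v
          by (rule has_field_derivative_at_within[OF dx])
        show "0 \<le> y v" if "v \<in> {t0<..<u}" for v
          using yD[OF s(3)[of v]] \<mu> that \<open>u \<le> s\<close> by auto
      qed
      then show ?thesis using t0 by simp
    qed
    have "D t0 \<le> D s"
    proof (rule deriv_nonneg_mono[OF less_imp_le[OF s(1)]])
      show "(D has_real_derivative - poly h (x v) + d * x v * y v) (at v within {t0..s})" for v
        by (rule has_field_derivative_at_within[OF dD])
      fix v assume v: "v \<in> {t0<..<s}"
      have xv: "x0 \<le> x v" using xge v by auto
      have "poly h (x v) \<le> x v * (c\<^sup>2 / 8 * (x v)\<^sup>2 + A)" by (rule upper) (use xv x0 in simp)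
      also have "\<dots> \<le> x v * (d * y v)"
      proof (rule mult_left_mono)
        have "d * (d * (x v)\<^sup>2 / 2 + \<mu>) \<le> d * y v"
          using s(3)[of v] v d by (intro mult_left_mono) (auto simp: D_def)
        moreover have "d * (d * (x v)\<^sup>2 / 2 + \<mu>) = c\<^sup>2 / 8 * (x v)\<^sup>2 + d * \<mu>"
          by (simp add: d_def power2_eq_square field_simps)
        ultimately show "c\<^sup>2 / 8 * (x v)\<^sup>2 + A \<le> d * y v" using \<mu> by linarith
      qed (use xv x0 in simp)
      finally show "0 \<le> - poly h (x v) + d * x v * y v" by (simp add: algebra_simps)
    qed
    with D0 s(2) show False by simp
  qed
  have "x t0 < x (t0 + T)"
  proof (rule DERIV_pos_imp_increasing_open[where f = x])
    show "\<exists>d. (x has_real_derivative d) (at u) \<and> 0 < d" if "t0 < u" for u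
      using dx[of u] yD[OF Dpos[of u]] \<mu> that by force
    show "continuous_on {t0..t0 + T} x"
      using dx by (meson DERIV_isCont continuous_at_imp_continuous_on)
  qed (use T in simp)
  with per(1)[of t0] show False by simp
qed

section \<open>The Poincare disc\<close>

lemma poincare_projection_eq:
  "poincare_projection p = p /\<^sub>R sqrt (1 + (norm p)\<^sup>2)"
proof (cases p)
  case (Pair x y)
  have "norm (x, y, 1 :: real) = sqrt (1 + (norm (x, y))\<^sup>2)"
    by (simp add: norm_Pair)
  then show ?thesis
    by (simp add: Pair poincare_projection_def central_projection_def vertical_projection_def)
qed

text \<open>The inverse of the Poincare projection on the open disc; its value on the circle is irrelevant.\<close>

definition inverse_projection :: "plane \<Rightarrow> plane" where
  "inverse_projection q = q /\<^sub>R sqrt (1 - (norm q)\<^sup>2)"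

lemma one_plus_square_pos: "0 < 1 + (u :: real)\<^sup>2"
  by (rule add_pos_nonneg) auto

lemma norm_poincare_projection: "(norm (poincare_projection p))\<^sup>2 = (norm p)\<^sup>2 / (1 + (norm p)\<^sup>2)"
  using one_plus_square_pos[of "norm p"]
  by (simp add: poincare_projection_eq power_mult_distrib divide_inverse power_inverse)

lemma norm_poincare_projection_less: "norm (poincare_projection p) < 1"
proof -
  have "(norm (poincare_projection p))\<^sup>2 < 1\<^sup>2"
    using one_plus_square_pos[of "norm p"] by (simp add: norm_poincare_projection pos_divide_less_eq)
  then show ?thesis by (rule power2_less_imp_less) simp
qed

lemma inverse_projection_left: "inverse_projection (poincare_projection p) = p"
proof -
  have "1 - (norm (poincare_projection p))\<^sup>2 = inverse (1 + (norm p)\<^sup>2)"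
    using one_plus_square_pos[of "norm p"] by (simp add: norm_poincare_projection field_simps)
  then have "sqrt (1 - (norm (poincare_projection p))\<^sup>2) = inverse (sqrt (1 + (norm p)\<^sup>2))"
    by (simp add: real_sqrt_inverse)
  then show ?thesis
    using one_plus_square_pos[of "norm p"]
    by (simp add: inverse_projection_def poincare_projection_eq[of p])
qed

lemma inverse_projection_right:
  assumes "norm q < 1"
  shows "poincare_projection (inverse_projection q) = q"
proof -
  have "(norm q)\<^sup>2 < 1\<^sup>2" using assms by (intro power_strict_mono) auto
  then have p: "0 < 1 - (norm q)\<^sup>2" by simp
  then have "1 + (norm (inverse_projection q))\<^sup>2 = inverse (1 - (norm q)\<^sup>2)"
    by (simp add: inverse_projection_def power_mult_distrib power_inverse field_simps)
  then have "sqrt (1 + (norm (inverse_projection q))\<^sup>2) = inverse (sqrt (1 - (norm q)\<^sup>2))"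
    by (simp add: real_sqrt_inverse)
  then show ?thesis using p
    by (simp add: poincare_projection_eq) (simp add: inverse_projection_def)
qed

lemma norm_inverse_projection:
  assumes "norm q < 1" "0 \<le> R" "R * sqrt (1 - (norm q)\<^sup>2) < norm q"
  shows "R < norm (inverse_projection q)"
proof -
  have "(norm q)\<^sup>2 < 1\<^sup>2" using assms by (intro power_strict_mono) auto
  then have "0 < sqrt (1 - (norm q)\<^sup>2)" by simp
  with assms(3) show ?thesis
    by (simp add: inverse_projection_def pos_less_divide_eq divide_inverse[symmetric] mult.commute[of "inverse _"])
qed

lemma center_at_infinity_iff: "center_at_infinity V \<longleftrightarrow> outer_closed V"
proof
  assume "center_at_infinity V"
  then obtain U W \<C> where W: "openin (top_of_set poincare_disc) W" "infinity_circle \<subseteq> W" "W \<subseteq> U"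
    and \<C>: "\<forall>C \<in> \<C>. closed_orbit V C" "U - infinity_circle = (\<Union>C \<in> \<C>. poincare_projection ` C)"
    unfolding center_at_infinity_def by (elim exE conjE) (rule that)
  obtain S where S: "open S" "W = poincare_disc \<inter> S" using W(1) by (auto simp: openin_open)
  have comp: "compact (poincare_disc - S)"
    unfolding poincare_disc_def using S(1) by (intro compact_diff compact_cball)
  obtain r where r: "r < 1" "\<And>q. q \<in> poincare_disc - S \<Longrightarrow> norm q \<le> r"
  proof (cases "poincare_disc - S = {}")
    case True
    then show ?thesis using that[of 0] by auto
  next
    case False
    then obtain q0 where q0: "q0 \<in> poincare_disc - S" "\<And>q. q \<in> poincare_disc - S \<Longrightarrow> norm q \<le> norm q0"
      using continuous_attains_sup[OF comp False continuous_on_norm_id] by blast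
    have "norm q0 \<noteq> 1"
      using q0(1) W(2) unfolding S(2) infinity_circle_def by auto
    moreover have "norm q0 \<le> 1" using q0(1) by (simp add: poincare_disc_def)
    ultimately show ?thesis using that[of "norm q0"] q0(2) by simp
  qed
  show "outer_closed V" unfolding outer_closed_def
  proof (intro exI[of _ "1 / (1 - r)"] allI impI)
    fix p :: plane assume p: "1 / (1 - r) < norm p"
    have "0 < 1 / (1 - r)" using r by simp
    then have np: "0 < norm p" using p by linarith
    define n where "n = norm p"
    have n: "0 < n" "1 < n * (1 - r)" using np p r by (auto simp: n_def pos_divide_less_eq)
    have "sqrt (1 + n\<^sup>2) \<le> 1 + n"
      using n by (intro real_le_lsqrt) (auto simp: power2_eq_square algebra_simps)
    moreover have "norm (poincare_projection p) = n / sqrt (1 + n\<^sup>2)"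
      using one_plus_square_pos[of n] by (simp add: poincare_projection_eq n_def divide_inverse mult.commute)
    moreover have "n / (1 + n) \<le> n / sqrt (1 + n\<^sup>2)"
      using calculation(1) n one_plus_square_pos[of n] by (intro divide_left_mono) auto
    moreover have "r < n / (1 + n)" using n r by (simp add: pos_less_divide_eq algebra_simps)
    ultimately have "r < norm (poincare_projection p)" by linarith
    then have "poincare_projection p \<notin> poincare_disc - S" using r(2)[of "poincare_projection p"] by (auto simp: not_le)
    moreover have "poincare_projection p \<in> poincare_disc" "poincare_projection p \<notin> infinity_circle"
      using norm_poincare_projection_less[of p] by (auto simp: poincare_disc_def infinity_circle_def)
    ultimately have "poincare_projection p \<in> U - infinity_circle" using S(2) W(3) by blast
    then obtain C p' where C: "C \<in> \<C>" "p' \<in> C" "poincare_projection p = poincare_projection p'"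
      unfolding \<C>(2) by blast
    then have "p = p'" by (metis inverse_projection_left)
    then show "\<exists>C. closed_orbit V C \<and> p \<in> C" using C \<C>(1) by blast
  qed
next
  assume "outer_closed V"
  then obtain R where R: "\<And>p. R < norm p \<Longrightarrow> \<exists>C. closed_orbit V C \<and> p \<in> C"
    unfolding outer_closed_def by blast
  define R' where "R' = max R 0"
  define U where "U = infinity_circle \<union> (\<Union>C \<in> {C. closed_orbit V C}. poincare_projection ` C)"
  \<comment> \<open>The condition is \<open>R' < norm (inverse_projection q)\<close> cleared of the denominator, which makes sense on the circle as well.\<close>
  define W where "W = poincare_disc \<inter> {q. R' * sqrt (1 - (norm q)\<^sup>2) < norm q}"
  have img: "poincare_projection p \<in> poincare_disc" "poincare_projection p \<notin> infinity_circle" for p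
    using norm_poincare_projection_less[of p] by (auto simp: poincare_disc_def infinity_circle_def)
  show "center_at_infinity V" unfolding center_at_infinity_def
  proof (rule exI[of _ U], intro conjI, goal_cases)
    case 1
    show "U \<subseteq> poincare_disc"
      unfolding U_def using img by (auto simp: infinity_circle_def poincare_disc_def)
  next
    case 2
    have "open {q :: plane. R' * sqrt (1 - (norm q)\<^sup>2) < norm q}"
      by (intro open_Collect_less continuous_intros)
    then have "openin (top_of_set poincare_disc) W" unfolding W_def by (auto simp: openin_open)
    moreover have "infinity_circle \<subseteq> W"
      by (auto simp: W_def infinity_circle_def poincare_disc_def)
    moreover have "W \<subseteq> U"
    proof
      fix q assume q: "q \<in> W"
      show "q \<in> U"
      proof (cases "norm q = 1")
        case True
        then show ?thesis by (simp add: U_def infinity_circle_def)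
      next
        case False
        then have q1: "norm q < 1" using q by (auto simp: W_def poincare_disc_def)
        have "R' < norm (inverse_projection q)"
          by (rule norm_inverse_projection[OF q1]) (use q in \<open>auto simp: W_def R'_def\<close>)
        then obtain C where "closed_orbit V C" "inverse_projection q \<in> C"
          using R[of "inverse_projection q"] by (auto simp: R'_def)
        then show ?thesis unfolding U_def using inverse_projection_right[OF q1] by force
      qed
    qed
    ultimately show ?case by blast
  next
    case 3
    have "U - infinity_circle = (\<Union>C \<in> {C. closed_orbit V C}. poincare_projection ` C)"
      unfolding U_def using img by auto
    then show ?case by blast
  qed
qed

section \<open>Affine rescaling\<close>

text \<open>A time scale \<open>\<tau> < 0\<close> reverses the orientation of orbits; time-reversing symmetries are covered in this way.\<close>

lemma closed_orbit_affine:
  fixes \<alpha> \<beta> \<gamma> \<delta> \<tau> :: real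
  defines "A \<equiv> \<lambda>(X, Y). (\<alpha> * X + \<beta>, \<gamma> * Y + \<delta>)"
  assumes nz: "\<alpha> \<noteq> 0" "\<gamma> \<noteq> 0" "\<tau> \<noteq> 0"
    and W: "\<And>X Y. W (X, Y) = (\<tau> / \<alpha> * fst (V (\<alpha> * X + \<beta>, \<gamma> * Y + \<delta>)),
            \<tau> / \<gamma> * snd (V (\<alpha> * X + \<beta>, \<gamma> * Y + \<delta>)))"
    and C: "closed_orbit W C"
  shows "closed_orbit V (A ` C)"
proof -
  obtain \<psi> T where T: "0 < T" and d: "\<And>t. (\<psi> has_vector_derivative W (\<psi> t)) (at t)"
    and per: "\<And>t. \<psi> (t + T) = \<psi> t" and nc: "\<not> \<psi> constant_on UNIV" and rng: "C = range \<psi>"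
    using C unfolding closed_orbit_def by blast
  define \<phi> where "\<phi> = (\<lambda>t. A (\<psi> (t / \<tau>)))"
  have A_eq: "A z = (\<alpha> * fst z + \<beta>, \<gamma> * snd z + \<delta>)" for z by (simp add: A_def case_prod_unfold)
  have "(\<phi> has_vector_derivative V (\<phi> t)) (at t)" for t
  proof -
    have "((\<lambda>t. t / \<tau>) has_vector_derivative 1 / \<tau>) (at t)"
      using nz by (auto intro!: derivative_eq_intros simp: has_real_derivative_iff_has_vector_derivative[symmetric])
    from vector_diff_chain_at[OF this d]
    have d\<psi>: "((\<lambda>t. \<psi> (t / \<tau>)) has_vector_derivative (1 / \<tau>) *\<^sub>R W (\<psi> (t / \<tau>))) (at t)"
      by (simp add: o_def)
    have d1: "((\<lambda>t. fst (\<psi> (t / \<tau>))) has_real_derivative fst ((1 / \<tau>) *\<^sub>R W (\<psi> (t / \<tau>)))) (at t)"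
      and d2: "((\<lambda>t. snd (\<psi> (t / \<tau>))) has_real_derivative snd ((1 / \<tau>) *\<^sub>R W (\<psi> (t / \<tau>)))) (at t)"
      using bounded_linear.has_vector_derivative[OF bounded_linear_fst d\<psi>]
        bounded_linear.has_vector_derivative[OF bounded_linear_snd d\<psi>]
      by (simp_all add: has_real_derivative_iff_has_vector_derivative)
    have "((\<lambda>t. \<alpha> * fst (\<psi> (t / \<tau>)) + \<beta>) has_real_derivative \<alpha> * fst ((1 / \<tau>) *\<^sub>R W (\<psi> (t / \<tau>))) + 0) (at t)"
      by (intro DERIV_add DERIV_cmult d1 DERIV_const)
    moreover have "((\<lambda>t. \<gamma> * snd (\<psi> (t / \<tau>)) + \<delta>) has_real_derivative \<gamma> * snd ((1 / \<tau>) *\<^sub>R W (\<psi> (t / \<tau>))) + 0) (at t)"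
      by (intro DERIV_add DERIV_cmult d2 DERIV_const)
    moreover have "W (\<psi> (t / \<tau>)) = (\<tau> / \<alpha> * fst (V (\<phi> t)), \<tau> / \<gamma> * snd (V (\<phi> t)))"
      using W[of "fst (\<psi> (t / \<tau>))" "snd (\<psi> (t / \<tau>))"] by (simp add: \<phi>_def A_eq)
    ultimately have "((\<lambda>t. \<alpha> * fst (\<psi> (t / \<tau>)) + \<beta>) has_vector_derivative fst (V (\<phi> t))) (at t)"
      "((\<lambda>t. \<gamma> * snd (\<psi> (t / \<tau>)) + \<delta>) has_vector_derivative snd (V (\<phi> t))) (at t)"
      using nz by (simp_all add: has_real_derivative_iff_has_vector_derivative)
    then have "((\<lambda>t. (\<alpha> * fst (\<psi> (t / \<tau>)) + \<beta>, \<gamma> * snd (\<psi> (t / \<tau>)) + \<delta>)) has_vector_derivative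
        (fst (V (\<phi> t)), snd (V (\<phi> t)))) (at t)"
      by (rule has_vector_derivative_Pair)
    then show ?thesis by (simp add: \<phi>_def A_eq)
  qed
  moreover have "\<phi> (t + \<bar>\<tau>\<bar> * T) = \<phi> t" for t
  proof (cases "0 < \<tau>")
    case True
    then have "(t + \<bar>\<tau>\<bar> * T) / \<tau> = t / \<tau> + T" by (simp add: field_simps)
    then show ?thesis by (simp add: \<phi>_def per)
  next
    case False
    then have "t / \<tau> = (t + \<bar>\<tau>\<bar> * T) / \<tau> + T" using nz by (simp add: field_simps)
    then show ?thesis unfolding \<phi>_def by (metis per)
  qed
  moreover have "\<not> \<phi> constant_on UNIV"
  proof
    assume "\<phi> constant_on UNIV"
    then obtain p where p: "\<And>t. \<phi> t = p" by (auto simp: constant_on_def)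
    have "\<psi> t = ((fst p - \<beta>) / \<alpha>, (snd p - \<delta>) / \<gamma>)" for t
    proof -
      have "\<alpha> * fst (\<psi> t) + \<beta> = fst p" "\<gamma> * snd (\<psi> t) + \<delta> = snd p"
        using p[of "\<tau> * t"] nz by (auto simp: \<phi>_def A_eq)
      then show ?thesis using nz by (auto simp: prod_eq_iff field_simps)
    qed
    then have "\<psi> constant_on UNIV" unfolding constant_on_def by blast
    with nc show False ..
  qed
  moreover have "A ` C = range \<phi>"
  proof -
    have "A (\<psi> t) \<in> range \<phi>" for t
      by (rule range_eqI[of _ _ "\<tau> * t"]) (use nz in \<open>simp add: \<phi>_def\<close>)
    then have "A ` C \<subseteq> range \<phi>" unfolding rng by auto
    moreover have "range \<phi> \<subseteq> A ` C" unfolding rng by (auto simp: \<phi>_def)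
    ultimately show ?thesis by blast
  qed
  ultimately show ?thesis unfolding closed_orbit_def
    using T nz by (intro exI[of _ \<phi>] exI[of _ "\<bar>\<tau>\<bar> * T"]) auto
qed

lemma outer_closed_rescale:
  assumes "rescales_to V W" "outer_closed W"
  shows "outer_closed V"
proof -
  obtain \<alpha> \<beta> \<gamma> \<delta> \<tau> :: real where nz: "\<alpha> \<noteq> 0" "\<gamma> \<noteq> 0" "\<tau> \<noteq> 0"
    and W: "\<And>X Y. W (X, Y) = (\<tau> / \<alpha> * fst (V (\<alpha> * X + \<beta>, \<gamma> * Y + \<delta>)),
            \<tau> / \<gamma> * snd (V (\<alpha> * X + \<beta>, \<gamma> * Y + \<delta>)))"
    using assms(1) unfolding rescales_to_def by blast
  obtain R where R: "\<And>p. R < norm p \<Longrightarrow> \<exists>C. closed_orbit W C \<and> p \<in> C"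
    using assms(2) unfolding outer_closed_def by blast
  show ?thesis unfolding outer_closed_def
  proof (intro exI[of _ "(\<bar>\<alpha>\<bar> + \<bar>\<gamma>\<bar>) * \<bar>R\<bar> + (\<bar>\<beta>\<bar> + \<bar>\<delta>\<bar>)"] allI impI)
    fix p :: plane
    assume p: "(\<bar>\<alpha>\<bar> + \<bar>\<gamma>\<bar>) * \<bar>R\<bar> + (\<bar>\<beta>\<bar> + \<bar>\<delta>\<bar>) < norm p"
    define X where "X = (fst p - \<beta>) / \<alpha>"
    define Y where "Y = (snd p - \<delta>) / \<gamma>"
    have pA: "p = (\<alpha> * X + \<beta>, \<gamma> * Y + \<delta>)" using nz by (simp add: X_def Y_def)
    have "norm p \<le> norm (\<alpha> * X + \<beta>) + norm (\<gamma> * Y + \<delta>)" unfolding pA by (rule norm_Pair_le)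
    also have "\<dots> \<le> (\<bar>\<alpha>\<bar> * \<bar>X\<bar> + \<bar>\<beta>\<bar>) + (\<bar>\<gamma>\<bar> * \<bar>Y\<bar> + \<bar>\<delta>\<bar>)"
      unfolding real_norm_def abs_mult[symmetric] by (intro add_mono abs_triangle_ineq)
    also have "\<dots> \<le> (\<bar>\<alpha>\<bar> * norm (X, Y) + \<bar>\<beta>\<bar>) + (\<bar>\<gamma>\<bar> * norm (X, Y) + \<bar>\<delta>\<bar>)"
      using norm_fst_le[of X Y] norm_snd_le[of Y X] by (intro add_mono mult_left_mono order_refl) auto
    finally have "(\<bar>\<alpha>\<bar> + \<bar>\<gamma>\<bar>) * \<bar>R\<bar> < (\<bar>\<alpha>\<bar> + \<bar>\<gamma>\<bar>) * norm (X, Y)"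
      using p by (simp add: distrib_right)
    then have "\<bar>R\<bar> < norm (X, Y)" by (rule mult_left_less_imp_less) simp
    then obtain C where "closed_orbit W C" "(X, Y) \<in> C" using R by force
    then show "\<exists>C. closed_orbit V C \<and> p \<in> C"
    proof (intro exI conjI)
      show "closed_orbit V ((\<lambda>(X, Y). (\<alpha> * X + \<beta>, \<gamma> * Y + \<delta>)) ` C)"
        by (rule closed_orbit_affine[where W = W and \<tau> = \<tau>]) (use nz W \<open>closed_orbit W C\<close> in auto)
      show "p \<in> (\<lambda>(X, Y). (\<alpha> * X + \<beta>, \<gamma> * Y + \<delta>)) ` C"
        by (rule image_eqI[OF _ \<open>(X, Y) \<in> C\<close>]) (simp add: pA)
    qed
  qed
qed

section \<open>Closed orbits of odd systems\<close>

text \<open>Truncation of a real number to the interval from \<open>- M\<close> to \<open>M\<close>.\<close>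

definition clip :: "real \<Rightarrow> real \<Rightarrow> real" where
  "clip M u = max (- M) (min M u)"

lemma clip_minus: "0 \<le> M \<Longrightarrow> clip M (- u) = - clip M u"
  by (auto simp: clip_def)

lemma clip_id: "\<bar>u\<bar> \<le> M \<Longrightarrow> clip M u = u"
  by (auto simp: clip_def)

lemma abs_clip_le: "0 \<le> M \<Longrightarrow> \<bar>clip M u\<bar> \<le> M"
  by (auto simp: clip_def)

lemma clip_contraction: "\<bar>clip M u - clip M v\<bar> \<le> \<bar>u - v\<bar>"
  by (auto simp: clip_def)

text \<open>The field \<open>(y, - h(x) - c x y)\<close> with truncated arguments. It is globally Lipschitz, agrees with the original field on
  the square of half-width \<open>M\<close>, and has the same symmetries because \<open>clip M\<close> is odd.\<close>

definition clipped_field :: "real \<Rightarrow> real poly \<Rightarrow> real \<Rightarrow> plane \<Rightarrow> plane" where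
  "clipped_field M h c = (\<lambda>(x, y). (clip M y, - poly h (clip M x) - c * clip M x * clip M y))"

lemma clipped_field_lipschitz:
  assumes M: "0 \<le> M"
  obtains L where "\<And>u v. norm (clipped_field M h c u - clipped_field M h c v) \<le> L * norm (u - v)"
proof -
  have "compact ((\<lambda>x. poly (pderiv h) x) ` {-M..M})"
    by (intro compact_continuous_image continuous_intros) auto
  then obtain H where H: "\<And>x. x \<in> {-M..M} \<Longrightarrow> \<bar>poly (pderiv h) x\<bar> \<le> H"
    by (metis bounded_real compact_imp_bounded image_eqI)
  have H0: "0 \<le> H" using H[of 0] M by force
  have lip: "\<bar>poly h a - poly h b\<bar> \<le> H * \<bar>a - b\<bar>" if "a \<in> {-M..M}" "b \<in> {-M..M}" for a b
  proof -
    have "norm (poly h a - poly h b) \<le> H * norm (a - b)"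
    proof (rule field_differentiable_bound[of "{-M..M}"])
      show "(poly h has_field_derivative poly (pderiv h) z) (at z within {-M..M})" for z
        by (rule has_field_derivative_at_within[OF poly_DERIV])
    qed (use H that in auto)
    then show ?thesis by simp
  qed
  have "norm (clipped_field M h c u - clipped_field M h c v) \<le> (1 + H + 2 * \<bar>c\<bar> * M) * norm (u - v)" for u v
  proof -
    obtain x y x' y' where uv: "u = (x, y)" "v = (x', y')" by (metis surj_pair)
    define n where "n = norm (u - v)"
    have n: "\<bar>x - x'\<bar> \<le> n" "\<bar>y - y'\<bar> \<le> n"
      using norm_fst_le[of "x - x'" "y - y'"] norm_snd_le[of "y - y'" "x - x'"] by (auto simp: n_def uv)
    have cx: "\<bar>clip M x - clip M x'\<bar> \<le> n" and cy: "\<bar>clip M y - clip M y'\<bar> \<le> n"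
      using n clip_contraction[of M x x'] clip_contraction[of M y y'] by linarith+
    have "\<bar>poly h (clip M x) - poly h (clip M x')\<bar> \<le> H * \<bar>clip M x - clip M x'\<bar>"
      using abs_clip_le[OF M, of x] abs_clip_le[OF M, of x'] by (intro lip) (auto simp: abs_le_iff)
    also have "\<dots> \<le> H * n" using cx H0 by (intro mult_left_mono) auto
    finally have ph: "\<bar>poly h (clip M x) - poly h (clip M x')\<bar> \<le> H * n" .
    have "clip M x * clip M y - clip M x' * clip M y' =
        clip M x * (clip M y - clip M y') + (clip M x - clip M x') * clip M y'"
      by (simp add: algebra_simps)
    also have "\<bar>\<dots>\<bar> \<le> \<bar>clip M x\<bar> * \<bar>clip M y - clip M y'\<bar> + \<bar>clip M x - clip M x'\<bar> * \<bar>clip M y'\<bar>"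
      unfolding abs_mult[symmetric] by (rule abs_triangle_ineq)
    also have "\<dots> \<le> M * n + n * M"
      using abs_clip_le[OF M] cx cy M by (intro add_mono mult_mono) auto
    finally have pm: "\<bar>clip M x * clip M y - clip M x' * clip M y'\<bar> \<le> 2 * M * n" by simp
    have "\<bar>c * (clip M x * clip M y - clip M x' * clip M y')\<bar> \<le> \<bar>c\<bar> * (2 * M * n)"
      unfolding abs_mult using pm by (intro mult_left_mono) (auto simp: abs_mult)
    then have "\<bar>(- poly h (clip M x) - c * clip M x * clip M y) - (- poly h (clip M x') - c * clip M x' * clip M y')\<bar>
        \<le> H * n + \<bar>c\<bar> * (2 * M * n)"
      using ph by (simp add: algebra_simps abs_le_iff)
    moreover have "norm (clipped_field M h c u - clipped_field M h c v) \<le> norm (clip M y - clip M y') +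
        norm ((- poly h (clip M x) - c * clip M x * clip M y) - (- poly h (clip M x') - c * clip M x' * clip M y'))"
      unfolding uv clipped_field_def by (simp only: prod.case diff_Pair) (rule norm_Pair_le)
    ultimately have "norm (clipped_field M h c u - clipped_field M h c v) \<le> n + (H * n + \<bar>c\<bar> * (2 * M * n))"
      using cy by (simp only: real_norm_def)
    then show ?thesis by (simp add: n_def[symmetric] algebra_simps)
  qed
  then show ?thesis by (rule that)
qed

text \<open>A solution of the truncated system for all times.\<close>

definition clipped_solution ::
  "real \<Rightarrow> real poly \<Rightarrow> real \<Rightarrow> (real \<Rightarrow> real) \<Rightarrow> (real \<Rightarrow> real) \<Rightarrow> bool" where
  "clipped_solution M h c x y \<longleftrightarrow>
     (\<forall>t. (x has_real_derivative clip M (y t)) (at t) \<and>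
          (y has_real_derivative - poly h (clip M (x t)) - c * clip M (x t) * clip M (y t)) (at t))"

lemma clipped_solution_iff:
  "clipped_solution M h c x y \<longleftrightarrow>
     (\<forall>t. ((\<lambda>t. (x t, y t)) has_vector_derivative clipped_field M h c (x t, y t)) (at t))"
proof -
  have "((\<lambda>t. (x t, y t)) has_vector_derivative (u, v)) (at t) \<longleftrightarrow>
      (x has_real_derivative u) (at t) \<and> (y has_real_derivative v) (at t)" for u v t
  proof
    assume d: "((\<lambda>t. (x t, y t)) has_vector_derivative (u, v)) (at t)"
    show "(x has_real_derivative u) (at t) \<and> (y has_real_derivative v) (at t)"
      using bounded_linear.has_vector_derivative[OF bounded_linear_fst d]
        bounded_linear.has_vector_derivative[OF bounded_linear_snd d]
      by (simp add: has_real_derivative_iff_has_vector_derivative)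
  next
    assume "(x has_real_derivative u) (at t) \<and> (y has_real_derivative v) (at t)"
    then show "((\<lambda>t. (x t, y t)) has_vector_derivative (u, v)) (at t)"
      by (intro has_vector_derivative_Pair) (auto simp: has_real_derivative_iff_has_vector_derivative)
  qed
  then show ?thesis by (simp add: clipped_solution_def clipped_field_def)
qed

lemma clipped_solution_exists:
  assumes "0 \<le> M"
  obtains x y where "clipped_solution M h c x y" "x 0 = x0" "y 0 = y0"
proof -
  obtain L where L: "\<And>u v. norm (clipped_field M h c u - clipped_field M h c v) \<le> L * norm (u - v)"
    using clipped_field_lipschitz[OF assms] by blast
  obtain \<phi> where \<phi>: "\<phi> 0 = (x0, y0)" "\<And>t. (\<phi> has_vector_derivative clipped_field M h c (\<phi> t)) (at t)"
    by (rule picard_global[OF L]) blast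
  show ?thesis
    by (rule that[of "\<lambda>t. fst (\<phi> t)" "\<lambda>t. snd (\<phi> t)"]) (use \<phi> in \<open>auto simp: clipped_solution_iff\<close>)
qed

lemma clipped_solution_unique:
  assumes "0 \<le> M" "clipped_solution M h c x y" "clipped_solution M h c x' y'" "x 0 = x' 0" "y 0 = y' 0"
  shows "x = x'" "y = y'"
proof -
  obtain L where L: "\<And>u v. norm (clipped_field M h c u - clipped_field M h c v) \<le> L * norm (u - v)"
    using clipped_field_lipschitz[OF assms(1)] by blast
  have "(\<lambda>t. (x t, y t)) = (\<lambda>t. (x' t, y' t))"
    by (rule lipschitz_ode_unique[OF L]) (use assms in \<open>auto simp: clipped_solution_iff\<close>)
  then show "x = x'" "y = y'" by (auto simp: fun_eq_iff)
qed

lemma clipped_solution_reverse: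
  assumes M: "0 \<le> M" and sol: "clipped_solution M h c x y"
  shows "clipped_solution M h (- c) (\<lambda>t. x (- t)) (\<lambda>t. - y (- t))"
  unfolding clipped_solution_def
proof (intro allI conjI)
  fix t
  have d: "(x has_real_derivative clip M (y (- t))) (at (- t))"
    "(y has_real_derivative - poly h (clip M (x (- t))) - c * clip M (x (- t)) * clip M (y (- t))) (at (- t))"
    using sol by (auto simp: clipped_solution_def)
  have m: "(uminus has_real_derivative - 1) (at t)" by (auto intro!: derivative_eq_intros)
  show "((\<lambda>t. x (- t)) has_real_derivative clip M (- y (- t))) (at t)"
    by (rule DERIV_cong[OF DERIV_chain2[OF d(1) m]]) (simp add: clip_minus[OF M])
  show "((\<lambda>t. - y (- t)) has_real_derivative
      - poly h (clip M (x (- t))) - - c * clip M (x (- t)) * clip M (- y (- t))) (at t)"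
    by (rule DERIV_cong[OF DERIV_minus[OF DERIV_chain2[OF d(2) m]]]) (simp add: clip_minus[OF M])
qed

text \<open>The reversibility of the system with odd \<open>h\<close>.\<close>

lemma clipped_solution_reflect:
  assumes M: "0 \<le> M" and sol: "clipped_solution M h c x y" and odd: "\<And>x. poly h (- x) = - poly h x"
  shows "clipped_solution M h c (\<lambda>t. - x (- t)) (\<lambda>t. y (- t))"
  unfolding clipped_solution_def
proof (intro allI conjI)
  fix t
  have d: "(x has_real_derivative clip M (y (- t))) (at (- t))"
    "(y has_real_derivative - poly h (clip M (x (- t))) - c * clip M (x (- t)) * clip M (y (- t))) (at (- t))"
    using sol by (auto simp: clipped_solution_def)
  have m: "(uminus has_real_derivative - 1) (at t)" by (auto intro!: derivative_eq_intros)
  show "((\<lambda>t. - x (- t)) has_real_derivative clip M (y (- t))) (at t)"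
    by (rule DERIV_cong[OF DERIV_minus[OF DERIV_chain2[OF d(1) m]]]) simp
  show "((\<lambda>t. y (- t)) has_real_derivative
      - poly h (clip M (- x (- t))) - c * clip M (- x (- t)) * clip M (y (- t))) (at t)"
    by (rule DERIV_cong[OF DERIV_chain2[OF d(2) m]]) (simp add: clip_minus[OF M] odd)
qed

lemma clipped_solution_shift:
  assumes "clipped_solution M h c x y"
  shows "clipped_solution M h c (\<lambda>t. x (t + s)) (\<lambda>t. y (t + s))"
  unfolding clipped_solution_def
proof (intro allI conjI)
  fix t
  have d: "(x has_real_derivative clip M (y (t + s))) (at (t + s))"
    "(y has_real_derivative - poly h (clip M (x (t + s))) - c * clip M (x (t + s)) * clip M (y (t + s))) (at (t + s))"
    using assms by (auto simp: clipped_solution_def)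
  show "((\<lambda>t. x (t + s)) has_real_derivative clip M (y (t + s))) (at t)"
    using d(1) by (simp only: DERIV_shift)
  show "((\<lambda>t. y (t + s)) has_real_derivative
      - poly h (clip M (x (t + s))) - c * clip M (x (t + s)) * clip M (y (t + s))) (at t)"
    using d(2) by (simp only: DERIV_shift)
qed

lemma clipped_solution_continuous:
  assumes "clipped_solution M h c x y"
  shows "continuous_on S x" "continuous_on S y"
  using assms by (auto simp: clipped_solution_def intro!: continuous_at_imp_continuous_on DERIV_isCont)

lemma clipped_solution_in_box:
  assumes "clipped_solution M h c x y" "\<And>t. t \<in> S \<Longrightarrow> \<bar>x t\<bar> \<le> M \<and> \<bar>y t\<bar> \<le> M"
  shows "lienard_solution h c x y S"
  using assms unfolding lienard_solution_def clipped_solution_def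
  by (metis clip_id)

text \<open>While \<open>x \<ge> 0\<close>, the energy bound keeps the solution strictly inside the square, so truncation plays no role.\<close>

lemma clipped_half_plane_bounds:
  assumes rc: "rotation_constants h G c K R0 \<Lambda> \<tau>" and sol: "clipped_solution M h c x y"
    and start: "R0 < (y 0)\<^sup>2 / 2 + poly G (x 0) + K"
    and M: "\<Lambda> * ((y 0)\<^sup>2 / 2 + poly G (x 0) + K) + 1 < M"
    and "0 \<le> b" and nn: "\<And>t. t \<in> {0..b} \<Longrightarrow> 0 \<le> x t"
  shows "b \<le> \<tau>" "\<And>t. t \<in> {0..b} \<Longrightarrow> \<bar>x t\<bar> \<le> M \<and> \<bar>y t\<bar> \<le> M"
proof -
  define E where "E = \<Lambda> * ((y 0)\<^sup>2 / 2 + poly G (x 0) + K)"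
  have L: "1 \<le> \<Lambda>" "0 < R0" and GK: "\<And>x. 0 \<le> x \<Longrightarrow> x \<le> poly G x + K"
    using rc unfolding rotation_constants_def by blast+
  have E0: "0 \<le> E" using L start by (simp add: E_def)
  have rot: "u - 0 \<le> \<tau> \<and> (\<forall>t\<in>{0..u}. (y t)\<^sup>2 / 2 + poly G (x t) + K \<le> E)"
    if "0 \<le> u" "u \<le> b" "\<And>t. t \<in> {0..u} \<Longrightarrow> \<bar>x t\<bar> \<le> M \<and> \<bar>y t\<bar> \<le> M" for u
  proof -
    have "lienard_solution h c x y {0..u}" by (rule clipped_solution_in_box[OF sol]) (use that in auto)
    moreover have "\<forall>t\<in>{0..u}. 0 \<le> x t" using nn that by auto
    ultimately show ?thesis
      using rc start that(1) unfolding rotation_constants_def E_def by blast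
  qed
  have small: "\<bar>x t\<bar> < M \<and> \<bar>y t\<bar> < M" if "0 \<le> x t" "(y t)\<^sup>2 / 2 + poly G (x t) + K \<le> E" for t
  proof -
    have "x t \<le> E" "(y t)\<^sup>2 \<le> 2 * E" using GK[OF that(1)] that zero_le_power2[of "y t"] by linarith+
    moreover have "2 * E \<le> (E + 1)\<^sup>2" by (simp add: power2_eq_square algebra_simps)
    ultimately have "(y t)\<^sup>2 \<le> (E + 1)\<^sup>2" by linarith
    then have "\<bar>y t\<bar> \<le> E + 1" using E0 by (simp add: abs_le_square_iff[symmetric])
    then show ?thesis using \<open>x t \<le> E\<close> that(1) M by (simp add: E_def[symmetric])
  qed
  define f where "f = (\<lambda>t. M - max \<bar>x t\<bar> \<bar>y t\<bar>)"
  have "0 \<le> x 0" using nn \<open>0 \<le> b\<close> by simp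
  moreover have "1 * ((y 0)\<^sup>2 / 2 + poly G (x 0) + K) \<le> E"
    unfolding E_def using L start by (intro mult_right_mono) auto
  ultimately have f0: "0 < f 0" using small[of 0] by (simp add: f_def)
  have cf: "continuous_on {0..u} f" for u
    unfolding f_def using clipped_solution_continuous[OF sol] by (intro continuous_intros)
  have fpos: "0 < f t" if t: "t \<in> {0..b}" for t
  proof (rule ccontr)
    assume "\<not> 0 < f t"
    then have "f t \<le> 0" "0 \<le> t" using t by auto
    from first_hit[OF cf f0 this] obtain s where s: "0 < s" "s \<le> t" "f s = 0"
      "\<And>u. 0 \<le> u \<Longrightarrow> u < s \<Longrightarrow> 0 < f u" by blast
    have "(y s)\<^sup>2 / 2 + poly G (x s) + K \<le> E"
    proof -
      have "\<bar>x u\<bar> \<le> M \<and> \<bar>y u\<bar> \<le> M" if "u \<in> {0..s}" for u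
        using s(3) s(4)[of u] that by (cases "u = s") (auto simp: f_def)
      then show ?thesis using rot[of s] s t by simp
    qed
    with small[of s] nn[of s] s(1,2) t have "\<bar>x s\<bar> < M \<and> \<bar>y s\<bar> < M" by simp
    then have "0 < f s" by (simp add: f_def)
    with s(3) show False by simp
  qed
  show box: "\<bar>x t\<bar> \<le> M \<and> \<bar>y t\<bar> \<le> M" if "t \<in> {0..b}" for t
    using fpos[OF that] by (simp add: f_def)
  show "b \<le> \<tau>" using rot[of b] box \<open>0 \<le> b\<close> by simp
qed

lemma clipped_next_crossing:
  assumes rc: "rotation_constants h G c K R0 \<Lambda> \<tau>" and sol: "clipped_solution M h c x y"
    and start: "R0 < (y 0)\<^sup>2 / 2 + poly G (x 0) + K"
    and M: "\<Lambda> * ((y 0)\<^sup>2 / 2 + poly G (x 0) + K) + 1 < M"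
    and x0: "0 < x 0 \<or> x 0 = 0 \<and> 0 < y 0"
  obtains b where "0 < b" "x b = 0" "\<And>t. t \<in> {0..b} \<Longrightarrow> 0 \<le> x t \<and> \<bar>x t\<bar> \<le> M \<and> \<bar>y t\<bar> \<le> M"
proof -
  have "0 < \<Lambda> * ((y 0)\<^sup>2 / 2 + poly G (x 0) + K)"
    using rc start unfolding rotation_constants_def by (intro mult_pos_pos) linarith+
  then have M0: "0 < M" using M by linarith
  have \<tau>: "0 < \<tau>" using rc unfolding rotation_constants_def by blast
  have "0 \<le> x 0" using x0 by auto
  have "\<exists>b>0. x b \<le> 0"
  proof (rule ccontr)
    assume "\<not> (\<exists>b>0. x b \<le> 0)"
    then have nn: "0 \<le> x t" if "t \<in> {0..\<tau> + 1}" for t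
      using that \<open>0 \<le> x 0\<close> by (cases "t = 0") (auto simp: not_le intro: less_imp_le)
    have "\<tau> + 1 \<le> \<tau>"
      by (rule clipped_half_plane_bounds(1)[OF rc sol start M _ nn]) (use \<tau> in auto)
    then show False by simp
  qed
  then obtain b1 where b1: "0 < b1" "x b1 \<le> 0" by blast
  obtain b where b: "0 < b" "x b = 0" "\<And>t. 0 < t \<Longrightarrow> t < b \<Longrightarrow> 0 < x t"
  proof (cases "0 < x 0")
    case True
    from first_hit[OF clipped_solution_continuous(1)[OF sol] this b1(2) less_imp_le[OF b1(1)]]
    show ?thesis using that by (metis less_imp_le)
  next
    case False
    then have "x 0 = 0" "0 < clip M (y 0)" using x0 M0 by (auto simp: clip_def)
    moreover have "(x has_real_derivative clip M (y t)) (at t)" for t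
      using sol by (auto simp: clipped_solution_def)
    ultimately show ?thesis using next_zero[of x "\<lambda>t. clip M (y t)" 0 b1] b1 that by blast
  qed
  have nn: "0 \<le> x t" if "t \<in> {0..b}" for t
    using b(2) b(3)[of t] \<open>0 \<le> x 0\<close> that by (cases "t = 0 \<or> t = b") auto
  show ?thesis
    by (rule that[OF b(1,2)]) (use nn clipped_half_plane_bounds(2)[OF rc sol start M less_imp_le[OF b(1)] nn] in blast)
qed

lemma closed_orbit_if_lienard_solution:
  assumes sol: "lienard_solution h c x y UNIV" and "0 < T"
    and per: "\<And>t. x (t + T) = x t" "\<And>t. y (t + T) = y t"
    and nc: "\<not> (\<forall>t. x t = x 0 \<and> y t = y 0)"
  shows "closed_orbit (lienard_field h [:0, c:]) (range (\<lambda>t. (x t, y t)))"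
  unfolding closed_orbit_def
proof (intro exI[of _ "\<lambda>t. (x t, y t)"] exI[of _ T] conjI allI)
  fix t
  have "(x has_real_derivative y t) (at t)" "(y has_real_derivative - poly h (x t) - c * x t * y t) (at t)"
    using sol by (auto simp: lienard_solution_def)
  then have "((\<lambda>t. (x t, y t)) has_vector_derivative (y t, - poly h (x t) - c * x t * y t)) (at t)"
    by (intro has_vector_derivative_Pair) (simp_all add: has_real_derivative_iff_has_vector_derivative)
  moreover have "lienard_field h [:0, c:] (x t, y t) = (y t, - poly h (x t) - c * x t * y t)"
    by (simp add: lienard_field_def mult_ac)
  ultimately show "((\<lambda>t. (x t, y t)) has_vector_derivative lienard_field h [:0, c:] (x t, y t)) (at t)"
    by simp
  show "(x (t + T), y (t + T)) = (x t, y t)" by (simp add: per)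
next
  show "\<not> (\<lambda>t. (x t, y t)) constant_on UNIV"
  proof
    assume "(\<lambda>t. (x t, y t)) constant_on UNIV"
    then obtain p where "\<And>t. (x t, y t) = p" by (auto simp: constant_on_def)
    then have "\<forall>t. x t = x 0 \<and> y t = y 0" by (metis prod.inject)
    with nc show False ..
  qed
qed (use assms in auto)

text \<open>The orbit meets the \<open>y\<close>-axis at times \<open>- a \<le> 0\<close> and \<open>b > 0\<close>. Shifted to start on the axis, it is
  symmetric under reflection by uniqueness, so it closes up after twice the time \<open>T = a + b\<close>.\<close>

lemma odd_field_closed_orbit_quadrant:
  assumes odd: "\<And>x. poly h (- x) = - poly h x"
    and rc: "rotation_constants h G c K R0 \<Lambda> \<tau>" and rc': "rotation_constants h G (- c) K' R0' \<Lambda>' \<tau>'"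
    and start: "R0 < y0\<^sup>2 / 2 + poly G x0 + K" and start': "R0' < y0\<^sup>2 / 2 + poly G x0 + K'"
    and p: "0 \<le> x0" "0 \<le> y0" "0 < x0 \<or> 0 < y0"
  shows "\<exists>C. closed_orbit (lienard_field h [:0, c:]) C \<and> (x0, y0) \<in> C"
proof -
  define E where "E = \<Lambda> * (y0\<^sup>2 / 2 + poly G x0 + K)"
  define E' where "E' = \<Lambda>' * (y0\<^sup>2 / 2 + poly G x0 + K')"
  define M where "M = max \<bar>E\<bar> \<bar>E'\<bar> + 2"
  have M: "E + 1 < M" "E' + 1 < M" "0 \<le> M" by (auto simp: M_def)
  obtain x y where sol: "clipped_solution M h c x y" and init: "x 0 = x0" "y 0 = y0"
    using clipped_solution_exists[OF M(3)] by blast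
  have st: "R0 < (y 0)\<^sup>2 / 2 + poly G (x 0) + K" "\<Lambda> * ((y 0)\<^sup>2 / 2 + poly G (x 0) + K) + 1 < M"
    using start M by (auto simp: init E_def)
  have "0 < x 0 \<or> x 0 = 0 \<and> 0 < y 0" using p by (auto simp: init)
  from clipped_next_crossing[OF rc sol st this]
  obtain b where b: "0 < b" "x b = 0" "\<And>t. t \<in> {0..b} \<Longrightarrow> 0 \<le> x t \<and> \<bar>x t\<bar> \<le> M \<and> \<bar>y t\<bar> \<le> M" by blast
  obtain a where a: "0 \<le> a" "x (- a) = 0" "\<And>t. t \<in> {- a..0} \<Longrightarrow> \<bar>x t\<bar> \<le> M \<and> \<bar>y t\<bar> \<le> M"
  proof (cases "x0 = 0")
    case True
    show ?thesis
    proof (rule that[of 0])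
      show "\<bar>x t\<bar> \<le> M \<and> \<bar>y t\<bar> \<le> M" if "t \<in> {- 0..0}" for t using b(3)[of 0] b(1) that by auto
    qed (use True init in auto)
  next
    case False
    define X where "X = (\<lambda>t. x (- t))"
    define Y where "Y = (\<lambda>t. - y (- t))"
    have solr: "clipped_solution M h (- c) X Y"
      unfolding X_def Y_def by (rule clipped_solution_reverse[OF M(3) sol])
    have "R0' < (Y 0)\<^sup>2 / 2 + poly G (X 0) + K'" "\<Lambda>' * ((Y 0)\<^sup>2 / 2 + poly G (X 0) + K') + 1 < M"
      using start' M by (auto simp: X_def Y_def init E'_def)
    moreover have "0 < X 0 \<or> X 0 = 0 \<and> 0 < Y 0" using p False by (auto simp: X_def init)
    ultimately obtain a where a: "0 < a" "X a = 0" "\<And>t. t \<in> {0..a} \<Longrightarrow> 0 \<le> X t \<and> \<bar>X t\<bar> \<le> M \<and> \<bar>Y t\<bar> \<le> M"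
      using clipped_next_crossing[OF rc' solr] by blast
    show ?thesis
    proof (rule that[of a])
      show "\<bar>x t\<bar> \<le> M \<and> \<bar>y t\<bar> \<le> M" if "t \<in> {- a..0}" for t
        using a(3)[of "- t"] that by (auto simp: X_def Y_def)
    qed (use a in \<open>auto simp: X_def\<close>)
  qed
  define u where "u = (\<lambda>t. x (t + (- a)))"
  define v where "v = (\<lambda>t. y (t + (- a)))"
  define T where "T = a + b"
  have T: "0 < T" using a b by (simp add: T_def)
  have soluv: "clipped_solution M h c u v" unfolding u_def v_def by (rule clipped_solution_shift[OF sol])
  have u0: "u 0 = 0" "u T = 0" using a b by (auto simp: u_def T_def)
  have box: "\<bar>u t\<bar> \<le> M \<and> \<bar>v t\<bar> \<le> M" if "t \<in> {0..T}" for t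
    using a(3)[of "t - a"] b(3)[of "t - a"] that by (cases "t \<le> a") (auto simp: u_def v_def T_def)
  have refl: "u = (\<lambda>t. - u (- t))" "v = (\<lambda>t. v (- t))"
    by (rule clipped_solution_unique[OF M(3) soluv clipped_solution_reflect[OF M(3) soluv odd]]; simp add: u0)+
  have refl': "u (- t) = - u t" "v (- t) = v t" for t
    using fun_cong[OF refl(1), of "- t"] fun_cong[OF refl(2), of "- t"] by auto
  have shift: "(\<lambda>t. u (t + T)) = (\<lambda>t. u (t + (- T)))" "(\<lambda>t. v (t + T)) = (\<lambda>t. v (t + (- T)))"
    by (rule clipped_solution_unique[OF M(3) clipped_solution_shift[OF soluv] clipped_solution_shift[OF soluv]];
        simp add: refl' u0)+
  have per: "u (t + 2 * T) = u t" "v (t + 2 * T) = v t" for t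
    using fun_cong[OF shift(1), of "t + T"] fun_cong[OF shift(2), of "t + T"] by (auto simp: algebra_simps)
  have boxall: "\<bar>u t\<bar> \<le> M \<and> \<bar>v t\<bar> \<le> M" for t
  proof -
    have T2: "0 < 2 * T" using T by simp
    obtain k :: int where k: "t + of_int k * (2 * T) \<in> {- T..- T + 2 * T}"
      "\<And>t. (\<lambda>t. (u t, v t)) (t + of_int k * (2 * T)) = (\<lambda>t. (u t, v t)) t"
      by (rule periodic_to_fundamental[OF T2, of "\<lambda>t. (u t, v t)" t "- T"]) (use per in auto)
    define s where "s = t + of_int k * (2 * T)"
    have "\<bar>u s\<bar> \<le> M \<and> \<bar>v s\<bar> \<le> M"
      using box[of s] box[of "- s"] k(1) by (cases "0 \<le> s") (auto simp: refl' s_def[symmetric])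
    then show ?thesis using k(2)[of t] by (simp add: s_def)
  qed
  have solL: "lienard_solution h c u v UNIV"
    by (rule clipped_solution_in_box[OF soluv]) (use boxall in auto)
  have ua: "u a = x0" "v a = y0" by (auto simp: u_def v_def init)
  have nc: "\<not> (\<forall>t. u t = u 0 \<and> v t = v 0)"
  proof
    assume const: "\<forall>t. u t = u 0 \<and> v t = v 0"
    then have "x0 = 0" "v 0 = y0" using ua u0 by metis+
    then have "0 < v 0" using p by auto
    moreover have "(u has_real_derivative v 0) (at 0)" using solL by (auto simp: lienard_solution_def)
    moreover have "u = (\<lambda>t. 0)" using const u0 by auto
    ultimately show False using DERIV_unique[of u "v 0" 0 0] by simp
  qed
  have "closed_orbit (lienard_field h [:0, c:]) (range (\<lambda>t. (u t, v t)))"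
    by (rule closed_orbit_if_lienard_solution[OF solL _ per nc]) (use T in simp)
  moreover have "(x0, y0) \<in> range (\<lambda>t. (u t, v t))"
    by (rule range_eqI[of _ _ a]) (simp add: ua)
  ultimately show ?thesis by blast
qed

lemma outer_closed_if_odd:
  assumes odd: "\<And>x. poly h (- x) = - poly h x"
    and lower: "0 < \<delta>" "0 \<le> B" "\<And>x. 0 \<le> x \<Longrightarrow> (c\<^sup>2 / 8 + \<delta>) * x ^ 3 - B \<le> poly h x"
  shows "outer_closed (lienard_field h [:0, c:])"
proof -
  obtain G where G: "pderiv G = h" "poly G 0 = 0" using poly_primitive by blast
  have large: "\<exists>R. \<forall>x y. 0 \<le> x \<longrightarrow> 0 \<le> y \<longrightarrow> R < norm (x, y) \<longrightarrow> R0 < y\<^sup>2 / 2 + poly G x + K"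
    if rc: "rotation_constants h G c' K R0 \<Lambda> \<tau>" for c' K R0 \<Lambda> \<tau>
  proof (intro exI[of _ "2 * R0 + 2"] allI impI)
    have GK: "\<And>x. 0 \<le> x \<Longrightarrow> x \<le> poly G x + K" and R0: "0 < R0"
      using rc unfolding rotation_constants_def by blast+
    fix x y :: real
    assume xy: "0 \<le> x" "0 \<le> y" "2 * R0 + 2 < norm (x, y)"
    have "norm (x, y) \<le> x + y" using norm_Pair_le[of x y] xy by simp
    then have "2 * R0 + 2 < x + y" using xy by linarith
    moreover have "y \<le> y\<^sup>2 / 2 + 1 / 2" using sum_squares_bound[of 1 y] by simp
    ultimately have "R0 < y\<^sup>2 / 2 + x" using R0 by linarith
    then show "R0 < y\<^sup>2 / 2 + poly G x + K" using GK[OF xy(1)] by linarith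
  qed
  have lower': "\<And>x. 0 \<le> x \<Longrightarrow> ((- c)\<^sup>2 / 8 + \<delta>) * x ^ 3 - B \<le> poly h x" using lower(3) by simp
  obtain K R0 \<Lambda> \<tau> where rc: "rotation_constants h G c K R0 \<Lambda> \<tau>"
    by (rule half_plane_rotation[OF lower G])
  obtain K' R0' \<Lambda>' \<tau>' where rc': "rotation_constants h G (- c) K' R0' \<Lambda>' \<tau>'"
    by (rule half_plane_rotation[OF lower(1,2) lower' G])
  have rc'': "rotation_constants h G (- (- c)) K R0 \<Lambda> \<tau>" using rc by simp
  obtain R where R: "\<And>x y. 0 \<le> x \<Longrightarrow> 0 \<le> y \<Longrightarrow> R < norm (x, y) \<Longrightarrow> R0 < y\<^sup>2 / 2 + poly G x + K"
    using large[OF rc] by blast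
  obtain R' where R': "\<And>x y. 0 \<le> x \<Longrightarrow> 0 \<le> y \<Longrightarrow> R' < norm (x, y) \<Longrightarrow> R0' < y\<^sup>2 / 2 + poly G x + K'"
    using large[OF rc'] by blast
  define S where "S = max 0 (max R R')"
  have quadrant: "\<exists>C. closed_orbit (lienard_field h [:0, c:]) C \<and> (x0, y0) \<in> C"
    "\<exists>C. closed_orbit (lienard_field h [:0, - c:]) C \<and> (x0, y0) \<in> C"
    if "0 \<le> x0" "0 \<le> y0" "S < norm (x0, y0)" for x0 y0
  proof -
    have b: "R0 < y0\<^sup>2 / 2 + poly G x0 + K" "R0' < y0\<^sup>2 / 2 + poly G x0 + K'"
      using R[OF that(1,2)] R'[OF that(1,2)] that(3) by (auto simp: S_def)
    have nz: "0 < x0 \<or> 0 < y0" using that by (auto simp: S_def less_le zero_prod_def[symmetric])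
    show "\<exists>C. closed_orbit (lienard_field h [:0, c:]) C \<and> (x0, y0) \<in> C"
      by (rule odd_field_closed_orbit_quadrant[OF odd rc rc' b that(1,2) nz])
    show "\<exists>C. closed_orbit (lienard_field h [:0, - c:]) C \<and> (x0, y0) \<in> C"
      by (rule odd_field_closed_orbit_quadrant[OF odd rc' rc'' b(2,1) that(1,2) nz])
  qed
  have half: "\<exists>C. closed_orbit (lienard_field h [:0, c:]) C \<and> (x0, y0) \<in> C"
    if xy: "0 \<le> x0" "S < norm (x0, y0)" for x0 y0
  proof (cases "0 \<le> y0")
    case False
    then obtain C where C: "closed_orbit (lienard_field h [:0, - c:]) C" "(x0, - y0) \<in> C"
      using quadrant(2)[of x0 "- y0"] xy by (auto simp: norm_Pair)
    have "closed_orbit (lienard_field h [:0, c:]) ((\<lambda>(X, Y). (1 * X + 0, - 1 * Y + 0)) ` C)"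
      by (rule closed_orbit_affine[OF _ _ _ _ C(1), where \<tau> = "- 1"]) (auto simp: lienard_field_def)
    moreover have "(x0, y0) \<in> (\<lambda>(X, Y). (1 * X + 0, - 1 * Y + 0)) ` C"
      by (rule image_eqI[OF _ C(2)]) simp
    ultimately show ?thesis by blast
  qed (use quadrant(1) xy in auto)
  have "\<exists>C. closed_orbit (lienard_field h [:0, c:]) C \<and> (x0, y0) \<in> C"
    if xy: "S < norm (x0, y0)" for x0 y0
  proof (cases "0 \<le> x0")
    case False
    then obtain C where C: "closed_orbit (lienard_field h [:0, c:]) C" "(- x0, y0) \<in> C"
      using half[of "- x0" y0] xy by (auto simp: norm_Pair)
    have "closed_orbit (lienard_field h [:0, c:]) ((\<lambda>(X, Y). (- 1 * X + 0, 1 * Y + 0)) ` C)"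
      by (rule closed_orbit_affine[OF _ _ _ _ C(1), where \<tau> = "- 1"]) (auto simp: lienard_field_def odd)
    moreover have "(x0, y0) \<in> (\<lambda>(X, Y). (- 1 * X + 0, 1 * Y + 0)) ` C"
      by (rule image_eqI[OF _ C(2)]) simp
    ultimately show ?thesis by blast
  qed (use half xy in auto)
  then have "\<forall>p. S < norm p \<longrightarrow> (\<exists>C. closed_orbit (lienard_field h [:0, c:]) C \<and> p \<in> C)" by auto
  then show ?thesis unfolding outer_closed_def by blast
qed

section \<open>Characterization of centres at infinity\<close>

text \<open>The symmetry \<open>(y, t) \<mapsto> (- y, - t)\<close> changes the sign of the damping.\<close>

lemma outer_closed_reverse:
  assumes "outer_closed (lienard_field h [:0, c:])"
  shows "outer_closed (lienard_field h [:0, - c:])"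
proof (rule outer_closed_rescale[OF _ assms])
  show "rescales_to (lienard_field h [:0, - c:]) (lienard_field h [:0, c:])"
    unfolding rescales_to_def
    by (rule exI[of _ 1], rule exI[of _ 0], rule exI[of _ "- 1"], rule exI[of _ 0], rule exI[of _ "- 1"])
      (simp add: lienard_field_def)
qed

text \<open>The mirror system is the original one under \<open>(x, t) \<mapsto> (- x, - t)\<close>.\<close>

lemma outer_closed_mirror:
  assumes "outer_closed (lienard_field h [:0, c:])"
  shows "outer_closed (lienard_field (- pcompose h [:0, -1:]) [:0, c:])"
proof (rule outer_closed_rescale[OF _ assms])
  show "rescales_to (lienard_field (- pcompose h [:0, -1:]) [:0, c:]) (lienard_field h [:0, c:])"
    unfolding rescales_to_def
    by (rule exI[of _ "- 1"], rule exI[of _ 0], rule exI[of _ 1], rule exI[of _ 0], rule exI[of _ "- 1"])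
      (simp add: lienard_field_def poly_pcompose)
qed

text \<open>The degree bound is later improved to three by parity, as the same holds for the mirror image.\<close>

lemma supercritical_if_outer_closed:
  assumes "c \<noteq> 0" "outer_closed (lienard_field h [:0, c:])"
  shows "2 \<le> degree (h - monom (c\<^sup>2 / 8) 3) \<and> 0 < lead_coeff (h - monom (c\<^sup>2 / 8) 3)"
proof (rule ccontr)
  assume "\<not> ?thesis"
  then have "degree (h - monom (c\<^sup>2 / 8) 3) \<le> 1 \<or> lead_coeff (h - monom (c\<^sup>2 / 8) 3) \<le> 0" by linarith
  from poly_linear_upper_bound[OF this] obtain A X0 where
    "\<And>x. X0 \<le> x \<Longrightarrow> poly (h - monom (c\<^sup>2 / 8) 3) x \<le> A * x" by blast
  then have up: "poly h x \<le> x * (c\<^sup>2 / 8 * x\<^sup>2 + A)" if "X0 \<le> x" for x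
    using that by (fastforce simp: poly_monom algebra_simps power2_eq_square power3_eq_cube)
  show False
  proof (cases "c < 0")
    case True
    then show ?thesis using not_outer_closed_if_escape[OF True up] assms(2) by blast
  next
    case False
    then have "- c < 0" using assms(1) by simp
    moreover have "poly h x \<le> x * ((- c)\<^sup>2 / 8 * x\<^sup>2 + A)" if "X0 \<le> x" for x using up[OF that] by simp
    ultimately show ?thesis
      using not_outer_closed_if_escape[of "- c" X0 h A] outer_closed_reverse[OF assms(2)] by blast
  qed
qed

lemma mirror_lead_coeff:
  fixes p :: "real poly"
  shows "degree (- pcompose p [:0, -1:]) = degree p"
    "lead_coeff (- pcompose p [:0, -1:]) = - (lead_coeff p * (-1) ^ degree p)"
proof -
  show "degree (- pcompose p [:0, -1:]) = degree p" by (simp add: degree_pcompose)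
  show "lead_coeff (- pcompose p [:0, -1:]) = - (lead_coeff p * (-1) ^ degree p)"
    unfolding lead_coeff_minus by (subst lead_coeff_comp) simp_all
qed

lemma cubic_bound_if_supercritical:
  fixes h :: "real poly"
  assumes "3 \<le> degree (h - monom (c\<^sup>2 / 8) 3)" "0 < lead_coeff (h - monom (c\<^sup>2 / 8) 3)"
  obtains \<delta> B where "0 < \<delta>" "0 \<le> B" "\<And>x. 0 \<le> x \<Longrightarrow> (c\<^sup>2 / 8 + \<delta>) * x ^ 3 - B \<le> poly h x"
proof -
  obtain \<delta> B where "0 < \<delta>" "0 \<le> B"
    "\<And>x. 0 \<le> x \<Longrightarrow> \<delta> * x ^ 3 - B \<le> poly (h - monom (c\<^sup>2 / 8) 3) x"
    using cubic_lower_bound[OF assms] by blast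
  then show ?thesis
    by (intro that[of \<delta> B]) (auto simp: poly_monom algebra_simps)
qed

lemma odd_supercritical_if_outer_closed:
  assumes "c \<noteq> 0" "outer_closed (lienard_field h [:0, c:])"
  shows "3 \<le> degree (h - monom (c\<^sup>2 / 8) 3)" "0 < lead_coeff (h - monom (c\<^sup>2 / 8) 3)"
    "poly h (- x) = - poly h x"
proof -
  define h' where "h' = - pcompose h [:0, -1:]"
  define d where "d = h - monom (c\<^sup>2 / 8) 3"
  have h'h: "- pcompose h' [:0, -1:] = h"
    by (rule poly_eq_poly_eq_iff[THEN iffD1]) (simp add: fun_eq_iff h'_def poly_pcompose)
  have d': "h' - monom (c\<^sup>2 / 8) 3 = - pcompose d [:0, -1:]"
    by (rule poly_eq_poly_eq_iff[THEN iffD1])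
      (simp add: fun_eq_iff h'_def d_def poly_pcompose poly_monom)
  have sup: "2 \<le> degree d" "0 < lead_coeff d"
    using supercritical_if_outer_closed[OF assms] by (auto simp: d_def)
  have oc': "outer_closed (lienard_field h' [:0, c:])"
    unfolding h'_def by (rule outer_closed_mirror[OF assms(2)])
  have sup': "0 < lead_coeff (- pcompose d [:0, -1:])"
    using supercritical_if_outer_closed[OF assms(1) oc'] by (simp add: d')
  then have "0 < - (lead_coeff d * (-1) ^ degree d)" by (simp only: mirror_lead_coeff(2))
  then have "odd (degree d)" using sup(2) by (cases "even (degree d)") auto
  then have deg: "3 \<le> degree d" using sup(1) by presburger
  then show "3 \<le> degree (h - monom (c\<^sup>2 / 8) 3)" "0 < lead_coeff (h - monom (c\<^sup>2 / 8) 3)"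
    using sup(2) by (auto simp: d_def)
  have *: "lead_coeff (h - h') \<le> 0 \<and> lead_coeff (h' - h) \<le> 0" if c: "0 < c'" "c'\<^sup>2 = c\<^sup>2"
      and oc: "outer_closed (lienard_field h [:0, c':])" "outer_closed (lienard_field h' [:0, c':])" for c'
  proof -
    obtain \<delta> B where b: "0 < \<delta>" "0 \<le> B" "\<And>x. 0 \<le> x \<Longrightarrow> (c'\<^sup>2 / 8 + \<delta>) * x ^ 3 - B \<le> poly h x"
      using cubic_bound_if_supercritical[of h c'] deg sup(2) unfolding c d_def by blast
    have "3 \<le> degree (h' - monom (c'\<^sup>2 / 8) 3)" "0 < lead_coeff (h' - monom (c'\<^sup>2 / 8) 3)"
      unfolding c d' using sup' deg mirror_lead_coeff(1)[of d] by auto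
    then obtain \<delta>' B' where b': "0 < \<delta>'" "0 \<le> B'" "\<And>x. 0 \<le> x \<Longrightarrow> (c'\<^sup>2 / 8 + \<delta>') * x ^ 3 - B' \<le> poly h' x"
      using cubic_bound_if_supercritical[of h' c'] by blast
    have "\<not> 0 < lead_coeff (h - h')"
      using not_outer_closed_if_asymmetric[OF c(1) h'_def b b'] oc(1) by blast
    moreover have "\<not> 0 < lead_coeff (h' - h)"
      using not_outer_closed_if_asymmetric[OF c(1) h'h[symmetric] b' b] oc(2) by blast
    ultimately show ?thesis by simp
  qed
  have "lead_coeff (h - h') \<le> 0 \<and> lead_coeff (h' - h) \<le> 0"
  proof (cases "0 < c")
    case True
    then show ?thesis using *[of c] assms(2) oc' by simp
  next
    case False
    then show ?thesis
      using *[of "- c"] assms(1) outer_closed_reverse[OF assms(2)] outer_closed_reverse[OF oc'] by simp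
  qed
  moreover have "lead_coeff (h' - h) = - lead_coeff (h - h')"
    by (metis lead_coeff_minus minus_diff_eq)
  ultimately have "lead_coeff (h - h') = 0" by linarith
  then have "h = h'" by (simp only: leading_coeff_0_iff right_minus_eq)
  then have "poly h (- x) = poly h' (- x)" by simp
  then show "poly h (- x) = - poly h x" by (simp add: h'_def poly_pcompose)
qed

text \<open>The quantity \<open>h - c\<^sup>2 x\<^sup>3 / 8\<close> treats the cases of degree three and of higher degree at once.\<close>

lemma supercritical_iff:
  fixes h :: "real poly"
  assumes "c \<noteq> 0"
  shows "3 \<le> degree (h - monom (c\<^sup>2 / 8) 3) \<and> 0 < lead_coeff (h - monom (c\<^sup>2 / 8) 3) \<longleftrightarrow>
    3 \<le> degree h \<and> (degree h = 3 \<longrightarrow> c\<^sup>2 / 8 < lead_coeff h) \<and> (3 < degree h \<longrightarrow> 0 < lead_coeff h)"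
proof -
  define m where "m = monom (c\<^sup>2 / 8) 3"
  have m: "degree m = 3" "coeff m 3 = c\<^sup>2 / 8" "\<And>i. i \<noteq> 3 \<Longrightarrow> coeff m i = 0"
    using assms by (auto simp: m_def degree_monom_eq)
  have le: "degree (h - m) \<le> max (degree h) 3"
    using degree_diff_le_max[of h m] m(1) by simp
  consider "degree h < 3" | "degree h = 3" | "3 < degree h" by linarith
  then show ?thesis
  proof cases
    case 1
    then have c3: "coeff (h - m) 3 = - (c\<^sup>2 / 8)" by (simp add: m coeff_eq_0)
    then have "3 \<le> degree (h - m)" using assms by (intro le_degree) simp
    then have "degree (h - m) = 3" using le 1 by simp
    then show ?thesis unfolding m_def[symmetric] using c3 1 assms by simp
  next
    case 2
    have c3: "coeff (h - m) 3 = lead_coeff h - c\<^sup>2 / 8" by (simp add: m 2)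
    have "degree (h - m) \<le> 3" using le 2 by simp
    show ?thesis
    proof (cases "3 \<le> degree (h - m)")
      case True
      then have d3: "degree (h - m) = 3" using \<open>degree (h - m) \<le> 3\<close> by simp
      then have "lead_coeff (h - m) = lead_coeff h - c\<^sup>2 / 8" using c3 by (simp only:)
      then show ?thesis unfolding m_def[symmetric] using d3 2 by (simp only:) auto
    next
      case False
      then have "coeff (h - m) 3 = 0" by (intro coeff_eq_0) simp
      then show ?thesis unfolding m_def[symmetric] using c3 2 False by simp
    qed
  next
    case 3
    have cd: "coeff (h - m) (degree h) = lead_coeff h" using 3 by (simp add: m)
    have "lead_coeff h \<noteq> 0" using 3 by auto
    then have "degree h \<le> degree (h - m)" using cd by (intro le_degree) simp
    then have "degree (h - m) = degree h" using le 3 by simp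
    then show ?thesis unfolding m_def[symmetric] using cd 3 by simp
  qed
qed

theorem theorem2:
  fixes m n k s :: nat and a b :: "nat \<Rightarrow> real" and g f :: "real poly"
  assumes "k \<le> m" and "s \<le> n"
    and "a k * a m * b s * b n \<noteq> 0"
    and "g = (\<Sum>i = k..m. monom (a i) i)"
    and "f = (\<Sum>i = s..n. monom (b i) i)"
    and "n = 1"
  shows "center_at_infinity (lienard_field g f) \<longleftrightarrow>
    (\<exists>(h :: real poly) (c :: real).
       rescales_to (lienard_field g f) (lienard_field h [:0, c:]) \<and>
       (\<forall>x. poly h (- x) = - poly h x) \<and>
       degree h \<ge> 3 \<and>
       (degree h = 3 \<longrightarrow> lead_coeff h > c\<^sup>2 / 8 \<and> c\<^sup>2 / 8 > 0) \<and>
       (degree h > 3 \<longrightarrow> lead_coeff h > 0))"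
    (is "?L \<longleftrightarrow> ?R")
proof
  define c where "c = b 1"
  have c: "c \<noteq> 0" using assms(3,6) by (simp add: c_def)
  obtain e where f: "f = [:e, c:]"
  proof -
    have "degree f \<le> 1"
      unfolding assms(5) using assms(6) by (intro degree_sum_le) (auto intro: order_trans[OF degree_monom_le])
    moreover have "coeff f 1 = c"
      using assms(2,5,6) by (simp add: coeff_sum c_def)
    ultimately have "f = [:coeff f 0, c:]"
      by (intro poly_eqI) (auto simp: coeff_pCons coeff_eq_0 split: nat.split)
    then show ?thesis by (rule that)
  qed
  \<comment> \<open>The translation by the zero of \<open>f\<close>.\<close>
  define \<beta> where "\<beta> = - e / c"
  define h where "h = pcompose g [:\<beta>, 1:]"
  assume ?L
  then have oc: "outer_closed (lienard_field g f)" by (simp add: center_at_infinity_iff)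
  have "rescales_to (lienard_field h [:0, c:]) (lienard_field g f)"
    unfolding rescales_to_def
    by (rule exI[of _ 1], rule exI[of _ "- \<beta>"], rule exI[of _ 1], rule exI[of _ 0], rule exI[of _ 1])
      (use c in \<open>simp add: lienard_field_def h_def poly_pcompose f \<beta>_def algebra_simps\<close>)
  from outer_closed_rescale[OF this oc] have oc': "outer_closed (lienard_field h [:0, c:])" .
  have "rescales_to (lienard_field g f) (lienard_field h [:0, c:])"
    unfolding rescales_to_def
    by (rule exI[of _ 1], rule exI[of _ \<beta>], rule exI[of _ 1], rule exI[of _ 0], rule exI[of _ 1])
      (use c in \<open>simp add: lienard_field_def h_def poly_pcompose f \<beta>_def algebra_simps\<close>)
  moreover have "\<forall>x. poly h (- x) = - poly h x" using odd_supercritical_if_outer_closed(3)[OF c oc'] by blast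
  moreover have "3 \<le> degree h \<and> (degree h = 3 \<longrightarrow> c\<^sup>2 / 8 < lead_coeff h) \<and> (3 < degree h \<longrightarrow> 0 < lead_coeff h)"
    using odd_supercritical_if_outer_closed(1,2)[OF c oc'] supercritical_iff[OF c, of h] by blast
  moreover have "0 < c\<^sup>2 / 8" using c by simp
  ultimately show ?R by blast
next
  assume ?R
  then obtain h c where rs: "rescales_to (lienard_field g f) (lienard_field h [:0, c:])"
    and odd: "\<And>x. poly h (- x) = - poly h x"
    and deg: "3 \<le> degree h" "degree h = 3 \<longrightarrow> c\<^sup>2 / 8 < lead_coeff h \<and> 0 < c\<^sup>2 / 8"
      "3 < degree h \<longrightarrow> 0 < lead_coeff h"
    by blast
  have "3 \<le> degree (h - monom (c\<^sup>2 / 8) 3) \<and> 0 < lead_coeff (h - monom (c\<^sup>2 / 8) 3)"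
  proof (cases "c = 0")
    case True
    then show ?thesis using deg by (cases "degree h = 3") auto
  next
    case False
    then show ?thesis using deg supercritical_iff[OF False, of h] by blast
  qed
  then obtain \<delta> B where "0 < \<delta>" "0 \<le> B" "\<And>x. 0 \<le> x \<Longrightarrow> (c\<^sup>2 / 8 + \<delta>) * x ^ 3 - B \<le> poly h x"
    using cubic_bound_if_supercritical[of h c] by blast
  from outer_closed_if_odd[OF odd this] have "outer_closed (lienard_field h [:0, c:])" .
  from outer_closed_rescale[OF rs this] show ?L by (simp add: center_at_infinity_iff)
qed

end
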